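(* Let $\Omega$ be a locally compact Hausdorff space, let $\mathcal{U}=\{\Omega,A_t,\Theta\}$ be a locally trivial continuous field of Banach algebras, and let $\mathcal{A}$ be the Banach algebra defined by $\mathcal{U}$. If $\mathcal{A}$ is left projective (respectively right projective, respectively biprojective), then the Banach algebras $A_x$, $x\in\Omega$, are uniformly left projective (respectively uniformly right projective, respectively uniformly biprojective).
   Context: Continuous fields. A continuous field of Banach algebras is a triple $\mathcal{U}=\{\Omega,A_t,\Theta\}$ where $\Omega$ is a locally compact Hausdorff space, $(A_t)_{t\in\Omega}$ is a family of Banach algebras, and $\Theta$ is a subalgebra of $\prod_{t\in\Omega}A_t$ such that: (i) for every $t\in\Omega$ the set $\{x(t):x\in\Theta\}$ is dense in $A_t$; (ii) for every $x\in\Theta$ the function $t\mapsto\|x(t)\|$ is continuous on $\Omega$; (iii) if $x\in\prod_{t}A_t$ and for every $t\in\Omega$ and every $\varepsilon>0$ there is $x'\in\Theta$ with $\|x(s)-x'(s)\|\le\varepsilon$ for all $s$ in some neighbourhood of $t$, then $x\in\Theta$. The Banach algebra $\mathcal{A}$ defined by $\mathcal{U}$ is the set of $x\in\Theta$ such that $t\mapsto\|x(t)\|$ vanishes at infinity on $\Omega$, with pointwise operations and norm $\|x\|=\sup_t\|x(t)\|$. For $Y\subseteq\Omega$, the induced field is $\mathcal{U}|_Y=\{Y,(A_t)_{t\in Y},\Theta|_Y\}$, where $\Theta|_Y$ is the set of $x\in\prod_{t\in Y}A_t$ such that for every $t_0\in Y$ and $\varepsilon>0$ there is $x'\in\Theta$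 with $\|x(t)-x'(t)\|\le\varepsilon$ for all $t\in Y$ in some neighbourhood of $t_0$. An isomorphism of fields over the same space is a family of isometric algebra isomorphisms $\phi_t:A_t\to A'_t$ carrying $\Theta$ into $\Theta'$. The constant field over $\Omega$ defined by a Banach algebra $A$ has $A_t=A$ for all $t$ and $\Theta$ equal to the algebra of all continuous maps $\Omega\to A$. A field is trivial if it is isomorphic to a constant field, and locally trivial if every point of $\Omega$ has a neighbourhood $V$ such that $\mathcal{U}|_V$ is trivial. Projectivity. $\widehat{\otimes}$ is the projective tensor product of Banach spaces; $B_+$ is the Banach algebra obtained by adjoining an identity to a Banach algebra $B$. A module $P$ in a category of Banach modules (left, right or bimodules over $B$) is projective if every epimorphism of modules $\varphi:Y\to P$ that has a right inverse as a morphism of Banach spaces has a right inverse that is a morphism of modules. $B$ is left projective, right projective, biprojective if it is projective as a left Banach $B$-module, right Banach $B$-module, Banach $B$-bimodule, respectively. Uniform projectivity. The algebras $A_x$, $x\in\Omega$, are uniformly left projective if for every $x\in\Omega$ there is a morphism of left Banach $A_x$-modules $\rho_x:A_x\to(A_x)_+\widehat{\otimes}A_x$ with $\pi\circ\rho_x=\mathrm{id}_{A_x}$ and $\sup_{x\in\Omega}\|\rho_x\|<\infty$, where $\pi(a\otimes b)=ab$. They are uniformly right projective if the same holds with morphisms of right modules $\rho_x:A_x\to A_x\widehat{\otimes}(A_x)_+$, and uniformly biprojective if the same holds with morphisms of bimodules $\rho_x:A_x\to A_x\widehat{\otimes}A_x$. *)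

theory Defs
  imports
    "HOL-Analysis.Analysis"
    "HOL-Algebra.Module"
    "HOL-Library.Poly_Mapping"
begin

section \<open>Banach spaces and Banach algebras with explicit carriers\<close>

text \<open>
  Scalars are complex. The fibres of a field are different Banach algebras, and algebras of
  sections and tensor products are built from them, so all spaces live on carrier sets, as in
  HOL-Algebra. The inherited fields \<open>mult\<close> and \<open>one\<close> play no role for a Banach space;
  for a Banach algebra \<open>mult\<close> is the product, and \<open>one\<close> is again ignored, since no
  identity is assumed.
\<close>

definition complex_ring :: "complex ring" where
  "complex_ring = \<lparr>carrier = UNIV, mult = (*), one = 1, zero = 0, add = (+)\<rparr>"

record 'v nspace = "(complex, 'v) module" +
  nrm :: "'v \<Rightarrow> real"

text \<open>
  The locale \<open>Metric_space\<close> asks for symmetry and nonnegativity on the whole type, hence the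
  value off the carrier.
\<close>

definition ndist :: "'v nspace \<Rightarrow> 'v \<Rightarrow> 'v \<Rightarrow> real" where
  "ndist V x y = (if x \<in> carrier V \<and> y \<in> carrier V then nrm V (x \<ominus>\<^bsub>V\<^esub> y) else 0)"

locale banach_space = Module.module complex_ring V
  for V :: "'v nspace" (structure) +
  assumes nrm_eq_0_iff: "x \<in> carrier V \<Longrightarrow> nrm V x = 0 \<longleftrightarrow> x = \<zero>"
    and nrm_triangle: "\<lbrakk>x \<in> carrier V; y \<in> carrier V\<rbrakk> \<Longrightarrow> nrm V (x \<oplus> y) \<le> nrm V x + nrm V y"
    and nrm_smult: "x \<in> carrier V \<Longrightarrow> nrm V (c \<odot> x) = cmod c * nrm V x"
    and complete: "Metric_space.mcomplete (carrier V) (ndist V)"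

definition linear_map :: "'v nspace \<Rightarrow> 'w nspace \<Rightarrow> ('v \<Rightarrow> 'w) \<Rightarrow> bool" where
  "linear_map V W T \<longleftrightarrow>
     T \<in> carrier V \<rightarrow> carrier W \<and>
     (\<forall>x\<in>carrier V. \<forall>y\<in>carrier V. T (x \<oplus>\<^bsub>V\<^esub> y) = T x \<oplus>\<^bsub>W\<^esub> T y) \<and>
     (\<forall>c. \<forall>x\<in>carrier V. T (c \<odot>\<^bsub>V\<^esub> x) = c \<odot>\<^bsub>W\<^esub> T x)"

definition bounded_linear_map :: "'v nspace \<Rightarrow> 'w nspace \<Rightarrow> ('v \<Rightarrow> 'w) \<Rightarrow> bool" where
  "bounded_linear_map V W T \<longleftrightarrow>
     linear_map V W T \<and> (\<exists>K. \<forall>x\<in>carrier V. nrm W (T x) \<le> K * nrm V x)"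

definition op_norm :: "'v nspace \<Rightarrow> 'w nspace \<Rightarrow> ('v \<Rightarrow> 'w) \<Rightarrow> real" where
  "op_norm V W T = Sup {nrm W (T x) | x. x \<in> carrier V \<and> nrm V x \<le> 1}"

definition bilinear_map ::
  "'u nspace \<Rightarrow> 'v nspace \<Rightarrow> 'w nspace \<Rightarrow> ('u \<Rightarrow> 'v \<Rightarrow> 'w) \<Rightarrow> bool" where
  "bilinear_map U V W \<beta> \<longleftrightarrow>
     (\<forall>x\<in>carrier U. linear_map V W (\<beta> x)) \<and>
     (\<forall>y\<in>carrier V. linear_map U W (\<lambda>x. \<beta> x y))"

definition bounded_bilinear_map ::
  "'u nspace \<Rightarrow> 'v nspace \<Rightarrow> 'w nspace \<Rightarrow> ('u \<Rightarrow> 'v \<Rightarrow> 'w) \<Rightarrow> bool" where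
  "bounded_bilinear_map U V W \<beta> \<longleftrightarrow>
     bilinear_map U V W \<beta> \<and>
     (\<exists>K. \<forall>x\<in>carrier U. \<forall>y\<in>carrier V. nrm W (\<beta> x y) \<le> K * nrm U x * nrm V y)"

locale banach_algebra = banach_space A for A :: "'a nspace" (structure) +
  assumes mult_bilinear: "bilinear_map A A A (mult A)"
    and mult_assoc: "\<lbrakk>x \<in> carrier A; y \<in> carrier A; z \<in> carrier A\<rbrakk>
                       \<Longrightarrow> (x \<otimes> y) \<otimes> z = x \<otimes> (y \<otimes> z)"
    and nrm_mult_le: "\<lbrakk>x \<in> carrier A; y \<in> carrier A\<rbrakk> \<Longrightarrow> nrm A (x \<otimes> y) \<le> nrm A x * nrm A y"

definition isometric_alg_iso :: "'a nspace \<Rightarrow> 'b nspace \<Rightarrow> ('a \<Rightarrow> 'b) \<Rightarrow> bool" where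
  "isometric_alg_iso A B \<phi> \<longleftrightarrow>
     linear_map A B \<phi> \<and> bij_betw \<phi> (carrier A) (carrier B) \<and>
     (\<forall>x\<in>carrier A. \<forall>y\<in>carrier A. \<phi> (x \<otimes>\<^bsub>A\<^esub> y) = \<phi> x \<otimes>\<^bsub>B\<^esub> \<phi> y) \<and>
     (\<forall>x\<in>carrier A. nrm B (\<phi> x) = nrm A x)"

text \<open>The algebra \<open>A\<^sub>+\<close>: an identity is adjoined even if \<open>A\<close> already has one.\<close>

type_synonym 'a plus_elt = "complex \<times> 'a"

definition unitization :: "'a nspace \<Rightarrow> 'a plus_elt nspace" where
  "unitization A =
     \<lparr>carrier = UNIV \<times> carrier A,
      mult = (\<lambda>(c, a) (d, b). (c * d, (c \<odot>\<^bsub>A\<^esub> b \<oplus>\<^bsub>A\<^esub> d \<odot>\<^bsub>A\<^esub> a) \<oplus>\<^bsub>A\<^esub> a \<otimes>\<^bsub>A\<^esub> b)),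
      one = (1, \<zero>\<^bsub>A\<^esub>),
      zero = (0, \<zero>\<^bsub>A\<^esub>),
      add = (\<lambda>(c, a) (d, b). (c + d, a \<oplus>\<^bsub>A\<^esub> b)),
      smult = (\<lambda>k (c, a). (k * c, k \<odot>\<^bsub>A\<^esub> a)),
      nrm = (\<lambda>(c, a). cmod c + nrm A a)\<rparr>"


section \<open>The projective tensor product\<close>

text \<open>
  Hausdorff completion of a set \<open>S\<close> of vectors, closed under linear combinations, under a
  seminorm \<open>p\<close>: Cauchy sequences in \<open>S\<close> modulo sequences tending to zero.
\<close>

definition seminorm_Cauchy :: "'v::ab_group_add set \<Rightarrow> ('v \<Rightarrow> real) \<Rightarrow> (nat \<Rightarrow> 'v) set" where
  "seminorm_Cauchy S p =
     {s. range s \<subseteq> S \<and> (\<forall>\<epsilon>>0. \<exists>N. \<forall>m\<ge>N. \<forall>n\<ge>N. p (s m - s n) < \<epsilon>)}"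

definition completion_class ::
  "'v::ab_group_add set \<Rightarrow> ('v \<Rightarrow> real) \<Rightarrow> (nat \<Rightarrow> 'v) \<Rightarrow> (nat \<Rightarrow> 'v) set" where
  "completion_class S p s = {s' \<in> seminorm_Cauchy S p. (\<lambda>n. p (s n - s' n)) \<longlonglongrightarrow> 0}"

definition seminorm_completion ::
  "'v::ab_group_add set \<Rightarrow> (complex \<Rightarrow> 'v \<Rightarrow> 'v) \<Rightarrow> ('v \<Rightarrow> real) \<Rightarrow> (nat \<Rightarrow> 'v) set nspace" where
  "seminorm_completion S sc p =
     \<lparr>carrier = completion_class S p ` seminorm_Cauchy S p,
      mult = undefined,
      one = undefined,
      zero = completion_class S p (\<lambda>n. 0),
      add = (\<lambda>C D. \<Union>s\<in>C. \<Union>t\<in>D. completion_class S p (\<lambda>n. s n + t n)),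
      smult = (\<lambda>k C. \<Union>s\<in>C. completion_class S p (\<lambda>n. sc k (s n))),
      nrm = (\<lambda>C. THE r. \<forall>s\<in>C. (\<lambda>n. p (s n)) \<longlonglongrightarrow> r)\<rparr>"

text \<open>
  The algebraic tensor product of \<open>E\<close> and \<open>F\<close> is the free complex vector space on
  \<open>carrier E \<times> carrier F\<close> (finitely supported functions; \<open>Poly_Mapping.single (x, y) 1\<close>
  is the formal symbol of the tensor of \<open>x\<close> and \<open>y\<close>) modulo the span of the bilinearity
  relations. Its projective norm, pulled back to the free space, is \<open>projective_seminorm\<close>;
  the Hausdorff completion of the free space under this seminorm is the completion of the
  algebraic tensor product under its projective norm.
\<close>

type_synonym ('e, 'f) formal_tensor = "'e \<times> 'f \<Rightarrow>\<^sub>0 complex"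
type_synonym ('e, 'f) tensor_elt = "(nat \<Rightarrow> ('e, 'f) formal_tensor) set"

definition formal_scale :: "complex \<Rightarrow> ('e, 'f) formal_tensor \<Rightarrow> ('e, 'f) formal_tensor" where
  "formal_scale c u = Poly_Mapping.map ((*) c) u"

definition formal_tensors :: "'e nspace \<Rightarrow> 'f nspace \<Rightarrow> ('e, 'f) formal_tensor set" where
  "formal_tensors E F = {u. Poly_Mapping.keys u \<subseteq> carrier E \<times> carrier F}"

definition bilinearity_relations :: "'e nspace \<Rightarrow> 'f nspace \<Rightarrow> ('e, 'f) formal_tensor set" where
  "bilinearity_relations E F =
     {Poly_Mapping.single (x \<oplus>\<^bsub>E\<^esub> x', y) 1 - Poly_Mapping.single (x, y) 1
        - Poly_Mapping.single (x', y) 1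
      | x x' y. x \<in> carrier E \<and> x' \<in> carrier E \<and> y \<in> carrier F} \<union>
     {Poly_Mapping.single (x, y \<oplus>\<^bsub>F\<^esub> y') 1 - Poly_Mapping.single (x, y) 1
        - Poly_Mapping.single (x, y') 1
      | x y y'. x \<in> carrier E \<and> y \<in> carrier F \<and> y' \<in> carrier F} \<union>
     {Poly_Mapping.single (c \<odot>\<^bsub>E\<^esub> x, y) 1 - Poly_Mapping.single (x, y) c
      | c x y. x \<in> carrier E \<and> y \<in> carrier F} \<union>
     {Poly_Mapping.single (x, c \<odot>\<^bsub>F\<^esub> y) 1 - Poly_Mapping.single (x, y) c
      | c x y. x \<in> carrier E \<and> y \<in> carrier F}"

definition tensor_null :: "'e nspace \<Rightarrow> 'f nspace \<Rightarrow> ('e, 'f) formal_tensor set" where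
  "tensor_null E F = Modules.module.span formal_scale (bilinearity_relations E F)"

definition projective_seminorm ::
  "'e nspace \<Rightarrow> 'f nspace \<Rightarrow> ('e, 'f) formal_tensor \<Rightarrow> real" where
  "projective_seminorm E F u =
     Inf {(\<Sum>(x, y)\<leftarrow>zs. nrm E x * nrm F y) | zs.
            set zs \<subseteq> carrier E \<times> carrier F \<and>
            u - (\<Sum>z\<leftarrow>zs. Poly_Mapping.single z 1) \<in> tensor_null E F}"

definition ptensor :: "'e nspace \<Rightarrow> 'f nspace \<Rightarrow> ('e, 'f) tensor_elt nspace"
    (infixr \<open>\<otimes>\<^sub>\<pi>\<close> 75) where
  "E \<otimes>\<^sub>\<pi> F = seminorm_completion (formal_tensors E F) formal_scale (projective_seminorm E F)"

definition pure_tensor :: "'e nspace \<Rightarrow> 'f nspace \<Rightarrow> 'e \<Rightarrow> 'f \<Rightarrow> ('e, 'f) tensor_elt" where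
  "pure_tensor E F x y =
     completion_class (formal_tensors E F) (projective_seminorm E F)
       (\<lambda>n. Poly_Mapping.single (x, y) 1)"

text \<open>
  The bounded operator on \<open>E \<otimes>\<^sub>\<pi> F\<close> induced by a bounded bilinear map \<open>\<beta>\<close>. Extensionality makes
  it unique as a HOL function.
\<close>

definition ptensor_lift ::
  "'e nspace \<Rightarrow> 'f nspace \<Rightarrow> 'g nspace \<Rightarrow> ('e \<Rightarrow> 'f \<Rightarrow> 'g) \<Rightarrow> ('e, 'f) tensor_elt \<Rightarrow> 'g" where
  "ptensor_lift E F G \<beta> =
     (THE L. L \<in> extensional (carrier (E \<otimes>\<^sub>\<pi> F)) \<and> bounded_linear_map (E \<otimes>\<^sub>\<pi> F) G L \<and>
             (\<forall>x\<in>carrier E. \<forall>y\<in>carrier F. L (pure_tensor E F x y) = \<beta> x y))"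


section \<open>Banach modules and projectivity\<close>

text \<open>Outer multiplications are jointly bounded, not necessarily contractive.\<close>

definition left_banach_module :: "'b nspace \<Rightarrow> 'y nspace \<Rightarrow> ('b \<Rightarrow> 'y \<Rightarrow> 'y) \<Rightarrow> bool" where
  "left_banach_module B Y l \<longleftrightarrow>
     banach_space Y \<and> bounded_bilinear_map B Y Y l \<and>
     (\<forall>a\<in>carrier B. \<forall>b\<in>carrier B. \<forall>y\<in>carrier Y. l (a \<otimes>\<^bsub>B\<^esub> b) y = l a (l b y))"

definition right_banach_module :: "'b nspace \<Rightarrow> 'y nspace \<Rightarrow> ('y \<Rightarrow> 'b \<Rightarrow> 'y) \<Rightarrow> bool" where
  "right_banach_module B Y r \<longleftrightarrow>
     banach_space Y \<and> bounded_bilinear_map Y B Y r \<and>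
     (\<forall>a\<in>carrier B. \<forall>b\<in>carrier B. \<forall>y\<in>carrier Y. r y (a \<otimes>\<^bsub>B\<^esub> b) = r (r y a) b)"

definition banach_bimodule ::
  "'b nspace \<Rightarrow> 'y nspace \<Rightarrow> ('b \<Rightarrow> 'y \<Rightarrow> 'y) \<Rightarrow> ('y \<Rightarrow> 'b \<Rightarrow> 'y) \<Rightarrow> bool" where
  "banach_bimodule B Y l r \<longleftrightarrow>
     left_banach_module B Y l \<and> right_banach_module B Y r \<and>
     (\<forall>a\<in>carrier B. \<forall>b\<in>carrier B. \<forall>y\<in>carrier Y. r (l a y) b = l a (r y b))"

definition left_module_morphism ::
  "'b nspace \<Rightarrow> 'y nspace \<Rightarrow> ('b \<Rightarrow> 'y \<Rightarrow> 'y) \<Rightarrow> 'z nspace \<Rightarrow> ('b \<Rightarrow> 'z \<Rightarrow> 'z) \<Rightarrow> ('y \<Rightarrow> 'z) \<Rightarrow> bool" where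
  "left_module_morphism B Y l Z l' T \<longleftrightarrow>
     bounded_linear_map Y Z T \<and> (\<forall>b\<in>carrier B. \<forall>y\<in>carrier Y. T (l b y) = l' b (T y))"

definition right_module_morphism ::
  "'b nspace \<Rightarrow> 'y nspace \<Rightarrow> ('y \<Rightarrow> 'b \<Rightarrow> 'y) \<Rightarrow> 'z nspace \<Rightarrow> ('z \<Rightarrow> 'b \<Rightarrow> 'z) \<Rightarrow> ('y \<Rightarrow> 'z) \<Rightarrow> bool" where
  "right_module_morphism B Y r Z r' T \<longleftrightarrow>
     bounded_linear_map Y Z T \<and> (\<forall>b\<in>carrier B. \<forall>y\<in>carrier Y. T (r y b) = r' (T y) b)"

definition bimodule_morphism ::
  "'b nspace \<Rightarrow> 'y nspace \<Rightarrow> ('b \<Rightarrow> 'y \<Rightarrow> 'y) \<Rightarrow> ('y \<Rightarrow> 'b \<Rightarrow> 'y) \<Rightarrow>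
   'z nspace \<Rightarrow> ('b \<Rightarrow> 'z \<Rightarrow> 'z) \<Rightarrow> ('z \<Rightarrow> 'b \<Rightarrow> 'z) \<Rightarrow> ('y \<Rightarrow> 'z) \<Rightarrow> bool" where
  "bimodule_morphism B Y l r Z l' r' T \<longleftrightarrow>
     left_module_morphism B Y l Z l' T \<and> right_module_morphism B Y r Z r' T"

text \<open>
  \<open>T\<close> has a right inverse among the maps satisfying \<open>Q\<close>. Below, \<open>Q\<close> is either
  "bounded linear" or "morphism of modules".
\<close>

definition has_right_inverse :: "'z nspace \<Rightarrow> (('z \<Rightarrow> 'y) \<Rightarrow> bool) \<Rightarrow> ('y \<Rightarrow> 'z) \<Rightarrow> bool" where
  "has_right_inverse Z Q T \<longleftrightarrow> (\<exists>\<sigma>. Q \<sigma> \<and> (\<forall>z\<in>carrier Z. T (\<sigma> z) = z))"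

text \<open>
  Epimorphisms are rendered as surjective morphisms. Reading them categorically (dense range)
  changes nothing, since a right inverse of \<open>\<phi>\<close> already forces \<open>\<phi>\<close> to be surjective.

  HOL cannot quantify over all types inside a formula, so the modules \<open>Y\<close> range over those whose
  carrier lies in a given type \<open>'y\<close>. A smaller type gives a formally weaker property. Nothing is
  lost once \<open>'y\<close> can carry the canonical module mapping onto \<open>P\<close> (\<open>B\<^sub>+ \<otimes>\<^sub>\<pi> P\<close>,
  \<open>P \<otimes>\<^sub>\<pi> B\<^sub>+\<close>, \<open>B\<^sub>+ \<otimes>\<^sub>\<pi> P \<otimes>\<^sub>\<pi> B\<^sub>+\<close>, respectively): this module has the
  lifting property against all admissible epimorphisms, and \<open>P\<close> inherits it as soon as the
  canonical epimorphism onto \<open>P\<close> splits.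
\<close>

definition projective_left_module ::
  "'y itself \<Rightarrow> 'b nspace \<Rightarrow> 'p nspace \<Rightarrow> ('b \<Rightarrow> 'p \<Rightarrow> 'p) \<Rightarrow> bool" where
  "projective_left_module (_ :: 'y itself) B P l \<longleftrightarrow>
     (\<forall>(Y :: 'y nspace) lY \<phi>.
        left_banach_module B Y lY \<and> left_module_morphism B Y lY P l \<phi> \<and>
        \<phi> ` carrier Y = carrier P \<and>
        has_right_inverse P (bounded_linear_map P Y) \<phi>
        \<longrightarrow> has_right_inverse P (left_module_morphism B P l Y lY) \<phi>)"

definition projective_right_module ::
  "'y itself \<Rightarrow> 'b nspace \<Rightarrow> 'p nspace \<Rightarrow> ('p \<Rightarrow> 'b \<Rightarrow> 'p) \<Rightarrow> bool" where
  "projective_right_module (_ :: 'y itself) B P r \<longleftrightarrow>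
     (\<forall>(Y :: 'y nspace) rY \<phi>.
        right_banach_module B Y rY \<and> right_module_morphism B Y rY P r \<phi> \<and>
        \<phi> ` carrier Y = carrier P \<and>
        has_right_inverse P (bounded_linear_map P Y) \<phi>
        \<longrightarrow> has_right_inverse P (right_module_morphism B P r Y rY) \<phi>)"

definition projective_bimodule ::
  "'y itself \<Rightarrow> 'b nspace \<Rightarrow> 'p nspace \<Rightarrow> ('b \<Rightarrow> 'p \<Rightarrow> 'p) \<Rightarrow> ('p \<Rightarrow> 'b \<Rightarrow> 'p) \<Rightarrow> bool" where
  "projective_bimodule (_ :: 'y itself) B P l r \<longleftrightarrow>
     (\<forall>(Y :: 'y nspace) lY rY \<phi>.
        banach_bimodule B Y lY rY \<and> bimodule_morphism B Y lY rY P l r \<phi> \<and>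
        \<phi> ` carrier Y = carrier P \<and>
        has_right_inverse P (bounded_linear_map P Y) \<phi>
        \<longrightarrow> has_right_inverse P (bimodule_morphism B P l r Y lY rY) \<phi>)"

definition left_projective :: "'b nspace \<Rightarrow> bool" where
  "left_projective B \<longleftrightarrow>
     projective_left_module TYPE(('b plus_elt, 'b) tensor_elt) B B (mult B)"

definition right_projective :: "'b nspace \<Rightarrow> bool" where
  "right_projective B \<longleftrightarrow>
     projective_right_module TYPE(('b, 'b plus_elt) tensor_elt) B B (mult B)"

definition biprojective :: "'b nspace \<Rightarrow> bool" where
  "biprojective B \<longleftrightarrow>
     projective_bimodule TYPE(('b plus_elt, ('b, 'b plus_elt) tensor_elt) tensor_elt)
       B B (mult B) (mult B)"


section \<open>Uniform projectivity\<close>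

text \<open>\<open>a \<cdot> (x \<otimes> y) = (a \<cdot> x) \<otimes> y\<close> and \<open>(x \<otimes> y) \<cdot> a = x \<otimes> (y \<cdot> a)\<close>.\<close>

definition tensor_left_action ::
  "'e nspace \<Rightarrow> 'f nspace \<Rightarrow> ('b \<Rightarrow> 'e \<Rightarrow> 'e) \<Rightarrow> 'b \<Rightarrow> ('e, 'f) tensor_elt \<Rightarrow> ('e, 'f) tensor_elt" where
  "tensor_left_action E F l a = ptensor_lift E F (E \<otimes>\<^sub>\<pi> F) (\<lambda>x y. pure_tensor E F (l a x) y)"

definition tensor_right_action ::
  "'e nspace \<Rightarrow> 'f nspace \<Rightarrow> ('f \<Rightarrow> 'b \<Rightarrow> 'f) \<Rightarrow> ('e, 'f) tensor_elt \<Rightarrow> 'b \<Rightarrow> ('e, 'f) tensor_elt" where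
  "tensor_right_action E F r w a = ptensor_lift E F (E \<otimes>\<^sub>\<pi> F) (\<lambda>x y. pure_tensor E F x (r y a)) w"

text \<open>
  \<open>A\<close> acts on \<open>A\<^sub>+\<close> through its embedding \<open>a \<mapsto> (0, a)\<close> as an ideal; \<open>A\<^sub>+\<close> acts on \<open>A\<close>
  likewise, by \<open>(c, a) \<cdot> b = c b + a b\<close> and \<open>b \<cdot> (c, a) = c b + b a\<close>.
\<close>

definition plus_left :: "'a nspace \<Rightarrow> 'a \<Rightarrow> 'a plus_elt \<Rightarrow> 'a plus_elt" where
  "plus_left A a u = (0, a) \<otimes>\<^bsub>unitization A\<^esub> u"

definition plus_right :: "'a nspace \<Rightarrow> 'a plus_elt \<Rightarrow> 'a \<Rightarrow> 'a plus_elt" where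
  "plus_right A u a = u \<otimes>\<^bsub>unitization A\<^esub> (0, a)"

definition left_product :: "'a nspace \<Rightarrow> ('a plus_elt, 'a) tensor_elt \<Rightarrow> 'a" where
  "left_product A =
     ptensor_lift (unitization A) A A (\<lambda>(c, a) b. c \<odot>\<^bsub>A\<^esub> b \<oplus>\<^bsub>A\<^esub> a \<otimes>\<^bsub>A\<^esub> b)"

definition right_product :: "'a nspace \<Rightarrow> ('a, 'a plus_elt) tensor_elt \<Rightarrow> 'a" where
  "right_product A =
     ptensor_lift A (unitization A) A (\<lambda>b (c, a). c \<odot>\<^bsub>A\<^esub> b \<oplus>\<^bsub>A\<^esub> b \<otimes>\<^bsub>A\<^esub> a)"

definition bi_product :: "'a nspace \<Rightarrow> ('a, 'a) tensor_elt \<Rightarrow> 'a" where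
  "bi_product A = ptensor_lift A A A (mult A)"

definition uniformly_left_projective :: "'x set \<Rightarrow> ('x \<Rightarrow> 'a nspace) \<Rightarrow> bool" where
  "uniformly_left_projective I A \<longleftrightarrow>
     (\<exists>\<rho>. (\<forall>x\<in>I. left_module_morphism (A x) (A x) (mult (A x))
                  (unitization (A x) \<otimes>\<^sub>\<pi> A x)
                  (tensor_left_action (unitization (A x)) (A x) (plus_left (A x))) (\<rho> x) \<and>
                (\<forall>a\<in>carrier (A x). left_product (A x) (\<rho> x a) = a)) \<and>
          bdd_above ((\<lambda>x. op_norm (A x) (unitization (A x) \<otimes>\<^sub>\<pi> A x) (\<rho> x)) ` I))"

definition uniformly_right_projective :: "'x set \<Rightarrow> ('x \<Rightarrow> 'a nspace) \<Rightarrow> bool" where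
  "uniformly_right_projective I A \<longleftrightarrow>
     (\<exists>\<rho>. (\<forall>x\<in>I. right_module_morphism (A x) (A x) (mult (A x))
                  (A x \<otimes>\<^sub>\<pi> unitization (A x))
                  (tensor_right_action (A x) (unitization (A x)) (plus_right (A x))) (\<rho> x) \<and>
                (\<forall>a\<in>carrier (A x). right_product (A x) (\<rho> x a) = a)) \<and>
          bdd_above ((\<lambda>x. op_norm (A x) (A x \<otimes>\<^sub>\<pi> unitization (A x)) (\<rho> x)) ` I))"

definition uniformly_biprojective :: "'x set \<Rightarrow> ('x \<Rightarrow> 'a nspace) \<Rightarrow> bool" where
  "uniformly_biprojective I A \<longleftrightarrow>
     (\<exists>\<rho>. (\<forall>x\<in>I. bimodule_morphism (A x) (A x) (mult (A x)) (mult (A x))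
                  (A x \<otimes>\<^sub>\<pi> A x)
                  (tensor_left_action (A x) (A x) (mult (A x)))
                  (tensor_right_action (A x) (A x) (mult (A x))) (\<rho> x) \<and>
                (\<forall>a\<in>carrier (A x). bi_product (A x) (\<rho> x a) = a)) \<and>
          bdd_above ((\<lambda>x. op_norm (A x) (A x \<otimes>\<^sub>\<pi> A x) (\<rho> x)) ` I))"


section \<open>Continuous fields of Banach algebras\<close>

text \<open>
  All fibres have their carriers in one type \<open>'a\<close>; this is no restriction, as any family of
  algebras can be placed in a disjoint union. Sections are extensional functions on the base.
\<close>

record ('x, 'a) field_data =
  base :: "'x topology"
  fibre :: "'x \<Rightarrow> 'a nspace"
  sections :: "('x \<Rightarrow> 'a) set"

definition product_algebra :: "'x set \<Rightarrow> ('x \<Rightarrow> 'a nspace) \<Rightarrow> (complex, 'x \<Rightarrow> 'a) module" where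
  "product_algebra I A =
     \<lparr>carrier = (\<Pi>\<^sub>E t\<in>I. carrier (A t)),
      mult = (\<lambda>x y. \<lambda>t\<in>I. x t \<otimes>\<^bsub>A t\<^esub> y t),
      one = undefined,
      zero = (\<lambda>t\<in>I. \<zero>\<^bsub>A t\<^esub>),
      add = (\<lambda>x y. \<lambda>t\<in>I. x t \<oplus>\<^bsub>A t\<^esub> y t),
      smult = (\<lambda>c x. \<lambda>t\<in>I. c \<odot>\<^bsub>A t\<^esub> x t)\<rparr>"

definition subalgebra_set :: "'x set \<Rightarrow> ('x \<Rightarrow> 'a nspace) \<Rightarrow> ('x \<Rightarrow> 'a) set \<Rightarrow> bool" where
  "subalgebra_set I A \<Theta> \<longleftrightarrow>
     \<Theta> \<subseteq> carrier (product_algebra I A) \<and> \<zero>\<^bsub>product_algebra I A\<^esub> \<in> \<Theta> \<and>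
     (\<forall>x\<in>\<Theta>. \<forall>y\<in>\<Theta>. x \<oplus>\<^bsub>product_algebra I A\<^esub> y \<in> \<Theta> \<and> x \<otimes>\<^bsub>product_algebra I A\<^esub> y \<in> \<Theta>) \<and>
     (\<forall>c. \<forall>x\<in>\<Theta>. c \<odot>\<^bsub>product_algebra I A\<^esub> x \<in> \<Theta>)"

text \<open>\<open>x\<close> is, near every point of \<open>Y\<close>, a uniform limit on \<open>Y\<close> of elements of \<open>\<Theta>\<close>.\<close>

definition locally_approximable ::
  "'x topology \<Rightarrow> ('x \<Rightarrow> 'a nspace) \<Rightarrow> ('x \<Rightarrow> 'a) set \<Rightarrow> 'x set \<Rightarrow> ('x \<Rightarrow> 'a) \<Rightarrow> bool" where
  "locally_approximable X A \<Theta> Y x \<longleftrightarrow>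
     (\<forall>t\<in>Y. \<forall>\<epsilon>>0. \<exists>x'\<in>\<Theta>. \<exists>W. openin X W \<and> t \<in> W \<and>
        (\<forall>s\<in>W \<inter> Y. ndist (A s) (x s) (x' s) \<le> \<epsilon>))"

definition continuous_field :: "('x, 'a) field_data \<Rightarrow> bool" where
  "continuous_field \<U> \<longleftrightarrow>
     (let X = base \<U>; A = fibre \<U>; \<Theta> = sections \<U> in
        locally_compact_space X \<and> Hausdorff_space X \<and>
        (\<forall>t\<in>topspace X. banach_algebra (A t)) \<and>
        subalgebra_set (topspace X) A \<Theta> \<and>
        (\<forall>t\<in>topspace X. \<forall>a\<in>carrier (A t). \<forall>\<epsilon>>0. \<exists>x\<in>\<Theta>. ndist (A t) (x t) a < \<epsilon>) \<and>
        (\<forall>x\<in>\<Theta>. continuous_map X euclideanreal (\<lambda>t. nrm (A t) (x t))) \<and>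
        (\<forall>x\<in>carrier (product_algebra (topspace X) A).
           locally_approximable X A \<Theta> (topspace X) x \<longrightarrow> x \<in> \<Theta>))"

definition vanishes_at_infinity :: "'x topology \<Rightarrow> ('x \<Rightarrow> real) \<Rightarrow> bool" where
  "vanishes_at_infinity X f \<longleftrightarrow>
     (\<forall>\<epsilon>>0. \<exists>K. compactin X K \<and> (\<forall>t\<in>topspace X - K. \<bar>f t\<bar> < \<epsilon>))"

text \<open>
  The Banach algebra defined by the field. Inserting \<open>0\<close> matters only for an empty base, where
  the supremum in \<open>real\<close> would be unspecified.
\<close>

definition field_algebra :: "('x, 'a) field_data \<Rightarrow> ('x \<Rightarrow> 'a) nspace" where
  "field_algebra \<U> =
     (let X = base \<U>; A = fibre \<U>; P = product_algebra (topspace X) A in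
      \<lparr>carrier = {x \<in> sections \<U>. vanishes_at_infinity X (\<lambda>t. nrm (A t) (x t))},
       mult = mult P,
       one = undefined,
       zero = zero P,
       add = add P,
       smult = smult P,
       nrm = (\<lambda>x. Sup (insert 0 ((\<lambda>t. nrm (A t) (x t)) ` topspace X)))\<rparr>)"

definition induced_field :: "('x, 'a) field_data \<Rightarrow> 'x set \<Rightarrow> ('x, 'a) field_data" where
  "induced_field \<U> Y =
     \<lparr>base = subtopology (base \<U>) Y,
      fibre = fibre \<U>,
      sections = {x \<in> carrier (product_algebra Y (fibre \<U>)).
                    locally_approximable (base \<U>) (fibre \<U>) (sections \<U>) Y x}\<rparr>"

definition field_isomorphism ::
  "('x, 'a) field_data \<Rightarrow> ('x, 'b) field_data \<Rightarrow> ('x \<Rightarrow> 'a \<Rightarrow> 'b) \<Rightarrow> bool" where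
  "field_isomorphism \<U> \<U>' \<phi> \<longleftrightarrow>
     base \<U> = base \<U>' \<and>
     (\<forall>t\<in>topspace (base \<U>). isometric_alg_iso (fibre \<U> t) (fibre \<U>' t) (\<phi> t)) \<and>
     (\<forall>x\<in>sections \<U>. (\<lambda>t\<in>topspace (base \<U>). \<phi> t (x t)) \<in> sections \<U>')"

definition constant_field :: "'x topology \<Rightarrow> 'a nspace \<Rightarrow> ('x, 'a) field_data" where
  "constant_field X A =
     \<lparr>base = X,
      fibre = (\<lambda>t. A),
      sections = {x \<in> extensional (topspace X).
                    continuous_map X (Metric_space.mtopology (carrier A) (ndist A)) x}\<rparr>"

text \<open>
  The constant algebra may be taken with carrier in the type of the fibres: over a nonempty base
  it is isometrically isomorphic to any one of them.
\<close>

definition trivial_field :: "('x, 'a) field_data \<Rightarrow> bool" where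
  "trivial_field \<U> \<longleftrightarrow>
     (\<exists>(A :: 'a nspace) \<phi>. banach_algebra A \<and>
        field_isomorphism \<U> (constant_field (base \<U>) A) \<phi>)"

definition locally_trivial :: "('x, 'a) field_data \<Rightarrow> bool" where
  "locally_trivial \<U> \<longleftrightarrow>
     (\<forall>t\<in>topspace (base \<U>). \<exists>V \<subseteq> topspace (base \<U>).
        (\<exists>W. openin (base \<U>) W \<and> t \<in> W \<and> W \<subseteq> V) \<and> trivial_field (induced_field \<U> V))"

end

theory Submission
  imports Defs
begin

text \<open>
  Let \<open>\<A>\<close> be the algebra of the field. Projectivity of \<open>\<A>\<close> yields one bounded module map \<open>\<rho>\<close> that
  splits the canonical product map onto \<open>\<A>\<close>, and every fibre inherits a splitting from this single
  \<open>\<rho>\<close>; this is why the bound is uniform.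

  Evaluation at a point \<open>x\<close> is a contractive homomorphism from \<open>\<A>\<close> to \<open>A\<^sub>x\<close>. A trivialisation
  \<open>\<phi>\<close> near \<open>x\<close> and a cutoff function \<open>f\<close> with \<open>f x = 1\<close> give a contractive linear lift
  \<open>\<sigma> a = f \<cdot> \<phi>\<^sup>-\<^sup>1 (\<phi>\<^sub>x a)\<close>, extended by zero (\<open>cutoff_section_mem\<close>). The lift is not multiplicative, but a
  second cutoff function \<open>g\<close> that equals \<open>1\<close> wherever \<open>f \<noteq> 0\<close> defines another lift \<open>\<tau>\<close>, and
  \<open>\<tau> a \<cdot> \<sigma> b = \<sigma> (a b) = \<sigma> a \<cdot> \<tau> b\<close> (\<open>fibre_split_quotient\<close>). Therefore
  \<open>\<rho>\<^sub>x = (ev \<otimes> ev) \<circ> \<rho> \<circ> \<sigma>\<close> satisfies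
  \<open>\<rho>\<^sub>x (a b) = (ev \<otimes> ev) (\<tau> a \<cdot> \<rho> (\<sigma> b)) = a \<cdot> \<rho>\<^sub>x b\<close>, it splits the product of \<open>A\<^sub>x\<close>, and its norm is at most
  that of \<open>\<rho>\<close> (\<open>splitting_descends\<close>).

  For one-sided projectivity, \<open>\<rho>\<close> exists because the product \<open>\<A>\<^sub>+ \<otimes> \<A> \<rightarrow> \<A>\<close> has the bounded linear
  section \<open>b \<mapsto> 1 \<otimes> b\<close>. For biprojectivity \<open>\<rho>\<close> must take values in \<open>\<A> \<otimes> \<A>\<close>, whereas
  \<open>\<A> \<otimes> \<A> \<rightarrow> \<A>\<close> has no evident bounded linear section. The bimodule \<open>\<A>\<^sub>+ \<otimes> \<A>\<close> does give a bimodule map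
  \<open>\<rho>\<close> into \<open>\<A>\<^sub>+ \<otimes> \<A>\<close>, and the part of \<open>\<rho> b\<close> of the form \<open>1 \<otimes> \<alpha> b\<close> defines an operator \<open>\<alpha>\<close> that
  vanishes on products. If \<open>\<alpha>\<close> were nonzero, the Hahn-Banach theorem would give a nonzero bounded
  functional on \<open>\<A>\<close> vanishing on products, and a twisted bimodule structure on \<open>\<complex> \<oplus> \<A>\<close> shows that a
  biprojective algebra has none (\<open>biprojective_vanishing_functional\<close>). So \<open>\<rho>\<close> takes its values in the
  image of \<open>\<A> \<otimes> \<A>\<close> (\<open>biprojective_splitting\<close>).

  All maps on projective tensor products come from the universal property
  (\<open>ptensor_universal\<close>), and identities between them are checked on pure tensors (\<open>ptensor_eqI\<close>).
\<close>


section \<open>Normed spaces on carrier sets\<close>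

lemma complex_ring_simps [simp]:
  "carrier complex_ring = UNIV" "mult complex_ring = (*)" "one complex_ring = 1"
  "zero complex_ring = 0" "add complex_ring = (+)"
  by (simp_all add: complex_ring_def)

lemma cring_complex_ring: "cring complex_ring"
proof (rule cringI)
  show "abelian_group complex_ring"
    by (rule abelian_groupI)
      (auto simp: algebra_simps intro: exI[of _ "- x" for x :: complex] add.left_inverse)
  show "comm_monoid complex_ring"
    by (rule comm_monoidI) auto
qed (auto simp: algebra_simps)

lemma real_null_comparison:
  fixes f g :: "nat \<Rightarrow> real"
  assumes "\<And>n. \<bar>f n\<bar> \<le> g n" "g \<longlonglongrightarrow> 0"
  shows "f \<longlonglongrightarrow> 0"
  by (rule Lim_null_comparison[OF always_eventually assms(2)]) (use assms(1) in auto)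

locale normed_space = Module.module complex_ring V
  for V :: "'v nspace" (structure) +
  assumes nrm_eq_0_iff: "x \<in> carrier V \<Longrightarrow> nrm V x = 0 \<longleftrightarrow> x = \<zero>"
    and nrm_triangle: "\<lbrakk>x \<in> carrier V; y \<in> carrier V\<rbrakk> \<Longrightarrow> nrm V (x \<oplus> y) \<le> nrm V x + nrm V y"
    and nrm_smult: "x \<in> carrier V \<Longrightarrow> nrm V (c \<odot> x) = cmod c * nrm V x"
begin

lemma nrm_zero [simp]: "nrm V \<zero> = 0"
  using nrm_eq_0_iff by simp

lemma zero_smult [simp]: "x \<in> carrier V \<Longrightarrow> 0 \<odot> x = \<zero>"
  using smult_l_null by simp

lemma one_smult [simp]: "x \<in> carrier V \<Longrightarrow> 1 \<odot> x = x"
  using smult_one by simp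

lemma smult_zero [simp]: "c \<odot> \<zero> = \<zero>"
  using smult_r_null by simp

lemma scale_closed [simp, intro]: "x \<in> carrier V \<Longrightarrow> c \<odot> x \<in> carrier V"
  using smult_closed by simp

lemma scale_left_distrib: "x \<in> carrier V \<Longrightarrow> (c + d) \<odot> x = c \<odot> x \<oplus> d \<odot> x"
  using smult_l_distr by simp

lemma scale_right_distrib:
  "\<lbrakk>x \<in> carrier V; y \<in> carrier V\<rbrakk> \<Longrightarrow> c \<odot> (x \<oplus> y) = c \<odot> x \<oplus> c \<odot> y"
  using smult_r_distr by simp

lemma scale_scale: "x \<in> carrier V \<Longrightarrow> c \<odot> (d \<odot> x) = (c * d) \<odot> x"
  using smult_assoc1[of c d x] by simp

lemma neg_eq: "x \<in> carrier V \<Longrightarrow> \<ominus> x = (-1) \<odot> x"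
proof -
  assume x: "x \<in> carrier V"
  have "(-1) \<odot> x \<oplus> x = (-1 + 1) \<odot> x"
    using x scale_left_distrib[of x "-1" 1] by simp
  then show ?thesis
    using x by (intro minus_equality) simp_all
qed

lemma diff_eq: "x \<in> carrier V \<Longrightarrow> y \<in> carrier V \<Longrightarrow> x \<ominus> y = x \<oplus> (-1) \<odot> y"
  by (simp add: minus_eq neg_eq)

lemma nrm_nonneg [simp]: "x \<in> carrier V \<Longrightarrow> 0 \<le> nrm V x"
proof -
  assume x: "x \<in> carrier V"
  have "0 = nrm V (x \<oplus> (-1) \<odot> x)"
    using x by (simp add: neg_eq[symmetric] r_neg)
  also have "\<dots> \<le> nrm V x + nrm V ((-1) \<odot> x)"
    using x by (intro nrm_triangle) auto
  finally show ?thesis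
    using x by (simp add: nrm_smult)
qed

lemma nrm_minus [simp]: "x \<in> carrier V \<Longrightarrow> nrm V (\<ominus> x) = nrm V x"
  by (simp add: neg_eq nrm_smult)

lemma nrm_diff_commute:
  "\<lbrakk>x \<in> carrier V; y \<in> carrier V\<rbrakk> \<Longrightarrow> nrm V (x \<ominus> y) = nrm V (y \<ominus> x)"
  by (metis minus_closed minus_eq nrm_minus a_comm minus_minus minus_add a_inv_closed)

lemma diff_add_diff:
  "\<lbrakk>x \<in> carrier V; y \<in> carrier V; z \<in> carrier V\<rbrakk> \<Longrightarrow> (x \<ominus> y) \<oplus> (y \<ominus> z) = x \<ominus> z"
  by (simp add: minus_eq a_assoc r_neg1)

lemma diff_eq_zero_iff:
  "\<lbrakk>x \<in> carrier V; y \<in> carrier V\<rbrakk> \<Longrightarrow> x \<ominus> y = \<zero> \<longleftrightarrow> x = y"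
  by (metis a_inv_closed minus_eq minus_minus minus_equality r_neg)

lemma add_diff_add:
  "\<lbrakk>x \<in> carrier V; y \<in> carrier V; z \<in> carrier V; w \<in> carrier V\<rbrakk>
    \<Longrightarrow> (x \<oplus> y) \<ominus> (z \<oplus> w) = (x \<ominus> z) \<oplus> (y \<ominus> w)"
  by (simp add: minus_eq minus_add a_ac)

lemma smult_diff:
  "\<lbrakk>x \<in> carrier V; y \<in> carrier V\<rbrakk> \<Longrightarrow> c \<odot> (x \<ominus> y) = c \<odot> x \<ominus> c \<odot> y"
  by (simp add: diff_eq scale_right_distrib scale_scale)

lemma add_diff_cancel:
  "\<lbrakk>x \<in> carrier V; y \<in> carrier V\<rbrakk> \<Longrightarrow> (x \<ominus> y) \<oplus> y = x"
  by (simp add: minus_eq a_assoc l_neg)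

lemma nrm_diff_triangle:
  "\<lbrakk>x \<in> carrier V; y \<in> carrier V; z \<in> carrier V\<rbrakk>
    \<Longrightarrow> nrm V (x \<ominus> z) \<le> nrm V (x \<ominus> y) + nrm V (y \<ominus> z)"
  by (metis diff_add_diff minus_closed nrm_triangle)

lemma nrm_le_diff:
  "\<lbrakk>x \<in> carrier V; y \<in> carrier V\<rbrakk> \<Longrightarrow> nrm V x \<le> nrm V (x \<ominus> y) + nrm V y"
  by (metis add_diff_cancel minus_closed nrm_triangle)

lemma nrm_diff_eq_0_iff:
  "\<lbrakk>x \<in> carrier V; y \<in> carrier V\<rbrakk> \<Longrightarrow> nrm V (x \<ominus> y) = 0 \<longleftrightarrow> x = y"
  by (simp add: nrm_eq_0_iff diff_eq_zero_iff)

sublocale metric: Metric_space "carrier V" "ndist V"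
proof
  show "0 \<le> ndist V x y" for x y by (simp add: ndist_def)
  show "ndist V x y = ndist V y x" for x y by (auto simp: ndist_def nrm_diff_commute)
  show "ndist V x y = 0 \<longleftrightarrow> x = y" if "x \<in> carrier V" "y \<in> carrier V" for x y
    using that by (simp add: ndist_def nrm_diff_eq_0_iff)
  show "ndist V x z \<le> ndist V x y + ndist V y z"
    if "x \<in> carrier V" "y \<in> carrier V" "z \<in> carrier V" for x y z
    using that by (simp add: ndist_def nrm_diff_triangle)
qed

text \<open>Meaningful only for sequences in the carrier, which is assumed separately in each lemma.\<close>

definition converges :: "(nat \<Rightarrow> 'v) \<Rightarrow> 'v \<Rightarrow> bool" where
  "converges s x \<longleftrightarrow> (\<lambda>n. nrm V (s n \<ominus> x)) \<longlonglongrightarrow> 0"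

lemma converges_unique:
  assumes "converges s x" "converges s y" "range s \<subseteq> carrier V" "x \<in> carrier V" "y \<in> carrier V"
  shows "x = y"
proof -
  have s: "s n \<in> carrier V" for n using assms(3) by blast
  have "(\<lambda>n. nrm V (s n \<ominus> x) + nrm V (s n \<ominus> y)) \<longlonglongrightarrow> 0 + 0"
    using assms(1,2) unfolding converges_def by (rule tendsto_add)
  moreover have "nrm V (x \<ominus> y) \<le> nrm V (s n \<ominus> x) + nrm V (s n \<ominus> y)" for n
    using nrm_diff_triangle[of x "s n" y] assms s by (simp add: nrm_diff_commute)
  ultimately have "nrm V (x \<ominus> y) \<le> 0 + 0"
    by (intro LIMSEQ_le_const) auto
  then have "nrm V (x \<ominus> y) = 0"
    by (intro antisym nrm_nonneg) (use assms in auto)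
  then show ?thesis using assms by (simp add: nrm_diff_eq_0_iff)
qed

lemma converges_nrm:
  assumes "converges s x" "range s \<subseteq> carrier V" "x \<in> carrier V"
  shows "(\<lambda>n. nrm V (s n)) \<longlonglongrightarrow> nrm V x"
proof -
  have s: "s n \<in> carrier V" for n using assms(2) by blast
  have "\<bar>nrm V (s n) - nrm V x\<bar> \<le> nrm V (s n \<ominus> x)" for n
    using nrm_le_diff[of "s n" x] nrm_le_diff[of x "s n"] s assms(3)
    by (simp add: nrm_diff_commute[of x "s n"] abs_le_iff)
  then have "(\<lambda>n. nrm V (s n) - nrm V x) \<longlonglongrightarrow> 0"
    using assms(1) unfolding converges_def by (rule real_null_comparison)
  then show ?thesis by (rule LIM_zero_cancel)
qed

lemma converges_add:
  assumes "converges s x" "converges t y" "range s \<subseteq> carrier V" "range t \<subseteq> carrier V"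
    "x \<in> carrier V" "y \<in> carrier V"
  shows "converges (\<lambda>n. s n \<oplus> t n) (x \<oplus> y)"
proof -
  have st: "s n \<in> carrier V" "t n \<in> carrier V" for n using assms by blast+
  have "nrm V ((s n \<oplus> t n) \<ominus> (x \<oplus> y)) \<le> nrm V (s n \<ominus> x) + nrm V (t n \<ominus> y)" for n
    using nrm_triangle[of "s n \<ominus> x" "t n \<ominus> y"] st assms(5,6) by (simp add: add_diff_add)
  then have "\<bar>nrm V ((s n \<oplus> t n) \<ominus> (x \<oplus> y))\<bar> \<le> nrm V (s n \<ominus> x) + nrm V (t n \<ominus> y)" for n
    using st assms(5,6) by simp
  moreover have "(\<lambda>n. nrm V (s n \<ominus> x) + nrm V (t n \<ominus> y)) \<longlonglongrightarrow> 0"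
    using tendsto_add[OF assms(1,2)[unfolded converges_def]] by simp
  ultimately show ?thesis
    unfolding converges_def by (rule real_null_comparison)
qed

lemma converges_smult:
  assumes "converges s x" "range s \<subseteq> carrier V" "x \<in> carrier V"
  shows "converges (\<lambda>n. c \<odot> s n) (c \<odot> x)"
proof -
  have s: "s n \<in> carrier V" for n using assms by blast
  have "(\<lambda>n. cmod c * nrm V (s n \<ominus> x)) \<longlonglongrightarrow> cmod c * 0"
    using assms(1) unfolding converges_def by (rule tendsto_mult_left)
  then show ?thesis
    unfolding converges_def using s assms(3)
    by (simp add: smult_diff[symmetric] nrm_smult)
qed

lemma mcomplete_iff:
  "metric.mcomplete \<longleftrightarrow>
     (\<forall>s. range s \<subseteq> carrier V \<and> (\<forall>\<epsilon>>0. \<exists>N. \<forall>m\<ge>N. \<forall>n\<ge>N. nrm V (s m \<ominus> s n) < \<epsilon>)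
        \<longrightarrow> (\<exists>x\<in>carrier V. converges s x))"
proof -
  have C: "metric.MCauchy s \<longleftrightarrow>
      range s \<subseteq> carrier V \<and> (\<forall>\<epsilon>>0. \<exists>N. \<forall>m\<ge>N. \<forall>n\<ge>N. nrm V (s m \<ominus> s n) < \<epsilon>)" for s
  proof (cases "range s \<subseteq> carrier V")
    case True
    then have "s n \<in> carrier V" for n by blast
    then show ?thesis using True by (simp add: metric.MCauchy_def ndist_def)
  qed (simp add: metric.MCauchy_def)
  have L: "limitin metric.mtopology s x sequentially \<longleftrightarrow> x \<in> carrier V \<and> converges s x"
    if "range s \<subseteq> carrier V" for s x
  proof (cases "x \<in> carrier V")
    case True
    have s: "s n \<in> carrier V" for n using that by blast
    have "limitin metric.mtopology s x sequentially \<longleftrightarrow>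
        (\<forall>\<epsilon>>0. \<forall>\<^sub>F n in sequentially. nrm V (s n \<ominus> x) < \<epsilon>)"
      using True s by (simp add: metric.limitin_metric ndist_def)
    also have "\<dots> \<longleftrightarrow> converges s x"
      using True s by (simp add: converges_def tendsto_iff dist_real_def)
    finally show ?thesis using True by simp
  qed (simp add: metric.limitin_metric)
  have D: "(\<exists>x. limitin metric.mtopology s x sequentially) \<longleftrightarrow> (\<exists>x\<in>carrier V. converges s x)"
    if "range s \<subseteq> carrier V" for s
    using L[OF that] by blast
  show ?thesis
    unfolding metric.mcomplete_def C
    by (intro arg_cong[where f = All] ext imp_cong refl, elim conjE, rule D)
qed

end

sublocale banach_space \<subseteq> normed_space
  by unfold_locales (use nrm_eq_0_iff nrm_triangle nrm_smult in auto)

lemma (in banach_space) Cauchy_converges: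
  assumes "range s \<subseteq> carrier V" "\<forall>\<epsilon>>0. \<exists>N. \<forall>m\<ge>N. \<forall>n\<ge>N. nrm V (s m \<ominus> s n) < \<epsilon>"
  obtains x where "x \<in> carrier V" "converges s x"
  using complete assms unfolding mcomplete_iff by blast

lemma normed_spaceI:
  fixes V :: "'v nspace" (structure)
  assumes "\<And>x y. \<lbrakk>x \<in> carrier V; y \<in> carrier V\<rbrakk> \<Longrightarrow> x \<oplus> y \<in> carrier V"
    and "\<zero> \<in> carrier V"
    and "\<And>c x. x \<in> carrier V \<Longrightarrow> c \<odot> x \<in> carrier V"
    and "\<And>x y z. \<lbrakk>x \<in> carrier V; y \<in> carrier V; z \<in> carrier V\<rbrakk> \<Longrightarrow> (x \<oplus> y) \<oplus> z = x \<oplus> (y \<oplus> z)"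
    and "\<And>x y. \<lbrakk>x \<in> carrier V; y \<in> carrier V\<rbrakk> \<Longrightarrow> x \<oplus> y = y \<oplus> x"
    and "\<And>x. x \<in> carrier V \<Longrightarrow> \<zero> \<oplus> x = x"
    and "\<And>c d x. x \<in> carrier V \<Longrightarrow> (c + d) \<odot> x = c \<odot> x \<oplus> d \<odot> x"
    and "\<And>c x y. \<lbrakk>x \<in> carrier V; y \<in> carrier V\<rbrakk> \<Longrightarrow> c \<odot> (x \<oplus> y) = c \<odot> x \<oplus> c \<odot> y"
    and "\<And>c d x. x \<in> carrier V \<Longrightarrow> (c * d) \<odot> x = c \<odot> (d \<odot> x)"
    and "\<And>x. x \<in> carrier V \<Longrightarrow> 1 \<odot> x = x"
    and zero_smult: "\<And>x. x \<in> carrier V \<Longrightarrow> 0 \<odot> x = \<zero>"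
    and "\<And>x. x \<in> carrier V \<Longrightarrow> nrm V x = 0 \<Longrightarrow> x = \<zero>"
    and "\<And>x y. \<lbrakk>x \<in> carrier V; y \<in> carrier V\<rbrakk> \<Longrightarrow> nrm V (x \<oplus> y) \<le> nrm V x + nrm V y"
    and nrm_smult: "\<And>c x. x \<in> carrier V \<Longrightarrow> nrm V (c \<odot> x) = cmod c * nrm V x"
  shows "normed_space V"
proof -
  have inv: "(-1) \<odot> x \<oplus> x = \<zero>" if "x \<in> carrier V" for x
    using assms(7)[of x "-1" 1] assms(10) zero_smult that by simp
  have "abelian_group V"
  proof (rule abelian_groupI)
    show "\<exists>y\<in>carrier V. y \<oplus> x = \<zero>" if "x \<in> carrier V" for x
      using inv[OF that] assms(3)[OF that] by blast
  qed (fact assms)+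
  then have "Module.module complex_ring V"
    by (intro Module.moduleI cring_complex_ring) (simp_all only: complex_ring_simps assms)
  moreover have "nrm V \<zero> = 0"
    using nrm_smult[of "\<zero>" 0] zero_smult[of "\<zero>"] assms(2) by simp
  ultimately show ?thesis
    by (intro normed_space.intro normed_space_axioms.intro) (use assms(12-14) in \<open>blast+\<close>)
qed

lemma banach_spaceI:
  fixes V :: "'v nspace" (structure)
  assumes "normed_space V"
    and complete: "\<And>s. \<lbrakk>range s \<subseteq> carrier V;
        \<forall>\<epsilon>>0. \<exists>N. \<forall>m\<ge>N. \<forall>n\<ge>N. nrm V (s m \<ominus> s n) < \<epsilon>\<rbrakk>
        \<Longrightarrow> \<exists>x\<in>carrier V. (\<lambda>n. nrm V (s n \<ominus> x)) \<longlonglongrightarrow> 0"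
  shows "banach_space V"
proof -
  interpret normed_space V by fact
  have "Metric_space.mcomplete (carrier V) (ndist V)"
    unfolding mcomplete_iff converges_def using complete by blast
  then show ?thesis
    by unfold_locales (use nrm_eq_0_iff nrm_triangle nrm_smult in \<open>blast+\<close>)
qed


section \<open>The completion of a seminormed space\<close>

text \<open>The seminorm laws are required on \<open>S\<close> only: the formal tensors with entries in given
  carriers form a proper subspace of the free space on the whole type.\<close>

locale seminormed = Modules.module sc
  for sc :: "complex \<Rightarrow> 'v::ab_group_add \<Rightarrow> 'v" +
  fixes S :: "'v set" and p :: "'v \<Rightarrow> real"
  assumes zero_mem: "0 \<in> S"
    and add_mem: "\<lbrakk>x \<in> S; y \<in> S\<rbrakk> \<Longrightarrow> x + y \<in> S"
    and scale_mem: "x \<in> S \<Longrightarrow> sc c x \<in> S"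
    and p_add: "\<lbrakk>x \<in> S; y \<in> S\<rbrakk> \<Longrightarrow> p (x + y) \<le> p x + p y"
    and p_scale: "x \<in> S \<Longrightarrow> p (sc c x) = cmod c * p x"
begin

abbreviation "Cau \<equiv> seminorm_Cauchy S p"
abbreviation "cls \<equiv> completion_class S p"
abbreviation "Compl \<equiv> seminorm_completion S sc p"

lemma diff_mem: "\<lbrakk>x \<in> S; y \<in> S\<rbrakk> \<Longrightarrow> x - y \<in> S"
  using add_mem[of x "sc (-1) y"] scale_mem[of y "-1"] by simp

lemma p_zero [simp]: "p 0 = 0"
  using p_scale[of 0 0] zero_mem by simp

lemma p_minus: "x \<in> S \<Longrightarrow> p (- x) = p x"
  using p_scale[of x "-1"] by simp

lemma p_nonneg: "x \<in> S \<Longrightarrow> 0 \<le> p x"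
  using p_add[of x "- x"] p_minus[of x] diff_mem[of 0 x] zero_mem by simp

lemma p_diff_commute: "\<lbrakk>x \<in> S; y \<in> S\<rbrakk> \<Longrightarrow> p (x - y) = p (y - x)"
  using p_minus[of "x - y"] diff_mem by simp

lemma p_diff_triangle: "\<lbrakk>x \<in> S; y \<in> S; z \<in> S\<rbrakk> \<Longrightarrow> p (x - z) \<le> p (x - y) + p (y - z)"
  using p_add[of "x - y" "y - z"] diff_mem by simp

lemma p_le_diff: "\<lbrakk>x \<in> S; y \<in> S\<rbrakk> \<Longrightarrow> p x \<le> p (x - y) + p y"
  using p_add[of "x - y" y] diff_mem by simp

lemma CauI:
  assumes "\<And>n. s n \<in> S" "\<And>\<epsilon>. \<epsilon> > 0 \<Longrightarrow> \<exists>N. \<forall>m\<ge>N. \<forall>n\<ge>N. p (s m - s n) < \<epsilon>"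
  shows "s \<in> Cau"
  using assms by (auto simp: seminorm_Cauchy_def)

lemma Cau_mem: "s \<in> Cau \<Longrightarrow> s n \<in> S"
  by (auto simp: seminorm_Cauchy_def)

lemma CauD: "s \<in> Cau \<Longrightarrow> \<epsilon> > 0 \<Longrightarrow> \<exists>N. \<forall>m\<ge>N. \<forall>n\<ge>N. p (s m - s n) < \<epsilon>"
  by (auto simp: seminorm_Cauchy_def)

lemma Cau_const: "x \<in> S \<Longrightarrow> (\<lambda>_. x) \<in> Cau"
  by (rule CauI) auto

lemma Cau_add:
  assumes s: "s \<in> Cau" and t: "t \<in> Cau"
  shows "(\<lambda>n. s n + t n) \<in> Cau"
proof (rule CauI)
  fix \<epsilon> :: real assume "\<epsilon> > 0"
  obtain M where M: "\<And>m n. m \<ge> M \<Longrightarrow> n \<ge> M \<Longrightarrow> p (s m - s n) < \<epsilon> / 2"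
    using CauD[OF s, of "\<epsilon> / 2"] \<open>\<epsilon> > 0\<close> by auto
  obtain N where N: "\<And>m n. m \<ge> N \<Longrightarrow> n \<ge> N \<Longrightarrow> p (t m - t n) < \<epsilon> / 2"
    using CauD[OF t, of "\<epsilon> / 2"] \<open>\<epsilon> > 0\<close> by auto
  have "p (s m + t m - (s n + t n)) < \<epsilon>" if "m \<ge> max M N" "n \<ge> max M N" for m n
  proof -
    have "p ((s m - s n) + (t m - t n)) \<le> p (s m - s n) + p (t m - t n)"
      by (intro p_add diff_mem Cau_mem s t)
    also have "\<dots> < \<epsilon>" using M[of m n] N[of m n] that by simp
    finally show ?thesis by (simp add: algebra_simps)
  qed
  then show "\<exists>N. \<forall>m\<ge>N. \<forall>n\<ge>N. p (s m + t m - (s n + t n)) < \<epsilon>" by blast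
qed (intro add_mem Cau_mem s t)

lemma Cau_scale:
  assumes s: "s \<in> Cau"
  shows "(\<lambda>n. sc c (s n)) \<in> Cau"
proof (rule CauI)
  fix \<epsilon> :: real assume "\<epsilon> > 0"
  then have pos: "\<epsilon> / (cmod c + 1) > 0" by (simp add: add_nonneg_pos)
  obtain M where M: "\<And>m n. m \<ge> M \<Longrightarrow> n \<ge> M \<Longrightarrow> p (s m - s n) < \<epsilon> / (cmod c + 1)"
    using CauD[OF s pos] by auto
  have "p (sc c (s m) - sc c (s n)) < \<epsilon>" if "m \<ge> M" "n \<ge> M" for m n
  proof -
    have "p (sc c (s m) - sc c (s n)) = cmod c * p (s m - s n)"
      unfolding scale_right_diff_distrib[symmetric] by (intro p_scale diff_mem Cau_mem s)
    also have "\<dots> \<le> (cmod c + 1) * p (s m - s n)"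
      by (intro mult_right_mono p_nonneg diff_mem Cau_mem s) auto
    also have "\<dots> < (cmod c + 1) * (\<epsilon> / (cmod c + 1))"
      by (intro mult_strict_left_mono M that) (simp add: add_nonneg_pos)
    also have "\<dots> = \<epsilon>"
    proof -
      have "cmod c + 1 \<noteq> 0" using norm_ge_zero[of c] by linarith
      then show ?thesis by simp
    qed
    finally show ?thesis .
  qed
  then show "\<exists>N. \<forall>m\<ge>N. \<forall>n\<ge>N. p (sc c (s m) - sc c (s n)) < \<epsilon>" by blast
qed (intro scale_mem Cau_mem s)

definition asymp :: "(nat \<Rightarrow> 'v) \<Rightarrow> (nat \<Rightarrow> 'v) \<Rightarrow> bool" where
  "asymp s t \<longleftrightarrow> (\<lambda>n. p (s n - t n)) \<longlonglongrightarrow> 0"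

lemma asympI:
  assumes "\<And>n. s n \<in> S" "\<And>n. t n \<in> S" "\<And>n. p (s n - t n) \<le> g n" "g \<longlonglongrightarrow> 0"
  shows "asymp s t"
  unfolding asymp_def
  by (rule real_null_comparison[OF _ assms(4)]) (use assms p_nonneg diff_mem in auto)

lemma asymp_sym: "s \<in> Cau \<Longrightarrow> t \<in> Cau \<Longrightarrow> asymp s t \<Longrightarrow> asymp t s"
  unfolding asymp_def by (subst p_diff_commute) (auto intro: Cau_mem)

lemma asymp_trans:
  assumes "s \<in> Cau" "t \<in> Cau" "u \<in> Cau" "asymp s t" "asymp t u"
  shows "asymp s u"
proof (rule asympI)
  show "p (s n - u n) \<le> p (s n - t n) + p (t n - u n)" for n
    by (intro p_diff_triangle Cau_mem assms)
  show "(\<lambda>n. p (s n - t n) + p (t n - u n)) \<longlonglongrightarrow> 0"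
    using tendsto_add[OF assms(4,5)[unfolded asymp_def]] by simp
qed (intro Cau_mem assms)+

lemma mem_cls_iff: "t \<in> cls s \<longleftrightarrow> t \<in> Cau \<and> asymp s t"
  by (simp add: completion_class_def asymp_def)

lemma self_mem_cls: "s \<in> Cau \<Longrightarrow> s \<in> cls s"
  by (simp add: mem_cls_iff asymp_def)

lemma cls_eq_iff:
  assumes "s \<in> Cau" "t \<in> Cau"
  shows "cls s = cls t \<longleftrightarrow> asymp s t"
proof
  assume "cls s = cls t"
  then show "asymp s t" using self_mem_cls[OF assms(2)] by (metis mem_cls_iff)
next
  assume st: "asymp s t"
  show "cls s = cls t"
    using asymp_trans[of t s] asymp_trans[of s t] asymp_sym[OF assms st] st assms
    by (auto simp: mem_cls_iff)
qed

lemma carrier_completion: "carrier Compl = cls ` Cau"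
  by (simp add: seminorm_completion_def)

lemma zero_completion: "zero Compl = cls (\<lambda>_. 0)"
  by (simp add: seminorm_completion_def)

lemma UN_const: "A \<noteq> {} \<Longrightarrow> (\<And>x. x \<in> A \<Longrightarrow> f x = c) \<Longrightarrow> (\<Union>x\<in>A. f x) = c"
  by auto

text \<open>The union in the definition runs over all representatives; they all give the same class.\<close>

lemma add_completion:
  assumes s: "s \<in> Cau" and t: "t \<in> Cau"
  shows "cls s \<oplus>\<^bsub>Compl\<^esub> cls t = cls (\<lambda>n. s n + t n)"
proof -
  have "cls (\<lambda>n. s' n + t' n) = cls (\<lambda>n. s n + t n)" if "s' \<in> cls s" "t' \<in> cls t" for s' t'
  proof -
    have *: "s' \<in> Cau" "t' \<in> Cau" "asymp s s'" "asymp t t'"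
      using that by (auto simp: mem_cls_iff)
    have "asymp (\<lambda>n. s n + t n) (\<lambda>n. s' n + t' n)"
    proof (rule asympI)
      show "p (s n + t n - (s' n + t' n)) \<le> p (s n - s' n) + p (t n - t' n)" for n
        using p_add[of "s n - s' n" "t n - t' n"] s t *
        by (auto simp: algebra_simps intro: diff_mem Cau_mem)
      show "(\<lambda>n. p (s n - s' n) + p (t n - t' n)) \<longlonglongrightarrow> 0"
        using tendsto_add[OF *(3,4)[unfolded asymp_def]] by simp
    qed (intro add_mem Cau_mem s t *)+
    from asymp_sym[OF Cau_add[OF s t] Cau_add[OF *(1,2)] this] show ?thesis
      using Cau_add s t * by (simp add: cls_eq_iff)
  qed
  then have "(\<Union>s'\<in>cls s. \<Union>t'\<in>cls t. cls (\<lambda>n. s' n + t' n)) = cls (\<lambda>n. s n + t n)"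
    using self_mem_cls[OF s] self_mem_cls[OF t] by (intro UN_const) blast+
  then show ?thesis by (simp add: seminorm_completion_def)
qed

lemma smult_completion:
  assumes s: "s \<in> Cau"
  shows "c \<odot>\<^bsub>Compl\<^esub> cls s = cls (\<lambda>n. sc c (s n))"
proof -
  have "cls (\<lambda>n. sc c (s' n)) = cls (\<lambda>n. sc c (s n))" if "s' \<in> cls s" for s'
  proof -
    have *: "s' \<in> Cau" "asymp s s'"
      using that by (auto simp: mem_cls_iff)
    have "asymp (\<lambda>n. sc c (s n)) (\<lambda>n. sc c (s' n))"
    proof (rule asympI)
      show "p (sc c (s n) - sc c (s' n)) \<le> cmod c * p (s n - s' n)" for n
        unfolding scale_right_diff_distrib[symmetric]
        by (subst p_scale) (intro diff_mem Cau_mem s *, simp)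
      show "(\<lambda>n. cmod c * p (s n - s' n)) \<longlonglongrightarrow> 0"
        using tendsto_mult_left[OF *(2)[unfolded asymp_def], of "cmod c"] by simp
    qed (intro scale_mem Cau_mem s *)+
    from asymp_sym[OF Cau_scale[OF s] Cau_scale[OF *(1)] this] show ?thesis
      using Cau_scale s * by (simp add: cls_eq_iff)
  qed
  then have "(\<Union>s'\<in>cls s. cls (\<lambda>n. sc c (s' n))) = cls (\<lambda>n. sc c (s n))"
    using self_mem_cls[OF s] by (intro UN_const) blast+
  then show ?thesis by (simp add: seminorm_completion_def)
qed

lemma p_diff_abs_le: "\<lbrakk>x \<in> S; y \<in> S\<rbrakk> \<Longrightarrow> \<bar>p x - p y\<bar> \<le> p (x - y)"
  using p_le_diff[of x y] p_le_diff[of y x] p_diff_commute[of x y] by simp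

lemma nrm_completion:
  assumes s: "s \<in> Cau"
  shows "(\<lambda>n. p (s n)) \<longlonglongrightarrow> nrm Compl (cls s)"
proof -
  have "Cauchy (\<lambda>n. p (s n))"
  proof (rule metric_CauchyI)
    fix \<epsilon> :: real assume "\<epsilon> > 0"
    then obtain N where N: "\<And>m n. m \<ge> N \<Longrightarrow> n \<ge> N \<Longrightarrow> p (s m - s n) < \<epsilon>"
      using CauD[OF s] by blast
    have "dist (p (s m)) (p (s n)) < \<epsilon>" if "m \<ge> N" "n \<ge> N" for m n
      using p_diff_abs_le[of "s m" "s n"] N[OF that] Cau_mem[OF s] by (force simp: dist_real_def)
    then show "\<exists>M. \<forall>m\<ge>M. \<forall>n\<ge>M. dist (p (s m)) (p (s n)) < \<epsilon>" by blast
  qed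
  then obtain r where r: "(\<lambda>n. p (s n)) \<longlonglongrightarrow> r"
    by (meson Cauchy_convergent convergentD)
  have all: "(\<lambda>n. p (t n)) \<longlonglongrightarrow> r" if "t \<in> cls s" for t
  proof -
    have *: "t \<in> Cau" "asymp s t" using that by (auto simp: mem_cls_iff)
    have "(\<lambda>n. p (t n) - p (s n)) \<longlonglongrightarrow> 0"
    proof (rule real_null_comparison)
      show "\<bar>p (t n) - p (s n)\<bar> \<le> p (s n - t n)" for n
        using p_diff_abs_le[of "s n" "t n"] Cau_mem s * by fastforce
    qed (use * in \<open>simp add: asymp_def\<close>)
    from tendsto_add[OF this r] show ?thesis by simp
  qed
  have "(THE r. \<forall>t\<in>cls s. (\<lambda>n. p (t n)) \<longlonglongrightarrow> r) = r"
    using all self_mem_cls[OF s] by (intro the_equality) (auto intro: LIMSEQ_unique)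
  then show ?thesis using r by (simp add: seminorm_completion_def)
qed

lemma carrier_completionE:
  assumes "C \<in> carrier Compl"
  obtains s where "s \<in> Cau" "C = cls s"
  using assms by (auto simp: carrier_completion)

lemma cls_mem: "s \<in> Cau \<Longrightarrow> cls s \<in> carrier Compl"
  by (auto simp: carrier_completion)

lemma normed_completion: "normed_space Compl"
proof (rule normed_spaceI; (elim carrier_completionE)?; (hypsubst)?)
  show "zero Compl \<in> carrier Compl"
    by (simp add: zero_completion cls_mem Cau_const zero_mem)
next
  fix s t assume "s \<in> Cau" "t \<in> Cau"
  then show "cls s \<oplus>\<^bsub>Compl\<^esub> cls t \<in> carrier Compl"
    and "cls s \<oplus>\<^bsub>Compl\<^esub> cls t = cls t \<oplus>\<^bsub>Compl\<^esub> cls s"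
    by (simp_all add: add_completion cls_mem Cau_add add.commute)
  show "nrm Compl (cls s \<oplus>\<^bsub>Compl\<^esub> cls t) \<le> nrm Compl (cls s) + nrm Compl (cls t)"
  proof (rule LIMSEQ_le)
    show "(\<lambda>n. p (s n + t n)) \<longlonglongrightarrow> nrm Compl (cls s \<oplus>\<^bsub>Compl\<^esub> cls t)"
      using \<open>s \<in> Cau\<close> \<open>t \<in> Cau\<close> by (simp add: add_completion nrm_completion Cau_add)
    show "(\<lambda>n. p (s n) + p (t n)) \<longlonglongrightarrow> nrm Compl (cls s) + nrm Compl (cls t)"
      using \<open>s \<in> Cau\<close> \<open>t \<in> Cau\<close> by (intro tendsto_add nrm_completion)
    show "\<exists>N. \<forall>n\<ge>N. p (s n + t n) \<le> p (s n) + p (t n)"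
      using \<open>s \<in> Cau\<close> \<open>t \<in> Cau\<close> p_add Cau_mem by blast
  qed
  fix c
  show "c \<odot>\<^bsub>Compl\<^esub> (cls s \<oplus>\<^bsub>Compl\<^esub> cls t) =
      c \<odot>\<^bsub>Compl\<^esub> cls s \<oplus>\<^bsub>Compl\<^esub> c \<odot>\<^bsub>Compl\<^esub> cls t"
    using \<open>s \<in> Cau\<close> \<open>t \<in> Cau\<close>
    by (simp add: add_completion smult_completion Cau_add Cau_scale scale_right_distrib)
  fix u assume "u \<in> Cau"
  then show "cls s \<oplus>\<^bsub>Compl\<^esub> cls t \<oplus>\<^bsub>Compl\<^esub> cls u =
      cls s \<oplus>\<^bsub>Compl\<^esub> (cls t \<oplus>\<^bsub>Compl\<^esub> cls u)"
    using \<open>s \<in> Cau\<close> \<open>t \<in> Cau\<close> by (simp add: add_completion Cau_add add.assoc)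
next
  fix s c d assume s: "s \<in> Cau"
  then show "c \<odot>\<^bsub>Compl\<^esub> cls s \<in> carrier Compl"
    and "zero Compl \<oplus>\<^bsub>Compl\<^esub> cls s = cls s"
    and "(c + d) \<odot>\<^bsub>Compl\<^esub> cls s = c \<odot>\<^bsub>Compl\<^esub> cls s \<oplus>\<^bsub>Compl\<^esub> d \<odot>\<^bsub>Compl\<^esub> cls s"
    and "(c * d) \<odot>\<^bsub>Compl\<^esub> cls s = c \<odot>\<^bsub>Compl\<^esub> (d \<odot>\<^bsub>Compl\<^esub> cls s)"
    and "1 \<odot>\<^bsub>Compl\<^esub> cls s = cls s"
    and "0 \<odot>\<^bsub>Compl\<^esub> cls s = zero Compl"
    by (simp_all add: smult_completion zero_completion add_completion cls_mem Cau_scale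
        Cau_const zero_mem scale_left_distrib)
  show "nrm Compl (c \<odot>\<^bsub>Compl\<^esub> cls s) = cmod c * nrm Compl (cls s)"
  proof (rule LIMSEQ_unique)
    show "(\<lambda>n. p (sc c (s n))) \<longlonglongrightarrow> nrm Compl (c \<odot>\<^bsub>Compl\<^esub> cls s)"
      using s by (simp add: smult_completion nrm_completion Cau_scale)
    show "(\<lambda>n. p (sc c (s n))) \<longlonglongrightarrow> cmod c * nrm Compl (cls s)"
      using tendsto_mult_left[OF nrm_completion[OF s], of "cmod c"] s by (simp add: p_scale Cau_mem)
  qed
  show "cls s = zero Compl" if "nrm Compl (cls s) = 0"
    using nrm_completion[OF s] that s
    by (simp add: zero_completion cls_eq_iff Cau_const zero_mem asymp_def)
qed

sublocale compl: normed_space Compl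
  by (rule normed_completion)

lemma diff_completion:
  assumes "s \<in> Cau" "t \<in> Cau"
  shows "cls s \<ominus>\<^bsub>Compl\<^esub> cls t = cls (\<lambda>n. s n - t n)"
  using assms compl.diff_eq[OF cls_mem cls_mem] Cau_scale[OF assms(2), of "-1"]
  by (simp add: add_completion smult_completion)

definition emb :: "'v \<Rightarrow> (nat \<Rightarrow> 'v) set" where
  "emb x = cls (\<lambda>_. x)"

lemma emb_mem: "x \<in> S \<Longrightarrow> emb x \<in> carrier Compl"
  by (simp add: emb_def cls_mem Cau_const)

lemma emb_add: "\<lbrakk>x \<in> S; y \<in> S\<rbrakk> \<Longrightarrow> emb (x + y) = emb x \<oplus>\<^bsub>Compl\<^esub> emb y"
  by (simp add: emb_def add_completion Cau_const)

lemma emb_scale: "x \<in> S \<Longrightarrow> emb (sc c x) = c \<odot>\<^bsub>Compl\<^esub> emb x"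
  by (simp add: emb_def smult_completion Cau_const)

lemma nrm_emb: "x \<in> S \<Longrightarrow> nrm Compl (emb x) = p x"
  unfolding emb_def by (rule LIMSEQ_unique[OF nrm_completion[OF Cau_const] tendsto_const])

lemma emb_eq: "\<lbrakk>x \<in> S; y \<in> S; p (x - y) = 0\<rbrakk> \<Longrightarrow> emb x = emb y"
  by (simp add: emb_def cls_eq_iff Cau_const asymp_def)

lemma emb_converges:
  assumes s: "s \<in> Cau"
  shows "compl.converges (\<lambda>n. emb (s n)) (cls s)"
  unfolding compl.converges_def
proof (rule LIMSEQ_I)
  fix \<epsilon> :: real assume "\<epsilon> > 0"
  then obtain N where N: "\<And>m n. m \<ge> N \<Longrightarrow> n \<ge> N \<Longrightarrow> p (s m - s n) < \<epsilon> / 2"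
    using CauD[OF s, of "\<epsilon> / 2"] by auto
  have le: "nrm Compl (emb (s m) \<ominus>\<^bsub>Compl\<^esub> cls s) \<le> \<epsilon> / 2" if "m \<ge> N" for m
  proof (rule LIMSEQ_le_const2)
    have "(\<lambda>n. s m - s n) \<in> Cau"
      using Cau_add[OF Cau_const[OF Cau_mem[OF s]] Cau_scale[OF s], of m "-1"] by simp
    from nrm_completion[OF this]
    show "(\<lambda>n. p (s m - s n)) \<longlonglongrightarrow> nrm Compl (emb (s m) \<ominus>\<^bsub>Compl\<^esub> cls s)"
      using s by (simp add: emb_def diff_completion Cau_const Cau_mem)
    show "\<exists>M. \<forall>n\<ge>M. p (s m - s n) \<le> \<epsilon> / 2"
      using N[of m] that by (meson less_imp_le)
  qed
  have "norm (nrm Compl (emb (s n) \<ominus>\<^bsub>Compl\<^esub> cls s) - 0) < \<epsilon>" if "n \<ge> N" for n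
    using le[OF that] \<open>\<epsilon> > 0\<close> s by (simp add: emb_mem Cau_mem cls_mem)
  then show "\<exists>N. \<forall>n\<ge>N. norm (nrm Compl (emb (s n) \<ominus>\<^bsub>Compl\<^esub> cls s) - 0) < \<epsilon>"
    by blast
qed

lemma banach_completion: "banach_space Compl"
proof (rule banach_spaceI[OF normed_completion])
  fix C :: "nat \<Rightarrow> (nat \<Rightarrow> 'v) set"
  assume "range C \<subseteq> carrier Compl"
    and Cauchy: "\<forall>\<epsilon>>0. \<exists>N. \<forall>m\<ge>N. \<forall>n\<ge>N. nrm Compl (C m \<ominus>\<^bsub>Compl\<^esub> C n) < \<epsilon>"
  then have C: "C n \<in> carrier Compl" for n by blast
  \<comment> \<open>Each class is approximated, with error \<open>1 / (n + 1)\<close>, by an element of \<open>S\<close>; these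
    elements form a Cauchy sequence whose class is the limit.\<close>
  have "\<exists>x\<in>S. nrm Compl (emb x \<ominus>\<^bsub>Compl\<^esub> C n) < inverse (real (Suc n))" for n
  proof -
    obtain s where s: "s \<in> Cau" "C n = cls s" using C carrier_completionE by blast
    have "\<forall>\<^sub>F m in sequentially. nrm Compl (emb (s m) \<ominus>\<^bsub>Compl\<^esub> cls s) < inverse (real (Suc n))"
      using emb_converges[OF s(1)] unfolding compl.converges_def
      by (rule order_tendstoD) simp
    then obtain m where "nrm Compl (emb (s m) \<ominus>\<^bsub>Compl\<^esub> cls s) < inverse (real (Suc n))"
      by (meson eventually_happens trivial_limit_sequentially)
    then show ?thesis
      by (intro bexI[of _ "s m"]) (use s Cau_mem in auto)
  qed
  then obtain x where x: "\<And>n. x n \<in> S"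
    and xC: "\<And>n. nrm Compl (emb (x n) \<ominus>\<^bsub>Compl\<^esub> C n) < inverse (real (Suc n))"
    by metis
  have close: "(\<lambda>n. nrm Compl (emb (x n) \<ominus>\<^bsub>Compl\<^esub> C n)) \<longlonglongrightarrow> 0"
  proof (rule real_null_comparison)
    show "\<bar>nrm Compl (emb (x n) \<ominus>\<^bsub>Compl\<^esub> C n)\<bar> \<le> inverse (real (Suc n))" for n
      using xC[of n] emb_mem[OF x, of n] C[of n] by simp
  qed (rule LIMSEQ_inverse_real_of_nat)
  have xCau: "x \<in> Cau"
  proof (rule CauI[OF x])
    fix \<epsilon> :: real assume "\<epsilon> > 0"
    then have e: "\<epsilon> / 3 > 0" by simp
    obtain N where N: "\<And>m n. m \<ge> N \<Longrightarrow> n \<ge> N \<Longrightarrow> nrm Compl (C m \<ominus>\<^bsub>Compl\<^esub> C n) < \<epsilon> / 3"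
      using Cauchy e by blast
    obtain M where M: "\<And>n. n \<ge> M \<Longrightarrow> nrm Compl (emb (x n) \<ominus>\<^bsub>Compl\<^esub> C n) < \<epsilon> / 3"
      using order_tendstoD(2)[OF close e] by (auto simp: eventually_sequentially)
    have "p (x m - x n) < \<epsilon>" if "m \<ge> max M N" "n \<ge> max M N" for m n
    proof -
      have "p (x m - x n) = nrm Compl (emb (x m) \<ominus>\<^bsub>Compl\<^esub> emb (x n))"
        using nrm_emb[of "x m - x n"] x by (simp add: emb_def diff_completion Cau_const diff_mem)
      also have "\<dots> \<le> nrm Compl (emb (x m) \<ominus>\<^bsub>Compl\<^esub> C m) +
          nrm Compl (C m \<ominus>\<^bsub>Compl\<^esub> emb (x n))"
        by (intro compl.nrm_diff_triangle emb_mem x C)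
      also have "nrm Compl (C m \<ominus>\<^bsub>Compl\<^esub> emb (x n)) \<le>
          nrm Compl (C m \<ominus>\<^bsub>Compl\<^esub> C n) + nrm Compl (C n \<ominus>\<^bsub>Compl\<^esub> emb (x n))"
        by (intro compl.nrm_diff_triangle emb_mem x C)
      also have "nrm Compl (C n \<ominus>\<^bsub>Compl\<^esub> emb (x n)) =
          nrm Compl (emb (x n) \<ominus>\<^bsub>Compl\<^esub> C n)"
        by (intro compl.nrm_diff_commute emb_mem x C)
      finally show ?thesis using N[of m n] M[of m] M[of n] that by simp
    qed
    then show "\<exists>N. \<forall>m\<ge>N. \<forall>n\<ge>N. p (x m - x n) < \<epsilon>" by blast
  qed
  have "(\<lambda>n. nrm Compl (C n \<ominus>\<^bsub>Compl\<^esub> cls x)) \<longlonglongrightarrow> 0"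
  proof (rule real_null_comparison)
    show "\<bar>nrm Compl (C n \<ominus>\<^bsub>Compl\<^esub> cls x)\<bar> \<le>
        nrm Compl (emb (x n) \<ominus>\<^bsub>Compl\<^esub> C n) +
        nrm Compl (emb (x n) \<ominus>\<^bsub>Compl\<^esub> cls x)" for n
      using compl.nrm_diff_triangle[OF C emb_mem[OF x] cls_mem[OF xCau], of n n]
        compl.nrm_diff_commute[OF C emb_mem[OF x], of n n] C cls_mem[OF xCau] by simp
    show "(\<lambda>n. nrm Compl (emb (x n) \<ominus>\<^bsub>Compl\<^esub> C n) +
        nrm Compl (emb (x n) \<ominus>\<^bsub>Compl\<^esub> cls x)) \<longlonglongrightarrow> 0"
      using tendsto_add[OF close emb_converges[OF xCau, unfolded compl.converges_def]] by simp
  qed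
  then show "\<exists>D\<in>carrier Compl. (\<lambda>n. nrm Compl (C n \<ominus>\<^bsub>Compl\<^esub> D)) \<longlonglongrightarrow> 0"
    by (rule bexI) (rule cls_mem[OF xCau])
qed

text \<open>Boundedness turns Cauchy sequences in \<open>S\<close> into Cauchy sequences in \<open>G\<close> and equivalent ones into
  equivalent ones, so the limit depends on the class only.\<close>

lemma extend_to_completion:
  fixes G :: "'g nspace"
  assumes "banach_space G" and "K \<ge> 0"
    and T: "\<And>x. x \<in> S \<Longrightarrow> T x \<in> carrier G"
    and T_add: "\<And>x y. \<lbrakk>x \<in> S; y \<in> S\<rbrakk> \<Longrightarrow> T (x + y) = T x \<oplus>\<^bsub>G\<^esub> T y"
    and T_scale: "\<And>c x. x \<in> S \<Longrightarrow> T (sc c x) = c \<odot>\<^bsub>G\<^esub> T x"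
    and T_bound: "\<And>x. x \<in> S \<Longrightarrow> nrm G (T x) \<le> K * p x"
  shows "\<exists>L. linear_map Compl G L \<and> (\<forall>x\<in>S. L (emb x) = T x) \<and>
    (\<forall>C\<in>carrier Compl. nrm G (L C) \<le> K * nrm Compl C)"
proof -
  interpret G: banach_space G by fact
  have T_diff: "T (x - y) = T x \<ominus>\<^bsub>G\<^esub> T y" if "x \<in> S" "y \<in> S" for x y
    using T_add[OF that(1) scale_mem[OF that(2), of "-1"]] T_scale[OF that(2), of "-1"] that T
    by (simp add: G.diff_eq)
  have ex: "\<exists>g\<in>carrier G. G.converges (\<lambda>n. T (s n)) g" if s: "s \<in> Cau" for s
  proof -
    have "\<exists>N. \<forall>m\<ge>N. \<forall>n\<ge>N. nrm G (T (s m) \<ominus>\<^bsub>G\<^esub> T (s n)) < \<epsilon>" if "\<epsilon> > 0" for \<epsilon>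
    proof -
      have pos: "\<epsilon> / (K + 1) > 0" using that \<open>K \<ge> 0\<close> by simp
      obtain N where N: "\<And>m n. m \<ge> N \<Longrightarrow> n \<ge> N \<Longrightarrow> p (s m - s n) < \<epsilon> / (K + 1)"
        using CauD[OF s pos] by blast
      have "nrm G (T (s m) \<ominus>\<^bsub>G\<^esub> T (s n)) < \<epsilon>" if mn: "m \<ge> N" "n \<ge> N" for m n
      proof -
        have "nrm G (T (s m) \<ominus>\<^bsub>G\<^esub> T (s n)) \<le> K * p (s m - s n)"
          using T_bound[of "s m - s n"] s by (simp add: T_diff Cau_mem diff_mem)
        also have "\<dots> \<le> (K + 1) * p (s m - s n)"
          by (intro mult_right_mono p_nonneg diff_mem Cau_mem s) simp
        also have "\<dots> < \<epsilon>"
          using N[OF mn] \<open>K \<ge> 0\<close> by (simp add: field_simps)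
        finally show ?thesis .
      qed
      then show ?thesis by blast
    qed
    then have Cauchy: "\<forall>\<epsilon>>0. \<exists>N. \<forall>m\<ge>N. \<forall>n\<ge>N. nrm G (T (s m) \<ominus>\<^bsub>G\<^esub> T (s n)) < \<epsilon>"
      by blast
    have "range (\<lambda>n. T (s n)) \<subseteq> carrier G" using T Cau_mem[OF s] by blast
    from G.Cauchy_converges[OF this Cauchy] show ?thesis by metis
  qed
  define L where "L C = (SOME g. g \<in> carrier G \<and> (\<exists>s\<in>Cau. C = cls s \<and> G.converges (\<lambda>n. T (s n)) g))" for C
  have L: "L (cls s) \<in> carrier G \<and> G.converges (\<lambda>n. T (s n)) (L (cls s))" if s: "s \<in> Cau" for s
  proof -
    obtain g where g: "g \<in> carrier G" "G.converges (\<lambda>n. T (s n)) g" using ex[OF s] by blast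
    have "L (cls s) \<in> carrier G \<and> (\<exists>t\<in>Cau. cls s = cls t \<and> G.converges (\<lambda>n. T (t n)) (L (cls s)))"
      unfolding L_def by (rule someI[of _ g]) (use g s in blast)
    then obtain t where t: "t \<in> Cau" "cls s = cls t" "G.converges (\<lambda>n. T (t n)) (L (cls s))"
      and Ls: "L (cls s) \<in> carrier G" by blast
    have mem: "T (s n) \<in> carrier G" "T (t n) \<in> carrier G" for n
      using T Cau_mem s t by blast+
    have "(\<lambda>n. nrm G (T (s n) \<ominus>\<^bsub>G\<^esub> L (cls s))) \<longlonglongrightarrow> 0"
    proof (rule real_null_comparison)
      fix n
      have "nrm G (T (s n) \<ominus>\<^bsub>G\<^esub> T (t n)) \<le> K * p (s n - t n)"
        using T_bound[of "s n - t n"] s t by (simp add: T_diff Cau_mem diff_mem)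
      then show "\<bar>nrm G (T (s n) \<ominus>\<^bsub>G\<^esub> L (cls s))\<bar> \<le> K * p (s n - t n) + nrm G (T (t n) \<ominus>\<^bsub>G\<^esub> L (cls s))"
        using G.nrm_diff_triangle[OF mem Ls, of n n] mem[of n] Ls by simp
    next
      have "asymp s t" using t s cls_eq_iff by simp
      then show "(\<lambda>n. K * p (s n - t n) + nrm G (T (t n) \<ominus>\<^bsub>G\<^esub> L (cls s))) \<longlonglongrightarrow> 0"
        using tendsto_add[OF tendsto_mult_left[of _ 0 _ K] t(3)[unfolded G.converges_def]]
        by (simp add: asymp_def)
    qed
    then show ?thesis using Ls by (simp add: G.converges_def)
  qed
  have rng: "range (\<lambda>n. T (s n)) \<subseteq> carrier G" if "s \<in> Cau" for s
    using T Cau_mem[OF that] by blast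
  have L_eq: "L (cls s) = g" if "s \<in> Cau" "g \<in> carrier G" "G.converges (\<lambda>n. T (s n)) g" for s g
    by (rule G.converges_unique[OF conjunct2[OF L[OF that(1)]] that(3) rng[OF that(1)]
          conjunct1[OF L[OF that(1)]] that(2)])
  show ?thesis
  proof (intro exI[of _ L] conjI ballI)
    show "linear_map Compl G L"
      unfolding linear_map_def
    proof (intro conjI ballI allI funcsetI; elim carrier_completionE; hypsubst)
      fix s assume s: "s \<in> Cau"
      then show "L (cls s) \<in> carrier G" using L by blast
      show "L (c \<odot>\<^bsub>Compl\<^esub> cls s) = c \<odot>\<^bsub>G\<^esub> L (cls s)" for c
        unfolding smult_completion[OF s]
      proof (rule L_eq[OF Cau_scale[OF s]])
        show "G.converges (\<lambda>n. T (sc c (s n))) (c \<odot>\<^bsub>G\<^esub> L (cls s))"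
          using G.converges_smult[OF conjunct2[OF L[OF s]] rng[OF s], of c] L[OF s] s
          by (simp add: T_scale Cau_mem)
      qed (use L[OF s] in blast)
      fix t assume t: "t \<in> Cau"
      show "L (cls s \<oplus>\<^bsub>Compl\<^esub> cls t) = L (cls s) \<oplus>\<^bsub>G\<^esub> L (cls t)"
        unfolding add_completion[OF s t]
      proof (rule L_eq[OF Cau_add[OF s t]])
        show "G.converges (\<lambda>n. T (s n + t n)) (L (cls s) \<oplus>\<^bsub>G\<^esub> L (cls t))"
          using G.converges_add[OF conjunct2[OF L[OF s]] conjunct2[OF L[OF t]] rng[OF s] rng[OF t]]
            L[OF s] L[OF t] s t
          by (simp add: T_add Cau_mem)
      qed (use L[OF s] L[OF t] in blast)
    qed
    show "L (emb x) = T x" if "x \<in> S" for x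
      unfolding emb_def
    proof (rule L_eq[OF Cau_const[OF that] T[OF that]])
      have "T x \<ominus>\<^bsub>G\<^esub> T x = \<zero>\<^bsub>G\<^esub>"
        using T[OF that] by (simp add: G.diff_eq_zero_iff)
      then show "G.converges (\<lambda>n. T x) (T x)"
        by (simp add: G.converges_def)
    qed
    show "nrm G (L C) \<le> K * nrm Compl C" if C: "C \<in> carrier Compl" for C
    proof -
      obtain s where s: "s \<in> Cau" "C = cls s" using C by (rule carrier_completionE)
      show ?thesis
      proof (rule LIMSEQ_le)
        show "(\<lambda>n. nrm G (T (s n))) \<longlonglongrightarrow> nrm G (L C)"
          unfolding s(2) by (rule G.converges_nrm[OF conjunct2[OF L[OF s(1)]] rng[OF s(1)] conjunct1[OF L[OF s(1)]]])
        show "(\<lambda>n. K * p (s n)) \<longlonglongrightarrow> K * nrm Compl C"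
          unfolding s(2) by (rule tendsto_mult_left[OF nrm_completion[OF s(1)]])
        show "\<exists>N. \<forall>n\<ge>N. nrm G (T (s n)) \<le> K * p (s n)"
          by (intro exI allI impI T_bound Cau_mem s(1))
      qed
    qed
  qed
qed

end


section \<open>Bounded linear and bilinear maps\<close>

lemma linear_mapI:
  assumes "\<And>x. x \<in> carrier V \<Longrightarrow> T x \<in> carrier W"
    and "\<And>x y. \<lbrakk>x \<in> carrier V; y \<in> carrier V\<rbrakk> \<Longrightarrow> T (x \<oplus>\<^bsub>V\<^esub> y) = T x \<oplus>\<^bsub>W\<^esub> T y"
    and "\<And>c x. x \<in> carrier V \<Longrightarrow> T (c \<odot>\<^bsub>V\<^esub> x) = c \<odot>\<^bsub>W\<^esub> T x"
  shows "linear_map V W T"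
  using assms by (auto simp: linear_map_def)

lemma linear_map_closed: "linear_map V W T \<Longrightarrow> x \<in> carrier V \<Longrightarrow> T x \<in> carrier W"
  and linear_map_add: "linear_map V W T \<Longrightarrow> x \<in> carrier V \<Longrightarrow> y \<in> carrier V \<Longrightarrow>
        T (x \<oplus>\<^bsub>V\<^esub> y) = T x \<oplus>\<^bsub>W\<^esub> T y"
  and linear_map_scale: "linear_map V W T \<Longrightarrow> x \<in> carrier V \<Longrightarrow> T (c \<odot>\<^bsub>V\<^esub> x) = c \<odot>\<^bsub>W\<^esub> T x"
  by (auto simp: linear_map_def)

lemma linear_map_compose:
  "linear_map U V S \<Longrightarrow> linear_map V W T \<Longrightarrow> linear_map U W (\<lambda>x. T (S x))"
  by (auto simp: linear_map_def Pi_iff)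

lemma linear_map_diff:
  assumes "normed_space V" "normed_space W" "linear_map V W T" "x \<in> carrier V" "y \<in> carrier V"
  shows "T (x \<ominus>\<^bsub>V\<^esub> y) = T x \<ominus>\<^bsub>W\<^esub> T y"
proof -
  interpret V: normed_space V by fact
  interpret W: normed_space W by fact
  show ?thesis
    using assms(3-5)
    by (simp add: V.diff_eq W.diff_eq linear_map_add linear_map_scale linear_map_closed)
qed

lemma bounded_linear_mapI:
  assumes "linear_map V W T" "\<And>x. x \<in> carrier V \<Longrightarrow> nrm W (T x) \<le> K * nrm V x"
  shows "bounded_linear_map V W T"
  using assms by (auto simp: bounded_linear_map_def)

lemma bounded_linear_map_linear: "bounded_linear_map V W T \<Longrightarrow> linear_map V W T"
  by (simp add: bounded_linear_map_def)

lemmas bounded_linear_map_closed = linear_map_closed[OF bounded_linear_map_linear]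
lemmas bounded_linear_map_add = linear_map_add[OF bounded_linear_map_linear]
lemmas bounded_linear_map_scale = linear_map_scale[OF bounded_linear_map_linear]

lemma bounded_linear_map_bound:
  assumes "normed_space V" "bounded_linear_map V W T"
  shows "\<exists>K\<ge>0. \<forall>x\<in>carrier V. nrm W (T x) \<le> K * nrm V x"
proof -
  interpret V: normed_space V by fact
  obtain K where K: "\<And>x. x \<in> carrier V \<Longrightarrow> nrm W (T x) \<le> K * nrm V x"
    using assms(2) by (auto simp: bounded_linear_map_def)
  have "nrm W (T x) \<le> max K 0 * nrm V x" if "x \<in> carrier V" for x
    by (rule order_trans[OF K[OF that]]) (intro mult_right_mono V.nrm_nonneg that, simp)
  then show ?thesis by (intro exI[of _ "max K 0"]) simp
qed

lemma bounded_linear_map_compose: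
  assumes "normed_space U" "normed_space V" "bounded_linear_map U V S" "bounded_linear_map V W T"
  shows "bounded_linear_map U W (\<lambda>x. T (S x))"
proof -
  obtain K where K: "K \<ge> 0" "\<forall>x\<in>carrier U. nrm V (S x) \<le> K * nrm U x"
    using bounded_linear_map_bound[OF assms(1,3)] by blast
  obtain L where L: "L \<ge> 0" "\<forall>x\<in>carrier V. nrm W (T x) \<le> L * nrm V x"
    using bounded_linear_map_bound[OF assms(2,4)] by blast
  show ?thesis
  proof (rule bounded_linear_mapI)
    show "linear_map U W (\<lambda>x. T (S x))"
      by (rule linear_map_compose) (use assms in \<open>auto simp: bounded_linear_map_def\<close>)
    show "nrm W (T (S x)) \<le> (L * K) * nrm U x" if "x \<in> carrier U" for x
      using order_trans[OF bspec[OF L(2)] mult_left_mono[OF bspec[OF K(2) that] L(1)]]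
        bounded_linear_map_closed[OF assms(3) that] by (simp add: mult.assoc)
  qed
qed

lemma bilinear_mapI:
  assumes "\<And>x. x \<in> carrier U \<Longrightarrow> linear_map V W (\<beta> x)"
    and "\<And>y. y \<in> carrier V \<Longrightarrow> linear_map U W (\<lambda>x. \<beta> x y)"
  shows "bilinear_map U V W \<beta>"
  using assms by (auto simp: bilinear_map_def)

lemma bilinear_map_right: "bilinear_map U V W \<beta> \<Longrightarrow> x \<in> carrier U \<Longrightarrow> linear_map V W (\<beta> x)"
  and bilinear_map_left: "bilinear_map U V W \<beta> \<Longrightarrow> y \<in> carrier V \<Longrightarrow> linear_map U W (\<lambda>x. \<beta> x y)"
  by (auto simp: bilinear_map_def)

lemma bilinear_map_closed:
  "bilinear_map U V W \<beta> \<Longrightarrow> x \<in> carrier U \<Longrightarrow> y \<in> carrier V \<Longrightarrow> \<beta> x y \<in> carrier W"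
  using linear_map_closed[OF bilinear_map_right] .

lemma bilinear_map_compose:
  assumes "bilinear_map U V W \<beta>" "linear_map U' U S" "linear_map V' V T"
  shows "bilinear_map U' V' W (\<lambda>x y. \<beta> (S x) (T y))"
proof (rule bilinear_mapI)
  show "linear_map V' W (\<lambda>y. \<beta> (S x) (T y))" if "x \<in> carrier U'" for x
    by (rule linear_map_compose[OF assms(3) bilinear_map_right[OF assms(1)]])
      (rule linear_map_closed[OF assms(2) that])
  show "linear_map U' W (\<lambda>x. \<beta> (S x) (T y))" if "y \<in> carrier V'" for y
    by (rule linear_map_compose[OF assms(2) bilinear_map_left[OF assms(1)]])
      (rule linear_map_closed[OF assms(3) that])
qed

lemma bounded_bilinear_map_bound:
  assumes "normed_space U" "normed_space V" "bounded_bilinear_map U V W \<beta>"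
  shows "\<exists>K\<ge>0. \<forall>x\<in>carrier U. \<forall>y\<in>carrier V. nrm W (\<beta> x y) \<le> K * nrm U x * nrm V y"
proof -
  interpret U: normed_space U by fact
  interpret V: normed_space V by fact
  obtain K where K: "\<And>x y. x \<in> carrier U \<Longrightarrow> y \<in> carrier V \<Longrightarrow> nrm W (\<beta> x y) \<le> K * nrm U x * nrm V y"
    using assms(3) by (auto simp: bounded_bilinear_map_def)
  have "nrm W (\<beta> x y) \<le> max K 0 * nrm U x * nrm V y" if "x \<in> carrier U" "y \<in> carrier V" for x y
    by (rule order_trans[OF K[OF that]]) (intro mult_right_mono V.nrm_nonneg U.nrm_nonneg that, simp)
  then show ?thesis by (intro exI[of _ "max K 0"]) simp
qed


section \<open>The projective tensor product\<close>

lemma lookup_formal_scale [simp]: "Poly_Mapping.lookup (formal_scale c u) k = c * Poly_Mapping.lookup u k"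
  by (simp add: formal_scale_def Poly_Mapping.map.rep_eq when_def)

interpretation formal: Modules.module "formal_scale :: complex \<Rightarrow> ('e, 'f) formal_tensor \<Rightarrow> _"
  by unfold_locales (auto intro!: poly_mapping_eqI simp: lookup_add algebra_simps)

lemma keys_formal_scale: "Poly_Mapping.keys (formal_scale c u) \<subseteq> Poly_Mapping.keys u"
  by (auto simp: in_keys_iff)

lemma formal_scale_single: "formal_scale c (Poly_Mapping.single k d) = Poly_Mapping.single k (c * d)"
  by (rule poly_mapping_eqI) (simp add: lookup_single when_def)

lemma formal_tensor_eq_sum: "(u :: 'k \<Rightarrow>\<^sub>0 complex) = (\<Sum>k\<in>Poly_Mapping.keys u. Poly_Mapping.single k (Poly_Mapping.lookup u k))"
  by (rule poly_mapping_eqI) (simp add: lookup_sum lookup_single when_def in_keys_iff)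

lemma formal_tensors_single [simp]:
  "Poly_Mapping.single (x, y) c \<in> formal_tensors E F" if "x \<in> carrier E" "y \<in> carrier F"
  using that by (auto simp: formal_tensors_def)

lemma subspace_formal_tensors: "formal.subspace (formal_tensors E F)"
  unfolding formal.subspace_def formal_tensors_def
  using Poly_Mapping.keys_add keys_formal_scale by fastforce

definition (in normed_space) formal_sum :: "('k \<Rightarrow> 'v) \<Rightarrow> ('k \<Rightarrow>\<^sub>0 complex) \<Rightarrow> 'v" where
  "formal_sum b u = (\<Oplus>k\<in>Poly_Mapping.keys u. Poly_Mapping.lookup u k \<odot> b k)"

context normed_space
begin

lemma formal_sum_superset:
  assumes "finite K" "Poly_Mapping.keys u \<subseteq> K" "b \<in> K \<rightarrow> carrier V"
  shows "formal_sum b u = (\<Oplus>k\<in>K. Poly_Mapping.lookup u k \<odot> b k)"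
  unfolding formal_sum_def
  by (rule add.finprod_mono_neutral_cong_left) (use assms in \<open>auto simp: in_keys_iff Pi_iff\<close>)

lemma formal_sum_closed:
  "Poly_Mapping.keys u \<subseteq> D \<Longrightarrow> b \<in> D \<rightarrow> carrier V \<Longrightarrow> formal_sum b u \<in> carrier V"
  unfolding formal_sum_def by (rule finsum_closed) auto

lemma formal_sum_add:
  assumes "Poly_Mapping.keys u \<subseteq> D" "Poly_Mapping.keys v \<subseteq> D" "b \<in> D \<rightarrow> carrier V"
  shows "formal_sum b (u + v) = formal_sum b u \<oplus> formal_sum b v"
proof -
  let ?K = "Poly_Mapping.keys u \<union> Poly_Mapping.keys v"
  have b: "b \<in> ?K \<rightarrow> carrier V" using assms by auto
  have "formal_sum b (u + v) = (\<Oplus>k\<in>?K. Poly_Mapping.lookup (u + v) k \<odot> b k)"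
    using Poly_Mapping.keys_add[of u v] b by (intro formal_sum_superset) auto
  also have "\<dots> = (\<Oplus>k\<in>?K. Poly_Mapping.lookup u k \<odot> b k \<oplus> Poly_Mapping.lookup v k \<odot> b k)"
    using b by (intro finsum_cong') (auto simp: lookup_add scale_left_distrib Pi_iff)
  also have "\<dots> = (\<Oplus>k\<in>?K. Poly_Mapping.lookup u k \<odot> b k) \<oplus> (\<Oplus>k\<in>?K. Poly_Mapping.lookup v k \<odot> b k)"
    using b by (intro finsum_addf) auto
  also have "(\<Oplus>k\<in>?K. Poly_Mapping.lookup u k \<odot> b k) = formal_sum b u"
    using b by (intro formal_sum_superset[symmetric]) auto
  also have "(\<Oplus>k\<in>?K. Poly_Mapping.lookup v k \<odot> b k) = formal_sum b v"
    using b by (intro formal_sum_superset[symmetric]) auto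
  finally show ?thesis .
qed

lemma formal_sum_single:
  assumes "b k \<in> carrier V"
  shows "formal_sum b (Poly_Mapping.single k c) = c \<odot> b k"
proof -
  have "formal_sum b (Poly_Mapping.single k c) =
      (\<Oplus>l\<in>{k}. Poly_Mapping.lookup (Poly_Mapping.single k c) l \<odot> b l)"
    using assms by (intro formal_sum_superset) auto
  then show ?thesis using assms by simp
qed

lemma formal_sum_zero: "formal_sum b 0 = \<zero>"
  by (simp add: formal_sum_def)

lemma formal_sum_scale:
  assumes "Poly_Mapping.keys u \<subseteq> D" "b \<in> D \<rightarrow> carrier V"
  shows "formal_sum b (formal_scale c u) = c \<odot> formal_sum b u"
proof -
  have b: "b \<in> Poly_Mapping.keys u \<rightarrow> carrier V" using assms by auto
  have "formal_sum b (formal_scale c u) = (\<Oplus>k\<in>Poly_Mapping.keys u. c \<odot> (Poly_Mapping.lookup u k \<odot> b k))"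
  proof -
    have "formal_sum b (formal_scale c u) = (\<Oplus>k\<in>Poly_Mapping.keys u. Poly_Mapping.lookup (formal_scale c u) k \<odot> b k)"
      using b by (intro formal_sum_superset keys_formal_scale) auto
    also have "\<dots> = (\<Oplus>k\<in>Poly_Mapping.keys u. c \<odot> (Poly_Mapping.lookup u k \<odot> b k))"
      using b by (intro finsum_cong') (auto simp: scale_scale Pi_iff)
    finally show ?thesis .
  qed
  also have "\<dots> = c \<odot> formal_sum b u"
    unfolding formal_sum_def using b by (intro finsum_smult_ldistr[symmetric]) auto
  finally show ?thesis .
qed

end

locale normed_pair = E: normed_space E + F: normed_space F
  for E :: "'e nspace" and F :: "'f nspace"
begin

abbreviation "\<F> \<equiv> formal_tensors E F"
abbreviation "\<N> \<equiv> tensor_null E F"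
abbreviation "pn \<equiv> projective_seminorm E F"

lemma relations_formal: "bilinearity_relations E F \<subseteq> \<F>"
  unfolding bilinearity_relations_def
  by (auto intro!: formal.subspace_diff[OF subspace_formal_tensors])

lemma null_formal: "\<N> \<subseteq> \<F>"
  unfolding tensor_null_def
  by (rule formal.span_minimal[OF relations_formal subspace_formal_tensors])

lemma subspace_null: "formal.subspace \<N>"
  unfolding tensor_null_def by (rule formal.subspace_span)

lemma null_relation: "u \<in> bilinearity_relations E F \<Longrightarrow> u \<in> \<N>"
  unfolding tensor_null_def by (rule formal.span_base)

lemma null_scale_left:
  "\<lbrakk>x \<in> carrier E; y \<in> carrier F\<rbrakk> \<Longrightarrow>
    Poly_Mapping.single (c \<odot>\<^bsub>E\<^esub> x, y) 1 - Poly_Mapping.single (x, y) c \<in> \<N>"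
  by (intro null_relation) (unfold bilinearity_relations_def, blast)

text \<open>The two ingredients of the projective norm: the admissible representations of the tensor
  of \<open>u\<close>, and the quantity that is minimised over them.\<close>

definition represents :: "('e \<times> 'f) list \<Rightarrow> ('e, 'f) formal_tensor \<Rightarrow> bool" where
  "represents zs u \<longleftrightarrow> set zs \<subseteq> carrier E \<times> carrier F \<and>
     u - (\<Sum>z\<leftarrow>zs. Poly_Mapping.single z 1) \<in> \<N>"

definition cost :: "('e \<times> 'f) list \<Rightarrow> real" where
  "cost zs = (\<Sum>(x, y)\<leftarrow>zs. nrm E x * nrm F y)"

lemma cost_simps [simp]: "cost [] = 0" "cost ((x, y) # zs) = nrm E x * nrm F y + cost zs"
  "cost (zs @ zs') = cost zs + cost zs'"
  by (simp_all add: cost_def)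

lemma cost_nonneg: "set zs \<subseteq> carrier E \<times> carrier F \<Longrightarrow> 0 \<le> cost zs"
  by (induction zs) auto

lemma pn_eq: "pn u = Inf {cost zs | zs. represents zs u}"
  by (simp add: projective_seminorm_def represents_def cost_def)

lemma bdd_below_cost: "bdd_below {cost zs | zs. represents zs u}"
  by (rule bdd_belowI[of _ 0]) (auto simp: represents_def cost_nonneg)

lemma pn_le: "represents zs u \<Longrightarrow> pn u \<le> cost zs"
  unfolding pn_eq by (rule cInf_lower[OF _ bdd_below_cost]) blast

lemma represents_add:
  assumes "represents zs u" "represents zs' u'"
  shows "represents (zs @ zs') (u + u')"
  using formal.subspace_add[OF subspace_null, of "u - (\<Sum>z\<leftarrow>zs. Poly_Mapping.single z 1)"
      "u' - (\<Sum>z\<leftarrow>zs'. Poly_Mapping.single z 1)"] assms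
  by (simp add: represents_def algebra_simps)

lemma represents_single:
  assumes "x \<in> carrier E" "y \<in> carrier F"
  shows "represents [(c \<odot>\<^bsub>E\<^esub> x, y)] (Poly_Mapping.single (x, y) c)"
  using formal.subspace_neg[OF subspace_null null_scale_left[OF assms, of c]] assms
  by (simp add: represents_def)

lemma represents_zero: "represents [] 0"
  by (simp add: represents_def formal.subspace_0[OF subspace_null])

lemma ex_represents:
  assumes "u \<in> \<F>"
  shows "\<exists>zs. represents zs u"
proof -
  have "\<exists>zs. represents zs (\<Sum>k\<in>K. Poly_Mapping.single k (Poly_Mapping.lookup u k))"
    if "finite K" "K \<subseteq> carrier E \<times> carrier F" for K
    using that
  proof (induction K)
    case empty
    then show ?case using represents_zero by auto
  next
    case (insert k K)
    then obtain zs where "represents zs (\<Sum>k\<in>K. Poly_Mapping.single k (Poly_Mapping.lookup u k))" by auto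
    then show ?case
      using insert represents_add[OF represents_single[of "fst k" "snd k" "Poly_Mapping.lookup u k"]]
      by (auto simp: mem_Times_iff)
  qed
  from this[of "Poly_Mapping.keys u"] show ?thesis
    using assms formal_tensor_eq_sum[of u] by (simp add: formal_tensors_def)
qed

lemma pn_approx:
  assumes "u \<in> \<F>" "\<epsilon> > 0"
  obtains zs where "represents zs u" "cost zs < pn u + \<epsilon>"
proof -
  have "{cost zs | zs. represents zs u} \<noteq> {}" using ex_represents[OF assms(1)] by auto
  then have "\<exists>r\<in>{cost zs | zs. represents zs u}. r < pn u + \<epsilon>"
    using assms(2) by (intro cInf_lessD) (simp_all add: pn_eq)
  then show ?thesis using that by auto
qed

lemma pn_nonneg: "u \<in> \<F> \<Longrightarrow> 0 \<le> pn u"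
  unfolding pn_eq
  by (rule cInf_greatest) (use ex_represents in \<open>auto simp: represents_def cost_nonneg\<close>)

lemma pn_add:
  assumes "u \<in> \<F>" "v \<in> \<F>"
  shows "pn (u + v) \<le> pn u + pn v"
proof (rule field_le_epsilon)
  fix \<epsilon> :: real assume "\<epsilon> > 0"
  then have e: "\<epsilon> / 2 > 0" by simp
  obtain zs where zs: "represents zs u" "cost zs < pn u + \<epsilon> / 2"
    by (rule pn_approx[OF assms(1) e])
  obtain zs' where zs': "represents zs' v" "cost zs' < pn v + \<epsilon> / 2"
    by (rule pn_approx[OF assms(2) e])
  show "pn (u + v) \<le> pn u + pn v + \<epsilon>"
    using pn_le[OF represents_add[OF zs(1) zs'(1)]] zs zs' by simp
qed

lemma represents_scale:
  assumes "represents zs u"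
  shows "represents (map (\<lambda>(x, y). (c \<odot>\<^bsub>E\<^esub> x, y)) zs) (formal_scale c u)"
proof -
  have "represents (map (\<lambda>(x, y). (c \<odot>\<^bsub>E\<^esub> x, y)) zs)
      (formal_scale c (\<Sum>z\<leftarrow>zs. Poly_Mapping.single z 1))"
    if "set zs \<subseteq> carrier E \<times> carrier F" for zs
    using that
  proof (induction zs)
    case Nil
    then show ?case using represents_zero by simp
  next
    case (Cons z zs)
    obtain x y where z: "z = (x, y)" by (cases z)
    show ?case
      using represents_add[OF represents_single[of x y c] Cons.IH] Cons.prems
      by (simp add: z formal.scale_right_distrib formal_scale_single)
  qed
  from this[of zs] show ?thesis
    using formal.subspace_add[OF subspace_null _ formal.subspace_scale[OF subspace_null, of
        "u - (\<Sum>z\<leftarrow>zs. Poly_Mapping.single z 1)" c]] assms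
    by (fastforce simp: represents_def formal.scale_right_diff_distrib)
qed

lemma pn_scale_le:
  assumes "u \<in> \<F>"
  shows "pn (formal_scale c u) \<le> cmod c * pn u"
proof (rule field_le_epsilon)
  fix \<epsilon> :: real assume "\<epsilon> > 0"
  have pos: "cmod c + 1 > 0" using norm_ge_zero[of c] by linarith
  then have e: "\<epsilon> / (cmod c + 1) > 0" using \<open>\<epsilon> > 0\<close> by simp
  obtain zs where zs: "represents zs u" "cost zs < pn u + \<epsilon> / (cmod c + 1)"
    by (rule pn_approx[OF assms e])
  have "cost (map (\<lambda>(x, y). (c \<odot>\<^bsub>E\<^esub> x, y)) zs) = cmod c * cost zs"
    if "set zs \<subseteq> carrier E \<times> carrier F" for zs
    using that by (induction zs) (auto simp: E.nrm_smult algebra_simps)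
  then have "pn (formal_scale c u) \<le> cmod c * cost zs"
    using pn_le[OF represents_scale[OF zs(1), of c]] zs(1) by (simp add: represents_def)
  also have "\<dots> \<le> cmod c * (pn u + \<epsilon> / (cmod c + 1))"
    using zs(2) by (intro mult_left_mono) auto
  also have "\<dots> = cmod c * pn u + \<epsilon> * (cmod c / (cmod c + 1))"
    by (simp add: algebra_simps)
  also have "\<epsilon> * (cmod c / (cmod c + 1)) \<le> \<epsilon> * 1"
    using \<open>\<epsilon> > 0\<close> pos by (intro mult_left_mono) auto
  finally show "pn (formal_scale c u) \<le> cmod c * pn u + \<epsilon>" by simp
qed

lemma pn_scale:
  assumes "u \<in> \<F>"
  shows "pn (formal_scale c u) = cmod c * pn u"
proof (cases "c = 0")
  case True
  have "pn 0 = 0"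
    using pn_le[OF represents_zero] pn_nonneg[of 0] formal.subspace_0[OF subspace_formal_tensors, of E F]
    by simp
  then show ?thesis using True by simp
next
  case False
  have "pn u \<le> cmod (inverse c) * pn (formal_scale c u)"
    using pn_scale_le[of "formal_scale c u" "inverse c"] False
      formal.subspace_scale[OF subspace_formal_tensors assms] by simp
  then have "cmod c * pn u \<le> pn (formal_scale c u)"
    using False by (simp add: norm_divide field_simps)
  then show ?thesis using pn_scale_le[OF assms, of c] by simp
qed

lemma pn_null:
  assumes "u \<in> \<N>"
  shows "pn u = 0"
proof -
  have "represents [] u" using assms by (simp add: represents_def)
  then show ?thesis
    using pn_le[of "[]" u] pn_nonneg[of u] null_formal assms by auto
qed

sublocale seminormed formal_scale \<F> pn
  rewrites "seminorm_completion \<F> formal_scale pn = E \<otimes>\<^sub>\<pi> F"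
proof -
  show "seminormed formal_scale \<F> pn"
    by unfold_locales
      (auto intro: formal.subspace_0 formal.subspace_add formal.subspace_scale subspace_formal_tensors
        pn_add pn_scale)
qed (simp add: ptensor_def)

lemma pure_tensor_eq: "pure_tensor E F x y = emb (Poly_Mapping.single (x, y) 1)"
  by (simp add: pure_tensor_def emb_def)

lemma pure_tensor_mem:
  "\<lbrakk>x \<in> carrier E; y \<in> carrier F\<rbrakk> \<Longrightarrow> pure_tensor E F x y \<in> carrier (E \<otimes>\<^sub>\<pi> F)"
  by (simp add: pure_tensor_eq emb_mem)

lemma emb_eq_modulo_null: "\<lbrakk>u \<in> \<F>; v \<in> \<F>; u - v \<in> \<N>\<rbrakk> \<Longrightarrow> emb u = emb v"
  by (rule emb_eq) (auto simp: pn_null)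

lemma nrm_pure_tensor_le:
  assumes "x \<in> carrier E" "y \<in> carrier F"
  shows "nrm (E \<otimes>\<^sub>\<pi> F) (pure_tensor E F x y) \<le> nrm E x * nrm F y"
  using pn_le[OF represents_single[OF assms, of 1]] assms
  by (simp add: pure_tensor_eq nrm_emb)

lemma emb_single:
  assumes "x \<in> carrier E" "y \<in> carrier F"
  shows "emb (Poly_Mapping.single (x, y) c) = c \<odot>\<^bsub>E \<otimes>\<^sub>\<pi> F\<^esub> pure_tensor E F x y"
  using emb_scale[of "Poly_Mapping.single (x, y) 1" c] assms
  by (simp add: pure_tensor_eq formal_scale_single)

lemma bilinear_pure_tensor: "bilinear_map E F (E \<otimes>\<^sub>\<pi> F) (pure_tensor E F)"
proof (intro bilinear_mapI linear_mapI)
  fix x y assume x: "x \<in> carrier E" and y: "y \<in> carrier F"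
  show "pure_tensor E F x y \<in> carrier (E \<otimes>\<^sub>\<pi> F)" using x y by (rule pure_tensor_mem)
  then show "pure_tensor E F x y \<in> carrier (E \<otimes>\<^sub>\<pi> F)" .
  fix c
  show "pure_tensor E F x (c \<odot>\<^bsub>F\<^esub> y) = c \<odot>\<^bsub>E \<otimes>\<^sub>\<pi> F\<^esub> pure_tensor E F x y"
    unfolding emb_single[OF x y, symmetric] unfolding pure_tensor_eq
    by (rule emb_eq_modulo_null)
      (use x y in \<open>simp_all, intro null_relation, unfold bilinearity_relations_def, blast\<close>)
  show "pure_tensor E F (c \<odot>\<^bsub>E\<^esub> x) y = c \<odot>\<^bsub>E \<otimes>\<^sub>\<pi> F\<^esub> pure_tensor E F x y"
    unfolding emb_single[OF x y, symmetric] unfolding pure_tensor_eq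
    by (rule emb_eq_modulo_null) (use x y null_scale_left in simp_all)
next
  fix x x' y assume x: "x \<in> carrier E" and x': "x' \<in> carrier E" and y: "y \<in> carrier F"
  have "emb (Poly_Mapping.single (x \<oplus>\<^bsub>E\<^esub> x', y) 1) =
      emb (Poly_Mapping.single (x, y) 1 + Poly_Mapping.single (x', y) 1)"
  proof (rule emb_eq_modulo_null)
    show "Poly_Mapping.single (x \<oplus>\<^bsub>E\<^esub> x', y) 1 -
        (Poly_Mapping.single (x, y) 1 + Poly_Mapping.single (x', y) 1) \<in> \<N>"
      unfolding diff_diff_eq[symmetric]
      by (intro null_relation) (unfold bilinearity_relations_def, use x x' y in blast)
  qed (use x x' y in \<open>auto intro!: add_mem\<close>)
  then show "pure_tensor E F (x \<oplus>\<^bsub>E\<^esub> x') y =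
      pure_tensor E F x y \<oplus>\<^bsub>E \<otimes>\<^sub>\<pi> F\<^esub> pure_tensor E F x' y"
    using x x' y by (simp add: emb_add pure_tensor_eq)
next
  fix x y y' assume x: "x \<in> carrier E" and y: "y \<in> carrier F" and y': "y' \<in> carrier F"
  have "emb (Poly_Mapping.single (x, y \<oplus>\<^bsub>F\<^esub> y') 1) =
      emb (Poly_Mapping.single (x, y) 1 + Poly_Mapping.single (x, y') 1)"
  proof (rule emb_eq_modulo_null)
    show "Poly_Mapping.single (x, y \<oplus>\<^bsub>F\<^esub> y') 1 -
        (Poly_Mapping.single (x, y) 1 + Poly_Mapping.single (x, y') 1) \<in> \<N>"
      unfolding diff_diff_eq[symmetric]
      by (intro null_relation) (unfold bilinearity_relations_def, use x y y' in blast)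
  qed (use x y y' in \<open>auto intro!: add_mem\<close>)
  then show "pure_tensor E F x (y \<oplus>\<^bsub>F\<^esub> y') =
      pure_tensor E F x y \<oplus>\<^bsub>E \<otimes>\<^sub>\<pi> F\<^esub> pure_tensor E F x y'"
    using x y y' by (simp add: emb_add pure_tensor_eq)
qed

text \<open>A bounded bilinear map vanishes on the bilinearity relations, so its value on \<open>u\<close> can be
  computed from any representation of \<open>u\<close>; hence it is bounded for the projective seminorm.\<close>

lemma formal_sum_bilinear:
  fixes G :: "'g nspace"
  assumes "normed_space G" and \<beta>: "bilinear_map E F G \<beta>" and "K \<ge> 0"
    and bound: "\<And>x y. \<lbrakk>x \<in> carrier E; y \<in> carrier F\<rbrakk> \<Longrightarrow> nrm G (\<beta> x y) \<le> K * nrm E x * nrm F y"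
    and u: "u \<in> \<F>"
  shows "nrm G (normed_space.formal_sum G (case_prod \<beta>) u) \<le> K * pn u"
proof -
  interpret G: normed_space G by fact
  let ?L = "G.formal_sum (case_prod \<beta>)" and ?D = "carrier E \<times> carrier F"
  have D: "case_prod \<beta> \<in> ?D \<rightarrow> carrier G"
    using bilinear_map_closed[OF \<beta>] by auto
  have L_mem: "?L v \<in> carrier G" if "v \<in> \<F>" for v
    using that D by (intro G.formal_sum_closed) (auto simp: formal_tensors_def)
  have L_add: "?L (v + w) = ?L v \<oplus>\<^bsub>G\<^esub> ?L w" if "v \<in> \<F>" "w \<in> \<F>" for v w
    using that D by (intro G.formal_sum_add) (auto simp: formal_tensors_def)
  have L_scale: "?L (formal_scale c v) = c \<odot>\<^bsub>G\<^esub> ?L v" if "v \<in> \<F>" for c v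
    using that D by (intro G.formal_sum_scale) (auto simp: formal_tensors_def)
  have L_diff: "?L (v - w) = ?L v \<ominus>\<^bsub>G\<^esub> ?L w" if "v \<in> \<F>" "w \<in> \<F>" for v w
    using L_add[OF that(1) scale_mem[OF that(2), of "-1"]] L_scale[OF that(2), of "-1"] that L_mem
    by (simp add: G.diff_eq)
  have L_single: "?L (Poly_Mapping.single (x, y) c) = c \<odot>\<^bsub>G\<^esub> \<beta> x y"
    if "x \<in> carrier E" "y \<in> carrier F" for x y c
    using bilinear_map_closed[OF \<beta> that] by (simp add: G.formal_sum_single)
  have diff_single: "Poly_Mapping.single (x, y) a - Poly_Mapping.single (x', y') b \<in> \<F>"
    if "x \<in> carrier E" "y \<in> carrier F" "x' \<in> carrier E" "y' \<in> carrier F" for x y a x' y' b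
    using that by (intro diff_mem) auto
  have rel: "?L r = \<zero>\<^bsub>G\<^esub>" if "r \<in> bilinearity_relations E F" for r
    using that unfolding bilinearity_relations_def
  proof (elim UnE; clarsimp)
    fix x x' y assume *: "x \<in> carrier E" "x' \<in> carrier E" "y \<in> carrier F"
    have m: "\<beta> x y \<in> carrier G" "\<beta> x' y \<in> carrier G"
      using bilinear_map_closed[OF \<beta>] * by auto
    show "?L (Poly_Mapping.single (x \<oplus>\<^bsub>E\<^esub> x', y) 1 - Poly_Mapping.single (x, y) 1 -
        Poly_Mapping.single (x', y) 1) = \<zero>\<^bsub>G\<^esub>"
      using * m linear_map_add[OF bilinear_map_left[OF \<beta> *(3)] *(1,2)]
      by (simp add: L_diff diff_single L_single G.minus_eq G.a_ac G.r_neg G.r_neg1 G.r_neg2)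
  next
    fix x y y' assume *: "x \<in> carrier E" "y \<in> carrier F" "y' \<in> carrier F"
    have m: "\<beta> x y \<in> carrier G" "\<beta> x y' \<in> carrier G"
      using bilinear_map_closed[OF \<beta>] * by auto
    show "?L (Poly_Mapping.single (x, y \<oplus>\<^bsub>F\<^esub> y') 1 - Poly_Mapping.single (x, y) 1 -
        Poly_Mapping.single (x, y') 1) = \<zero>\<^bsub>G\<^esub>"
      using * m linear_map_add[OF bilinear_map_right[OF \<beta> *(1)] *(2,3)]
      by (simp add: L_diff diff_single L_single G.minus_eq G.a_ac G.r_neg G.r_neg1 G.r_neg2)
  next
    fix c x y assume *: "x \<in> carrier E" "y \<in> carrier F"
    have m: "\<beta> x y \<in> carrier G" using bilinear_map_closed[OF \<beta>] * by auto
    show "?L (Poly_Mapping.single (c \<odot>\<^bsub>E\<^esub> x, y) 1 - Poly_Mapping.single (x, y) c) = \<zero>\<^bsub>G\<^esub>"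
      using * m linear_map_scale[OF bilinear_map_left[OF \<beta> *(2)] *(1)]
      by (simp add: L_diff L_single G.diff_eq_zero_iff)
    show "?L (Poly_Mapping.single (x, c \<odot>\<^bsub>F\<^esub> y) 1 - Poly_Mapping.single (x, y) c) = \<zero>\<^bsub>G\<^esub>"
      using * m linear_map_scale[OF bilinear_map_right[OF \<beta> *(1)] *(2)]
      by (simp add: L_diff L_single G.diff_eq_zero_iff)
  qed
  have "\<N> \<subseteq> {v \<in> \<F>. ?L v = \<zero>\<^bsub>G\<^esub>}"
    unfolding tensor_null_def
  proof (rule formal.span_minimal)
    show "formal.subspace {v \<in> \<F>. ?L v = \<zero>\<^bsub>G\<^esub>}"
      by (rule formal.subspaceI)
        (simp_all add: zero_mem add_mem scale_mem L_add L_scale G.formal_sum_zero)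
  qed (use rel relations_formal in auto)
  then have null: "?L v = \<zero>\<^bsub>G\<^esub>" if "v \<in> \<N>" for v using that by auto
  have list: "(\<Sum>z\<leftarrow>zs. Poly_Mapping.single z 1) \<in> \<F> \<and>
      nrm G (?L (\<Sum>z\<leftarrow>zs. Poly_Mapping.single z 1)) \<le> K * cost zs"
    if "set zs \<subseteq> ?D" for zs
    using that
  proof (induction zs)
    case Nil
    then show ?case by (simp add: zero_mem G.formal_sum_zero)
  next
    case (Cons z zs)
    obtain x y where z: "z = (x, y)" by (cases z)
    have xy: "x \<in> carrier E" "y \<in> carrier F" using Cons.prems z by auto
    let ?s = "\<Sum>z\<leftarrow>zs. Poly_Mapping.single z (1 :: complex)"
    have IH: "?s \<in> \<F>" "nrm G (?L ?s) \<le> K * cost zs" using Cons by auto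
    have "nrm G (?L (Poly_Mapping.single (x, y) 1 + ?s)) \<le> nrm G (\<beta> x y) + nrm G (?L ?s)"
      using G.nrm_triangle[OF bilinear_map_closed[OF \<beta> xy] L_mem[OF IH(1)]] xy IH
        bilinear_map_closed[OF \<beta> xy]
      by (simp add: L_add L_single)
    also have "\<dots> \<le> K * nrm E x * nrm F y + K * cost zs"
      by (intro add_mono bound xy IH)
    finally show ?case
      using IH xy by (simp add: z add_mem algebra_simps)
  qed
  have "nrm G (?L u) \<le> K * cost zs" if "represents zs u" for zs
  proof -
    have *: "set zs \<subseteq> ?D" "u - (\<Sum>z\<leftarrow>zs. Poly_Mapping.single z 1) \<in> \<N>"
      using that by (auto simp: represents_def)
    have "?L u = ?L (\<Sum>z\<leftarrow>zs. Poly_Mapping.single z 1)"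
      using null[OF *(2)] u list[OF *(1)] L_mem by (simp add: L_diff G.diff_eq_zero_iff)
    then show ?thesis using list[OF *(1)] by simp
  qed
  note key = this
  show ?thesis
  proof (rule field_le_epsilon)
    fix \<epsilon> :: real assume "\<epsilon> > 0"
    then have e: "\<epsilon> / (K + 1) > 0" using \<open>K \<ge> 0\<close> by simp
    obtain zs where zs: "represents zs u" "cost zs < pn u + \<epsilon> / (K + 1)"
      by (rule pn_approx[OF u e])
    have "nrm G (?L u) \<le> K * (pn u + \<epsilon> / (K + 1))"
      using key[OF zs(1)] mult_left_mono[OF less_imp_le[OF zs(2)] \<open>K \<ge> 0\<close>] by linarith
    also have "\<dots> = K * pn u + \<epsilon> * (K / (K + 1))" by (simp add: algebra_simps)
    also have "\<epsilon> * (K / (K + 1)) \<le> \<epsilon> * 1"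
      using \<open>\<epsilon> > 0\<close> \<open>K \<ge> 0\<close> by (intro mult_left_mono) auto
    finally show "nrm G (?L u) \<le> K * pn u + \<epsilon>" by simp
  qed
qed

text \<open>On formal tensors the map is the linear extension of \<open>\<beta>\<close>; boundedness for the projective
  seminorm lets it pass to the completion.\<close>

theorem ptensor_universal:
  fixes G :: "'g nspace"
  assumes "banach_space G" and \<beta>: "bilinear_map E F G \<beta>" and "K \<ge> 0"
    and bound: "\<And>x y. \<lbrakk>x \<in> carrier E; y \<in> carrier F\<rbrakk> \<Longrightarrow> nrm G (\<beta> x y) \<le> K * nrm E x * nrm F y"
  shows "\<exists>L. linear_map (E \<otimes>\<^sub>\<pi> F) G L \<and>
    (\<forall>x\<in>carrier E. \<forall>y\<in>carrier F. L (pure_tensor E F x y) = \<beta> x y) \<and>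
    (\<forall>w\<in>carrier (E \<otimes>\<^sub>\<pi> F). nrm G (L w) \<le> K * nrm (E \<otimes>\<^sub>\<pi> F) w)"
proof -
  interpret G: banach_space G by fact
  let ?T = "G.formal_sum (case_prod \<beta>)" and ?D = "carrier E \<times> carrier F"
  have D: "case_prod \<beta> \<in> ?D \<rightarrow> carrier G"
    using bilinear_map_closed[OF \<beta>] by auto
  have F: "Poly_Mapping.keys u \<subseteq> ?D" if "u \<in> \<F>" for u
    using that by (simp add: formal_tensors_def)
  have "\<exists>L. linear_map (E \<otimes>\<^sub>\<pi> F) G L \<and> (\<forall>u\<in>\<F>. L (emb u) = ?T u) \<and>
      (\<forall>w\<in>carrier (E \<otimes>\<^sub>\<pi> F). nrm G (L w) \<le> K * nrm (E \<otimes>\<^sub>\<pi> F) w)"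
    by (rule extend_to_completion[OF assms(1) \<open>K \<ge> 0\<close>])
      (fact G.formal_sum_closed[OF F D] G.formal_sum_add[OF F F D] G.formal_sum_scale[OF F D] |
        rule formal_sum_bilinear[OF G.normed_space_axioms \<beta> \<open>K \<ge> 0\<close>], rule bound)+
  then obtain L where L: "linear_map (E \<otimes>\<^sub>\<pi> F) G L" "\<forall>u\<in>\<F>. L (emb u) = ?T u"
      "\<forall>w\<in>carrier (E \<otimes>\<^sub>\<pi> F). nrm G (L w) \<le> K * nrm (E \<otimes>\<^sub>\<pi> F) w"
    by blast
  have "L (pure_tensor E F x y) = \<beta> x y" if "x \<in> carrier E" "y \<in> carrier F" for x y
    using that bilinear_map_closed[OF \<beta> that] L(2)
    by (simp add: pure_tensor_eq G.formal_sum_single)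
  then show ?thesis using L by (intro exI[of _ L] conjI ballI) simp_all
qed

text \<open>Both maps are continuous, and pure tensors span a dense subspace.\<close>

theorem ptensor_eqI:
  fixes G :: "'g nspace"
  assumes "normed_space G"
    and S: "bounded_linear_map (E \<otimes>\<^sub>\<pi> F) G S" and T: "bounded_linear_map (E \<otimes>\<^sub>\<pi> F) G T"
    and eq: "\<And>x y. \<lbrakk>x \<in> carrier E; y \<in> carrier F\<rbrakk> \<Longrightarrow> S (pure_tensor E F x y) = T (pure_tensor E F x y)"
    and w: "w \<in> carrier (E \<otimes>\<^sub>\<pi> F)"
  shows "S w = T w"
proof -
  interpret G: normed_space G by fact
  have "S (emb u) = T (emb u)" if u: "u \<in> \<F>" for u
  proof -
    have "(\<Sum>k\<in>K. Poly_Mapping.single k (Poly_Mapping.lookup u k)) \<in> \<F> \<and>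
        S (emb (\<Sum>k\<in>K. Poly_Mapping.single k (Poly_Mapping.lookup u k))) =
        T (emb (\<Sum>k\<in>K. Poly_Mapping.single k (Poly_Mapping.lookup u k)))"
      if "finite K" "K \<subseteq> carrier E \<times> carrier F" for K
      using that
    proof (induction K)
      case empty
      have "emb 0 = 0 \<odot>\<^bsub>E \<otimes>\<^sub>\<pi> F\<^esub> emb 0"
        using emb_mem[OF zero_mem] emb_scale[OF zero_mem, of 0] by simp
      then have "S (emb 0) = \<zero>\<^bsub>G\<^esub>" "T (emb 0) = \<zero>\<^bsub>G\<^esub>"
        using bounded_linear_map_scale[OF S emb_mem[OF zero_mem], of 0]
          bounded_linear_map_scale[OF T emb_mem[OF zero_mem], of 0]
          bounded_linear_map_closed[OF S emb_mem[OF zero_mem]]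
          bounded_linear_map_closed[OF T emb_mem[OF zero_mem]]
        by simp_all
      then show ?case by (simp add: zero_mem)
    next
      case (insert k K)
      obtain x y where k: "k = (x, y)" "x \<in> carrier E" "y \<in> carrier F"
        using insert.prems by (cases k) auto
      then show ?case
        using insert
        by (simp add: emb_add emb_mem add_mem bounded_linear_map_add[OF S] bounded_linear_map_add[OF T]
            emb_single bounded_linear_map_scale[OF S] bounded_linear_map_scale[OF T] eq pure_tensor_mem)
    qed
    from this[of "Poly_Mapping.keys u"] show ?thesis
      using u formal_tensor_eq_sum[of u] by (simp add: formal_tensors_def)
  qed
  note dense = this
  obtain s where s: "s \<in> Cau" "w = cls s" using w by (rule carrier_completionE)
  obtain K where K: "\<And>x. x \<in> carrier (E \<otimes>\<^sub>\<pi> F) \<Longrightarrow> nrm G (S x) \<le> K * nrm (E \<otimes>\<^sub>\<pi> F) x"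
    using S by (auto simp: bounded_linear_map_def)
  obtain L where L: "\<And>x. x \<in> carrier (E \<otimes>\<^sub>\<pi> F) \<Longrightarrow> nrm G (T x) \<le> L * nrm (E \<otimes>\<^sub>\<pi> F) x"
    using T by (auto simp: bounded_linear_map_def)
  have mem: "emb (s n) \<in> carrier (E \<otimes>\<^sub>\<pi> F)" for n by (intro emb_mem Cau_mem s)
  have lim: "G.converges (\<lambda>n. R (emb (s n))) (R w)"
    if R: "bounded_linear_map (E \<otimes>\<^sub>\<pi> F) G R"
      and M: "\<And>x. x \<in> carrier (E \<otimes>\<^sub>\<pi> F) \<Longrightarrow> nrm G (R x) \<le> M * nrm (E \<otimes>\<^sub>\<pi> F) x" for R M
    unfolding G.converges_def
  proof (rule real_null_comparison)
    fix n
    have "R (emb (s n)) \<ominus>\<^bsub>G\<^esub> R w = R (emb (s n) \<ominus>\<^bsub>E \<otimes>\<^sub>\<pi> F\<^esub> w)"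
      using linear_map_diff[OF normed_completion assms(1) bounded_linear_map_linear[OF R] mem w]
      by simp
    then show "\<bar>nrm G (R (emb (s n)) \<ominus>\<^bsub>G\<^esub> R w)\<bar> \<le> M * nrm (E \<otimes>\<^sub>\<pi> F) (emb (s n) \<ominus>\<^bsub>E \<otimes>\<^sub>\<pi> F\<^esub> w)"
      using M[OF compl.minus_closed[OF mem w], of n] bounded_linear_map_closed[OF R] mem w by simp
    show "(\<lambda>n. M * nrm (E \<otimes>\<^sub>\<pi> F) (emb (s n) \<ominus>\<^bsub>E \<otimes>\<^sub>\<pi> F\<^esub> w)) \<longlonglongrightarrow> 0"
      using tendsto_mult_left[OF emb_converges[OF s(1), unfolded compl.converges_def], of M] s
      by simp
  qed
  have "(\<lambda>n. S (emb (s n))) = (\<lambda>n. T (emb (s n)))"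
    using dense Cau_mem[OF s(1)] by auto
  moreover have "G.converges (\<lambda>n. S (emb (s n))) (S w)"
    by (rule lim[OF S]) (rule K)
  moreover have "G.converges (\<lambda>n. T (emb (s n))) (T w)"
    by (rule lim[OF T]) (rule L)
  ultimately show ?thesis
    by (intro G.converges_unique[of "\<lambda>n. S (emb (s n))"])
      (use bounded_linear_map_closed[OF S] bounded_linear_map_closed[OF T] mem w in auto)
qed

text \<open>The description by which the lift is defined has exactly one solution: one exists by the
  universal property, and no other does since pure tensors span a dense subspace.\<close>

lemma ptensor_lift:
  fixes G :: "'g nspace"
  assumes "banach_space G" and \<beta>: "bilinear_map E F G \<beta>" and "K \<ge> 0"
    and bound: "\<forall>x\<in>carrier E. \<forall>y\<in>carrier F. nrm G (\<beta> x y) \<le> K * nrm E x * nrm F y"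
  shows bounded_linear_ptensor_lift: "bounded_linear_map (E \<otimes>\<^sub>\<pi> F) G (ptensor_lift E F G \<beta>)"
    and ptensor_lift_pure:
      "\<And>x y. \<lbrakk>x \<in> carrier E; y \<in> carrier F\<rbrakk> \<Longrightarrow> ptensor_lift E F G \<beta> (pure_tensor E F x y) = \<beta> x y"
    and nrm_ptensor_lift_le:
      "\<And>w. w \<in> carrier (E \<otimes>\<^sub>\<pi> F) \<Longrightarrow> nrm G (ptensor_lift E F G \<beta> w) \<le> K * nrm (E \<otimes>\<^sub>\<pi> F) w"
proof -
  interpret G: banach_space G by fact
  have "\<exists>L. linear_map (E \<otimes>\<^sub>\<pi> F) G L \<and>
    (\<forall>x\<in>carrier E. \<forall>y\<in>carrier F. L (pure_tensor E F x y) = \<beta> x y) \<and>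
    (\<forall>w\<in>carrier (E \<otimes>\<^sub>\<pi> F). nrm G (L w) \<le> K * nrm (E \<otimes>\<^sub>\<pi> F) w)"
    by (rule ptensor_universal[OF assms(1) \<beta> \<open>K \<ge> 0\<close>]) (use bound in blast)
  then obtain L where L: "linear_map (E \<otimes>\<^sub>\<pi> F) G L"
    "\<forall>x\<in>carrier E. \<forall>y\<in>carrier F. L (pure_tensor E F x y) = \<beta> x y"
    "\<forall>w\<in>carrier (E \<otimes>\<^sub>\<pi> F). nrm G (L w) \<le> K * nrm (E \<otimes>\<^sub>\<pi> F) w"
    by blast
  define L' where "L' = restrict L (carrier (E \<otimes>\<^sub>\<pi> F))"
  have L'_eq: "L' w = L w" if "w \<in> carrier (E \<otimes>\<^sub>\<pi> F)" for w
    using that by (simp add: L'_def)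
  have L': "bounded_linear_map (E \<otimes>\<^sub>\<pi> F) G L'"
    using L(3) by (intro bounded_linear_mapI[where K = K] linear_mapI)
      (simp_all add: L'_eq linear_map_closed[OF L(1)] linear_map_add[OF L(1)] linear_map_scale[OF L(1)])
  have pure: "L' (pure_tensor E F x y) = \<beta> x y" if "x \<in> carrier E" "y \<in> carrier F" for x y
    using that by (simp add: L'_eq L(2) pure_tensor_mem)
  have "ptensor_lift E F G \<beta> = L'"
    unfolding ptensor_lift_def
  proof (rule the_equality)
    show "L' \<in> extensional (carrier (E \<otimes>\<^sub>\<pi> F)) \<and> bounded_linear_map (E \<otimes>\<^sub>\<pi> F) G L' \<and>
        (\<forall>x\<in>carrier E. \<forall>y\<in>carrier F. L' (pure_tensor E F x y) = \<beta> x y)"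
      using L' pure by (simp add: L'_def)
    show "M = L'" if M: "M \<in> extensional (carrier (E \<otimes>\<^sub>\<pi> F)) \<and> bounded_linear_map (E \<otimes>\<^sub>\<pi> F) G M \<and>
        (\<forall>x\<in>carrier E. \<forall>y\<in>carrier F. M (pure_tensor E F x y) = \<beta> x y)" for M
    proof (rule extensionalityI)
      show "M x = L' x" if "x \<in> carrier (E \<otimes>\<^sub>\<pi> F)" for x
        by (rule ptensor_eqI[OF G.normed_space_axioms _ L' _ that]) (use M pure in auto)
    qed (use M in \<open>auto simp: L'_def\<close>)
  qed
  then show "bounded_linear_map (E \<otimes>\<^sub>\<pi> F) G (ptensor_lift E F G \<beta>)"
    and "\<And>x y. \<lbrakk>x \<in> carrier E; y \<in> carrier F\<rbrakk> \<Longrightarrow> ptensor_lift E F G \<beta> (pure_tensor E F x y) = \<beta> x y"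
    and "\<And>w. w \<in> carrier (E \<otimes>\<^sub>\<pi> F) \<Longrightarrow> nrm G (ptensor_lift E F G \<beta> w) \<le> K * nrm (E \<otimes>\<^sub>\<pi> F) w"
    using L' pure L(3) by (simp_all add: L'_eq)
qed

lemma banach_ptensor: "banach_space (E \<otimes>\<^sub>\<pi> F)"
  by (rule banach_completion)

end


lemma bounded_linear_map_id: "normed_space V \<Longrightarrow> bounded_linear_map V V (\<lambda>x. x)"
  by (rule bounded_linear_mapI[where K = 1]) (auto simp: linear_map_def)

lemma linear_map_plus:
  assumes "normed_space W" "linear_map V W S" "linear_map V W T"
  shows "linear_map V W (\<lambda>x. S x \<oplus>\<^bsub>W\<^esub> T x)"
proof -
  interpret W: normed_space W by fact
  show ?thesis
    by (rule linear_mapI) (simp_all add: linear_map_closed[OF assms(2)] linear_map_closed[OF assms(3)]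
        linear_map_add[OF assms(2)] linear_map_add[OF assms(3)] linear_map_scale[OF assms(2)]
        linear_map_scale[OF assms(3)] W.scale_right_distrib W.a_ac)
qed

lemma bounded_linear_map_plus:
  assumes "normed_space W" "bounded_linear_map V W S" "bounded_linear_map V W T"
  shows "bounded_linear_map V W (\<lambda>x. S x \<oplus>\<^bsub>W\<^esub> T x)"
proof -
  interpret W: normed_space W by fact
  obtain K where K: "\<forall>x\<in>carrier V. nrm W (S x) \<le> K * nrm V x"
    using assms(2) by (auto simp: bounded_linear_map_def)
  obtain L where L: "\<forall>x\<in>carrier V. nrm W (T x) \<le> L * nrm V x"
    using assms(3) by (auto simp: bounded_linear_map_def)
  show ?thesis
  proof (rule bounded_linear_mapI)
    show "linear_map V W (\<lambda>x. S x \<oplus>\<^bsub>W\<^esub> T x)"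
      by (intro linear_map_plus assms bounded_linear_map_linear)
    show "nrm W (S x \<oplus>\<^bsub>W\<^esub> T x) \<le> (K + L) * nrm V x" if "x \<in> carrier V" for x
      using W.nrm_triangle[of "S x" "T x"] K L that bounded_linear_map_closed[OF assms(2)]
        bounded_linear_map_closed[OF assms(3)] by (fastforce simp: distrib_right)
  qed
qed

lemma linear_map_smult:
  assumes "normed_space W" "linear_map V W T"
  shows "linear_map V W (\<lambda>x. c \<odot>\<^bsub>W\<^esub> T x)"
proof -
  interpret W: normed_space W by fact
  show ?thesis
    by (rule linear_mapI) (simp_all add: linear_map_closed[OF assms(2)]
        linear_map_add[OF assms(2)] linear_map_scale[OF assms(2)] W.scale_right_distrib
        W.scale_scale mult.commute)
qed

lemma bounded_linear_map_smult:
  assumes "normed_space W" "bounded_linear_map V W T"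
  shows "bounded_linear_map V W (\<lambda>x. c \<odot>\<^bsub>W\<^esub> T x)"
proof -
  interpret W: normed_space W by fact
  obtain K where K: "\<forall>x\<in>carrier V. nrm W (T x) \<le> K * nrm V x"
    using assms(2) by (auto simp: bounded_linear_map_def)
  show ?thesis
  proof (rule bounded_linear_mapI)
    show "linear_map V W (\<lambda>x. c \<odot>\<^bsub>W\<^esub> T x)"
      by (intro linear_map_smult assms bounded_linear_map_linear)
    show "nrm W (c \<odot>\<^bsub>W\<^esub> T x) \<le> (cmod c * K) * nrm V x" if "x \<in> carrier V" for x
      using mult_left_mono[OF bspec[OF K that], of "cmod c"] that
        bounded_linear_map_closed[OF assms(2)] by (simp add: W.nrm_smult mult.assoc)
  qed
qed


section \<open>Tensor products of maps and of modules\<close>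

definition tensor_map ::
  "'e nspace \<Rightarrow> 'f nspace \<Rightarrow> 'g nspace \<Rightarrow> 'h nspace \<Rightarrow> ('e \<Rightarrow> 'g) \<Rightarrow> ('f \<Rightarrow> 'h) \<Rightarrow>
   ('e, 'f) tensor_elt \<Rightarrow> ('g, 'h) tensor_elt" where
  "tensor_map E F G H S T = ptensor_lift E F (G \<otimes>\<^sub>\<pi> H) (\<lambda>x y. pure_tensor G H (S x) (T y))"

lemma tensor_left_action_eq: "tensor_left_action E F l a = tensor_map E F E F (l a) (\<lambda>y. y)"
  by (simp add: tensor_left_action_def tensor_map_def)

lemma tensor_right_action_eq: "tensor_right_action E F r w a = tensor_map E F E F (\<lambda>x. x) (\<lambda>y. r y a) w"
  by (simp add: tensor_right_action_def tensor_map_def)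

lemma tensor_map:
  fixes E :: "'e nspace" and F :: "'f nspace" and G :: "'g nspace" and H :: "'h nspace"
  assumes "normed_space E" "normed_space F" "normed_space G" "normed_space H"
    and S: "linear_map E G S" "\<And>x. x \<in> carrier E \<Longrightarrow> nrm G (S x) \<le> K * nrm E x" "K \<ge> 0"
    and T: "linear_map F H T" "\<And>y. y \<in> carrier F \<Longrightarrow> nrm H (T y) \<le> L * nrm F y" "L \<ge> 0"
  shows linear_tensor_map: "linear_map (E \<otimes>\<^sub>\<pi> F) (G \<otimes>\<^sub>\<pi> H) (tensor_map E F G H S T)"
    and tensor_map_pure: "\<And>x y. \<lbrakk>x \<in> carrier E; y \<in> carrier F\<rbrakk> \<Longrightarrow>
          tensor_map E F G H S T (pure_tensor E F x y) = pure_tensor G H (S x) (T y)"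
    and nrm_tensor_map_le: "\<And>w. w \<in> carrier (E \<otimes>\<^sub>\<pi> F) \<Longrightarrow>
          nrm (G \<otimes>\<^sub>\<pi> H) (tensor_map E F G H S T w) \<le> K * L * nrm (E \<otimes>\<^sub>\<pi> F) w"
proof -
  interpret D: normed_pair E F by (simp add: normed_pair_def assms)
  interpret C: normed_pair G H by (simp add: normed_pair_def assms)
  have bil: "bilinear_map E F (G \<otimes>\<^sub>\<pi> H) (\<lambda>x y. pure_tensor G H (S x) (T y))"
    by (rule bilinear_map_compose[OF C.bilinear_pure_tensor S(1) T(1)])
  have bound: "\<forall>x\<in>carrier E. \<forall>y\<in>carrier F.
      nrm (G \<otimes>\<^sub>\<pi> H) (pure_tensor G H (S x) (T y)) \<le> (K * L) * nrm E x * nrm F y"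
  proof (intro ballI)
    fix x y assume that: "x \<in> carrier E" "y \<in> carrier F"
    have m: "S x \<in> carrier G" "T y \<in> carrier H"
      using that linear_map_closed[OF S(1)] linear_map_closed[OF T(1)] by auto
    have "nrm (G \<otimes>\<^sub>\<pi> H) (pure_tensor G H (S x) (T y)) \<le> nrm G (S x) * nrm H (T y)"
      by (intro C.nrm_pure_tensor_le m)
    also have "\<dots> \<le> (K * nrm E x) * (L * nrm F y)"
      using that m S(3) by (intro mult_mono S(2) T(2)) simp_all
    finally show "nrm (G \<otimes>\<^sub>\<pi> H) (pure_tensor G H (S x) (T y)) \<le> (K * L) * nrm E x * nrm F y"
      by (simp add: algebra_simps)
  qed
  have KL: "K * L \<ge> 0" using S(3) T(3) by simp
  note lift = D.ptensor_lift[OF C.banach_ptensor bil KL bound, folded tensor_map_def]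
  show "linear_map (E \<otimes>\<^sub>\<pi> F) (G \<otimes>\<^sub>\<pi> H) (tensor_map E F G H S T)"
    by (rule bounded_linear_map_linear[OF lift(1)])
  show "tensor_map E F G H S T (pure_tensor E F x y) = pure_tensor G H (S x) (T y)"
    if "x \<in> carrier E" "y \<in> carrier F" for x y
    by (rule lift(2)) (use that in auto)
  show "nrm (G \<otimes>\<^sub>\<pi> H) (tensor_map E F G H S T w) \<le> K * L * nrm (E \<otimes>\<^sub>\<pi> F) w"
    if "w \<in> carrier (E \<otimes>\<^sub>\<pi> F)" for w
    by (rule lift(3)) (use that in auto)
qed

lemma bounded_tensor_map:
  assumes EF: "normed_space E" "normed_space F" and GH: "normed_space G" "normed_space H"
    and S: "bounded_linear_map E G S" and T: "bounded_linear_map F H T"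
  shows bounded_linear_tensor_map: "bounded_linear_map (E \<otimes>\<^sub>\<pi> F) (G \<otimes>\<^sub>\<pi> H) (tensor_map E F G H S T)"
    and bounded_tensor_map_pure: "\<And>x y. \<lbrakk>x \<in> carrier E; y \<in> carrier F\<rbrakk> \<Longrightarrow>
          tensor_map E F G H S T (pure_tensor E F x y) = pure_tensor G H (S x) (T y)"
proof -
  obtain K where K: "K \<ge> 0" "\<forall>x\<in>carrier E. nrm G (S x) \<le> K * nrm E x"
    using bounded_linear_map_bound[OF EF(1) S] by blast
  obtain L where L: "L \<ge> 0" "\<forall>y\<in>carrier F. nrm H (T y) \<le> L * nrm F y"
    using bounded_linear_map_bound[OF EF(2) T] by blast
  note tm = tensor_map[OF EF GH bounded_linear_map_linear[OF S] bspec[OF K(2)] K(1)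
      bounded_linear_map_linear[OF T] bspec[OF L(2)] L(1)]
  show "bounded_linear_map (E \<otimes>\<^sub>\<pi> F) (G \<otimes>\<^sub>\<pi> H) (tensor_map E F G H S T)"
    by (rule bounded_linear_mapI[where K = "K * L"]; rule tm; assumption)
  show "tensor_map E F G H S T (pure_tensor E F x y) = pure_tensor G H (S x) (T y)"
    if "x \<in> carrier E" "y \<in> carrier F" for x y
    by (rule tm; (assumption | rule that))
qed

lemma normed_banach: "banach_space V \<Longrightarrow> normed_space V"
  by (simp add: banach_space.axioms banach_space_def normed_space_def normed_space_axioms_def
      banach_space_axioms_def)

lemma left_banach_moduleD:
  assumes "left_banach_module B Y l"
  shows "banach_space Y" "bounded_bilinear_map B Y Y l" "bilinear_map B Y Y l"
    and "\<And>a b y. \<lbrakk>a \<in> carrier B; b \<in> carrier B; y \<in> carrier Y\<rbrakk> \<Longrightarrow> l (a \<otimes>\<^bsub>B\<^esub> b) y = l a (l b y)"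
  using assms by (auto simp: left_banach_module_def bounded_bilinear_map_def)

lemma right_banach_moduleD:
  assumes "right_banach_module B Y r"
  shows "banach_space Y" "bounded_bilinear_map Y B Y r" "bilinear_map Y B Y r"
    and "\<And>a b y. \<lbrakk>a \<in> carrier B; b \<in> carrier B; y \<in> carrier Y\<rbrakk> \<Longrightarrow> r y (a \<otimes>\<^bsub>B\<^esub> b) = r (r y a) b"
  using assms by (auto simp: right_banach_module_def bounded_bilinear_map_def)

lemma bounded_bilinear_map_right:
  assumes "bounded_bilinear_map U V W \<beta>" "x \<in> carrier U"
  shows "bounded_linear_map V W (\<beta> x)"
proof -
  obtain K where "\<forall>x\<in>carrier U. \<forall>y\<in>carrier V. nrm W (\<beta> x y) \<le> K * nrm U x * nrm V y"
    using assms(1) by (auto simp: bounded_bilinear_map_def)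
  then show ?thesis
    using assms by (intro bounded_linear_mapI[where K = "K * nrm U x"])
      (auto simp: bounded_bilinear_map_def bilinear_map_def)
qed

lemma bounded_bilinear_map_left:
  assumes "bounded_bilinear_map U V W \<beta>" "y \<in> carrier V"
  shows "bounded_linear_map U W (\<lambda>x. \<beta> x y)"
proof -
  obtain K where "\<forall>x\<in>carrier U. \<forall>y\<in>carrier V. nrm W (\<beta> x y) \<le> K * nrm U x * nrm V y"
    using assms(1) by (auto simp: bounded_bilinear_map_def)
  then show ?thesis
    using assms by (intro bounded_linear_mapI[where K = "K * nrm V y"])
      (auto simp: bounded_bilinear_map_def bilinear_map_def mult_ac)
qed

context banach_algebra
begin

lemma mult_closed: "\<lbrakk>x \<in> carrier A; y \<in> carrier A\<rbrakk> \<Longrightarrow> x \<otimes> y \<in> carrier A"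
  by (rule bilinear_map_closed[OF mult_bilinear])

lemma linear_mult_left: "x \<in> carrier A \<Longrightarrow> linear_map A A (\<lambda>y. x \<otimes> y)"
  by (rule bilinear_map_right[OF mult_bilinear])

lemma linear_mult_right: "y \<in> carrier A \<Longrightarrow> linear_map A A (\<lambda>x. x \<otimes> y)"
  by (rule bilinear_map_left[OF mult_bilinear])

lemmas mult_add_right = linear_map_add[OF linear_mult_left]
lemmas mult_add_left = linear_map_add[OF linear_mult_right]
lemmas mult_scale_right = linear_map_scale[OF linear_mult_left]
lemmas mult_scale_left = linear_map_scale[OF linear_mult_right]

lemma bounded_bilinear_mult: "bounded_bilinear_map A A A (mult A)"
  unfolding bounded_bilinear_map_def
  by (intro conjI mult_bilinear exI[of _ 1]) (simp add: nrm_mult_le)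

lemma left_banach_module_self: "left_banach_module A A (mult A)"
  by (simp add: left_banach_module_def bounded_bilinear_mult banach_space_axioms mult_assoc)

lemma right_banach_module_self: "right_banach_module A A (mult A)"
  by (simp add: right_banach_module_def bounded_bilinear_mult banach_space_axioms mult_assoc)

end

locale tensor_module = B: banach_algebra B + E: banach_space E + F: banach_space F
  for B :: "'b nspace" and E :: "'e nspace" and F :: "'f nspace"
begin

sublocale EF: normed_pair E F by unfold_locales

abbreviation "EF \<equiv> E \<otimes>\<^sub>\<pi> F"

lemmas nEF = E.normed_space_axioms F.normed_space_axioms

lemma left_action:
  assumes "left_banach_module B E l" "a \<in> carrier B"
  shows bounded_linear_left_action: "bounded_linear_map EF EF (tensor_left_action E F l a)"
    and left_action_pure: "\<And>x y. \<lbrakk>x \<in> carrier E; y \<in> carrier F\<rbrakk> \<Longrightarrow>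
      tensor_left_action E F l a (pure_tensor E F x y) = pure_tensor E F (l a x) y"
  unfolding tensor_left_action_eq
  using bounded_tensor_map[OF nEF nEF
      bounded_bilinear_map_right[OF left_banach_moduleD(2)[OF assms(1)] assms(2)]
      bounded_linear_map_id[OF F.normed_space_axioms]] by auto

lemma right_action:
  assumes "right_banach_module B F r" "a \<in> carrier B"
  shows bounded_linear_right_action: "bounded_linear_map EF EF (\<lambda>w. tensor_right_action E F r w a)"
    and right_action_pure: "\<And>x y. \<lbrakk>x \<in> carrier E; y \<in> carrier F\<rbrakk> \<Longrightarrow>
      tensor_right_action E F r (pure_tensor E F x y) a = pure_tensor E F x (r y a)"
  unfolding tensor_right_action_eq
  using bounded_tensor_map[OF nEF nEF bounded_linear_map_id[OF E.normed_space_axioms]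
      bounded_bilinear_map_left[OF right_banach_moduleD(2)[OF assms(1)] assms(2)]] by auto

text \<open>Additivity in the algebra element and associativity of the action are identities between
  bounded maps on the tensor product, so they need checking on pure tensors only.\<close>

lemma left_banach_module_ptensor:
  assumes M: "left_banach_module B E l"
  shows "left_banach_module B EF (tensor_left_action E F l)"
proof -
  let ?l = "tensor_left_action E F l"
  note l = left_banach_moduleD[OF M]
  obtain K where K: "K \<ge> 0" "\<forall>a\<in>carrier B. \<forall>x\<in>carrier E. nrm E (l a x) \<le> K * nrm B a * nrm E x"
    using bounded_bilinear_map_bound[OF B.normed_space_axioms E.normed_space_axioms l(2)] by blast
  note bl = bounded_linear_left_action[OF M] and pure = left_action_pure[OF M]
  have lin: "linear_map B E (\<lambda>a. l a x)" if "x \<in> carrier E" for x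
    by (rule bilinear_map_left[OF l(3) that])
  have mem: "l a x \<in> carrier E" if "a \<in> carrier B" "x \<in> carrier E" for a x
    by (rule bilinear_map_closed[OF l(3) that])
  have linB: "linear_map B EF (\<lambda>a. ?l a w)" if w: "w \<in> carrier EF" for w
  proof (rule linear_mapI)
    show "?l a w \<in> carrier EF" if "a \<in> carrier B" for a
      by (rule bounded_linear_map_closed[OF bl[OF that] w])
    show "?l (a \<oplus>\<^bsub>B\<^esub> b) w = ?l a w \<oplus>\<^bsub>EF\<^esub> ?l b w" if ab: "a \<in> carrier B" "b \<in> carrier B" for a b
      by (rule EF.ptensor_eqI[OF EF.normed_completion bl
            bounded_linear_map_plus[OF EF.normed_completion bl bl] _ w])
        (use ab in \<open>simp_all add: pure linear_map_add[OF lin]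
          linear_map_add[OF bilinear_map_left[OF EF.bilinear_pure_tensor]] mem\<close>)
    show "?l (c \<odot>\<^bsub>B\<^esub> a) w = c \<odot>\<^bsub>EF\<^esub> ?l a w" if a: "a \<in> carrier B" for c a
      by (rule EF.ptensor_eqI[OF EF.normed_completion bl
            bounded_linear_map_smult[OF EF.normed_completion bl] _ w])
        (use a in \<open>simp_all add: pure linear_map_scale[OF lin]
          linear_map_scale[OF bilinear_map_left[OF EF.bilinear_pure_tensor]] mem\<close>)
  qed
  have bound: "nrm EF (?l a w) \<le> K * nrm B a * nrm EF w"
    if "a \<in> carrier B" "w \<in> carrier EF" for a w
  proof -
    have "nrm EF (tensor_map E F E F (l a) (\<lambda>y. y) w) \<le> (K * nrm B a) * 1 * nrm EF w"
      by (rule nrm_tensor_map_le[OF nEF nEF bilinear_map_right[OF l(3)]])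
        (use that K in \<open>auto simp: linear_map_def\<close>)
    then show ?thesis by (simp add: tensor_left_action_eq)
  qed
  have assoc: "?l (a \<otimes>\<^bsub>B\<^esub> b) w = ?l a (?l b w)"
    if ab: "a \<in> carrier B" "b \<in> carrier B" and w: "w \<in> carrier EF" for a b w
    by (rule EF.ptensor_eqI[OF EF.normed_completion bl
          bounded_linear_map_compose[OF EF.normed_completion EF.normed_completion bl bl] _ w])
      (use ab in \<open>simp_all add: pure l(4) mem B.mult_closed\<close>)
  have "bounded_bilinear_map B EF EF ?l"
    unfolding bounded_bilinear_map_def
    by (intro conjI exI[of _ K] ballI bound bilinear_mapI linB bounded_linear_map_linear bl)
  then show ?thesis
    by (simp add: left_banach_module_def EF.banach_ptensor assoc)
qed

lemma right_banach_module_ptensor: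
  assumes M: "right_banach_module B F r"
  shows "right_banach_module B EF (tensor_right_action E F r)"
proof -
  let ?r = "tensor_right_action E F r"
  note r = right_banach_moduleD[OF M]
  obtain K where K: "K \<ge> 0" "\<forall>y\<in>carrier F. \<forall>a\<in>carrier B. nrm F (r y a) \<le> K * nrm F y * nrm B a"
    using bounded_bilinear_map_bound[OF F.normed_space_axioms B.normed_space_axioms r(2)] by blast
  note br = bounded_linear_right_action[OF M] and pure = right_action_pure[OF M]
  have lin: "linear_map B F (r y)" if "y \<in> carrier F" for y
    by (rule bilinear_map_right[OF r(3) that])
  have mem: "r y a \<in> carrier F" if "y \<in> carrier F" "a \<in> carrier B" for a y
    by (rule bilinear_map_closed[OF r(3) that])
  have linB: "linear_map B EF (?r w)" if w: "w \<in> carrier EF" for w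
  proof (rule linear_mapI)
    show "?r w a \<in> carrier EF" if "a \<in> carrier B" for a
      by (rule bounded_linear_map_closed[OF br[OF that] w])
    show "?r w (a \<oplus>\<^bsub>B\<^esub> b) = ?r w a \<oplus>\<^bsub>EF\<^esub> ?r w b" if ab: "a \<in> carrier B" "b \<in> carrier B" for a b
      by (rule EF.ptensor_eqI[OF EF.normed_completion br
            bounded_linear_map_plus[OF EF.normed_completion br br] _ w])
        (use ab in \<open>simp_all add: pure linear_map_add[OF lin]
          linear_map_add[OF bilinear_map_right[OF EF.bilinear_pure_tensor]] mem\<close>)
    show "?r w (c \<odot>\<^bsub>B\<^esub> a) = c \<odot>\<^bsub>EF\<^esub> ?r w a" if a: "a \<in> carrier B" for c a
      by (rule EF.ptensor_eqI[OF EF.normed_completion br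
            bounded_linear_map_smult[OF EF.normed_completion br] _ w])
        (use a in \<open>simp_all add: pure linear_map_scale[OF lin]
          linear_map_scale[OF bilinear_map_right[OF EF.bilinear_pure_tensor]] mem\<close>)
  qed
  have bound: "nrm EF (?r w a) \<le> K * nrm EF w * nrm B a"
    if "w \<in> carrier EF" "a \<in> carrier B" for a w
  proof -
    have "nrm EF (tensor_map E F E F (\<lambda>x. x) (\<lambda>y. r y a) w) \<le> 1 * (K * nrm B a) * nrm EF w"
      by (rule nrm_tensor_map_le[OF nEF nEF _ _ _ bilinear_map_left[OF r(3)]])
        (use that K in \<open>auto simp: linear_map_def mult_ac\<close>)
    then show ?thesis by (simp add: tensor_right_action_eq mult_ac)
  qed
  have assoc: "?r w (a \<otimes>\<^bsub>B\<^esub> b) = ?r (?r w a) b"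
    if ab: "a \<in> carrier B" "b \<in> carrier B" and w: "w \<in> carrier EF" for a b w
    by (rule EF.ptensor_eqI[OF EF.normed_completion br
          bounded_linear_map_compose[OF EF.normed_completion EF.normed_completion br br] _ w])
      (use ab in \<open>simp_all add: pure r(4) mem B.mult_closed\<close>)
  have "bounded_bilinear_map EF B EF ?r"
    unfolding bounded_bilinear_map_def
    by (intro conjI exI[of _ K] ballI bound bilinear_mapI linB bounded_linear_map_linear br)
  then show ?thesis
    by (simp add: right_banach_module_def EF.banach_ptensor assoc)
qed

lemma banach_bimodule_ptensor:
  assumes L: "left_banach_module B E l" and R: "right_banach_module B F r"
  shows "banach_bimodule B EF (tensor_left_action E F l) (tensor_right_action E F r)"
  unfolding banach_bimodule_def
proof (intro conjI ballI left_banach_module_ptensor right_banach_module_ptensor L R)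
  fix a b w assume ab: "a \<in> carrier B" "b \<in> carrier B" and w: "w \<in> carrier EF"
  note bl = bounded_linear_left_action[OF L ab(1)] and br = bounded_linear_right_action[OF R ab(2)]
  note comp = bounded_linear_map_compose[OF EF.normed_completion EF.normed_completion]
  show "tensor_right_action E F r (tensor_left_action E F l a w) b =
      tensor_left_action E F l a (tensor_right_action E F r w b)"
    by (rule EF.ptensor_eqI[OF EF.normed_completion comp[OF bl br] comp[OF br bl] _ w])
      (use ab in \<open>simp add: left_action_pure[OF L] right_action_pure[OF R]
        bilinear_map_closed[OF left_banach_moduleD(3)[OF L]]
        bilinear_map_closed[OF right_banach_moduleD(3)[OF R]]\<close>)
qed

end


section \<open>Adjoining an identity\<close>

context banach_algebra
begin

abbreviation "Ap \<equiv> unitization A"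

lemma unitization_simps [simp]:
  "carrier Ap = UNIV \<times> carrier A"
  "zero Ap = (0, \<zero>)"
  "(c, a) \<oplus>\<^bsub>Ap\<^esub> (d, b) = (c + d, a \<oplus> b)"
  "k \<odot>\<^bsub>Ap\<^esub> (c, a) = (k * c, k \<odot> a)"
  "nrm Ap (c, a) = cmod c + nrm A a"
  by (simp_all add: unitization_def)

lemma normed_unitization: "normed_space Ap"
proof (rule normed_spaceI)
  fix u v :: "complex \<times> 'a" and c
  assume u: "u \<in> carrier Ap"
  show "nrm Ap (c \<odot>\<^bsub>Ap\<^esub> u) = cmod c * nrm Ap u"
    using u by (cases u) (simp add: nrm_smult norm_mult distrib_left)
  show "u = \<zero>\<^bsub>Ap\<^esub>" if "nrm Ap u = 0"
    using u that nrm_nonneg[of "snd u"] by (cases u) (auto simp: nrm_eq_0_iff add_nonneg_eq_0_iff)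
  assume v: "v \<in> carrier Ap"
  show "nrm Ap (u \<oplus>\<^bsub>Ap\<^esub> v) \<le> nrm Ap u + nrm Ap v"
    using u v nrm_triangle[of "snd u" "snd v"] norm_triangle_ineq[of "fst u" "fst v"]
    by (cases u; cases v) (auto intro: order_trans)
qed (auto simp: a_ac algebra_simps scale_left_distrib scale_right_distrib scale_scale)

lemma unitization_diff:
  assumes "a \<in> carrier A" "b \<in> carrier A"
  shows "(c, a) \<ominus>\<^bsub>Ap\<^esub> (d, b) = (c - d, a \<ominus> b)"
  using assms normed_space.diff_eq[OF normed_unitization, of "(c, a)" "(d, b)"]
  by (simp add: diff_eq)

lemma banach_unitization: "banach_space Ap"
proof (rule banach_spaceI[OF normed_unitization])
  fix s :: "nat \<Rightarrow> complex \<times> 'a"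
  assume "range s \<subseteq> carrier Ap"
    and Cauchy: "\<forall>\<epsilon>>0. \<exists>N. \<forall>m\<ge>N. \<forall>n\<ge>N. nrm Ap (s m \<ominus>\<^bsub>Ap\<^esub> s n) < \<epsilon>"
  then have s: "snd (s n) \<in> carrier A" for n
    using rangeI[of s n] by (cases "s n") auto
  have nrm: "nrm Ap (s m \<ominus>\<^bsub>Ap\<^esub> (c, a)) = cmod (fst (s m) - c) + nrm A (snd (s m) \<ominus> a)"
    if "a \<in> carrier A" for m c a
    using s[of m] that by (cases "s m") (simp add: unitization_diff)
  have C: "\<exists>N. \<forall>m\<ge>N. \<forall>n\<ge>N. cmod (fst (s m) - fst (s n)) + nrm A (snd (s m) \<ominus> snd (s n)) < \<epsilon>"
    if "\<epsilon> > 0" for \<epsilon>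
  proof -
    have "nrm Ap (s m \<ominus>\<^bsub>Ap\<^esub> s n) = cmod (fst (s m) - fst (s n)) + nrm A (snd (s m) \<ominus> snd (s n))" for m n
      using nrm[OF s[of n], of m "fst (s n)"] by simp
    then show ?thesis using Cauchy[rule_format, OF that] by simp
  qed
  have "\<exists>N. \<forall>m\<ge>N. \<forall>n\<ge>N. nrm A (snd (s m) \<ominus> snd (s n)) < \<epsilon>" if "\<epsilon> > 0" for \<epsilon>
    using C[OF that] norm_ge_zero by (smt (verit, best))
  then obtain a where a: "a \<in> carrier A" "converges (\<lambda>n. snd (s n)) a"
    using Cauchy_converges[of "\<lambda>n. snd (s n)"] s by (smt (verit, best) image_subset_iff)
  have "Cauchy (\<lambda>n. fst (s n))"
  proof (rule CauchyI)
    fix \<epsilon> :: real assume "\<epsilon> > 0"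
    from C[OF this] obtain N where N: "\<And>m n. m \<ge> N \<Longrightarrow> n \<ge> N \<Longrightarrow>
        cmod (fst (s m) - fst (s n)) + nrm A (snd (s m) \<ominus> snd (s n)) < \<epsilon>" by blast
    have "norm (fst (s m) - fst (s n)) < \<epsilon>" if "m \<ge> N" "n \<ge> N" for m n
      using N[OF that] nrm_nonneg[OF minus_closed[OF s s], of m n] by linarith
    then show "\<exists>M. \<forall>m\<ge>M. \<forall>n\<ge>M. norm (fst (s m) - fst (s n)) < \<epsilon>" by blast
  qed
  then obtain c where "(\<lambda>n. fst (s n)) \<longlonglongrightarrow> c"
    by (meson Cauchy_convergent convergentD)
  then have "(\<lambda>n. cmod (fst (s n) - c)) \<longlonglongrightarrow> 0"
    by (simp add: LIM_zero tendsto_norm_zero)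
  from tendsto_add[OF this a(2)[unfolded converges_def]]
  have "(\<lambda>n. nrm Ap (s n \<ominus>\<^bsub>Ap\<^esub> (c, a))) \<longlonglongrightarrow> 0"
    by (simp add: nrm[OF a(1)])
  then show "\<exists>x\<in>carrier Ap. (\<lambda>n. nrm Ap (s n \<ominus>\<^bsub>Ap\<^esub> x)) \<longlonglongrightarrow> 0"
    using a(1) by (intro bexI[of _ "(c, a)"]) auto
qed

lemma plus_left_eq:
  "\<lbrakk>a \<in> carrier A; b \<in> carrier A\<rbrakk> \<Longrightarrow> plus_left A a (c, b) = (0, c \<odot> a \<oplus> a \<otimes> b)"
  by (simp add: plus_left_def unitization_def)

lemma plus_right_eq:
  "\<lbrakk>a \<in> carrier A; b \<in> carrier A\<rbrakk> \<Longrightarrow> plus_right A (c, b) a = (0, c \<odot> a \<oplus> b \<otimes> a)"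
  by (simp add: plus_right_def unitization_def)

lemma bilinear_act_left: "bilinear_map Ap A A (\<lambda>(c, a) b. c \<odot> b \<oplus> a \<otimes> b)"
  by (intro bilinear_mapI linear_mapI)
    (auto simp: mult_closed scale_left_distrib scale_right_distrib scale_scale mult_add_left
      mult_add_right mult_scale_left mult_scale_right a_ac mult.commute)

lemma bilinear_act_right: "bilinear_map A Ap A (\<lambda>b (c, a). c \<odot> b \<oplus> b \<otimes> a)"
  by (intro bilinear_mapI linear_mapI)
    (auto simp: mult_closed scale_left_distrib scale_right_distrib scale_scale mult_add_left
      mult_add_right mult_scale_left mult_scale_right a_ac mult.commute)

lemma nrm_act_le:
  assumes "a \<in> carrier A" "b \<in> carrier A"
  shows "nrm A (c \<odot> b \<oplus> a \<otimes> b) \<le> (cmod c + nrm A a) * nrm A b"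
    and "nrm A (c \<odot> b \<oplus> b \<otimes> a) \<le> nrm A b * (cmod c + nrm A a)"
  using nrm_triangle[of "c \<odot> b" "a \<otimes> b"] nrm_triangle[of "c \<odot> b" "b \<otimes> a"]
    nrm_mult_le[of a b] nrm_mult_le[of b a] assms
  by (auto simp: mult_closed nrm_smult algebra_simps)

lemma left_module_unitization: "left_banach_module A Ap (plus_left A)"
proof -
  have "bilinear_map A Ap Ap (plus_left A)"
    by (intro bilinear_mapI linear_mapI)
      (auto simp: plus_left_eq mult_closed scale_left_distrib scale_right_distrib scale_scale mult_add_left
        mult_add_right mult_scale_left mult_scale_right a_ac mult.commute)
  moreover have "nrm Ap (plus_left A a u) \<le> 1 * nrm A a * nrm Ap u"
    if "a \<in> carrier A" "u \<in> carrier Ap" for a u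
    using that nrm_act_le(2)[of "snd u" a "fst u"] by (cases u) (simp add: plus_left_eq)
  ultimately have "bounded_bilinear_map A Ap Ap (plus_left A)"
    unfolding bounded_bilinear_map_def by blast
  moreover have "plus_left A (a \<otimes> b) u = plus_left A a (plus_left A b u)"
    if "a \<in> carrier A" "b \<in> carrier A" "u \<in> carrier Ap" for a b u
    using that by (cases u) (simp add: plus_left_eq mult_closed mult_add_right mult_scale_right mult_assoc)
  ultimately show ?thesis
    by (simp add: left_banach_module_def banach_unitization)
qed

lemma right_module_unitization: "right_banach_module A Ap (plus_right A)"
proof -
  have "bilinear_map Ap A Ap (plus_right A)"
    by (intro bilinear_mapI linear_mapI)
      (auto simp: plus_right_eq mult_closed scale_left_distrib scale_right_distrib scale_scale mult_add_left
        mult_add_right mult_scale_left mult_scale_right a_ac mult.commute)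
  moreover have "nrm Ap (plus_right A u a) \<le> 1 * nrm Ap u * nrm A a"
    if "u \<in> carrier Ap" "a \<in> carrier A" for a u
    using that nrm_act_le(1)[of "snd u" a "fst u"] by (cases u) (simp add: plus_right_eq)
  ultimately have "bounded_bilinear_map Ap A Ap (plus_right A)"
    unfolding bounded_bilinear_map_def by blast
  moreover have "plus_right A u (a \<otimes> b) = plus_right A (plus_right A u a) b"
    if "a \<in> carrier A" "b \<in> carrier A" "u \<in> carrier Ap" for a b u
    using that by (cases u) (simp add: plus_right_eq mult_closed mult_add_left mult_scale_left mult_assoc)
  ultimately show ?thesis
    by (simp add: right_banach_module_def banach_unitization)
qed

end


section \<open>Bounded linear functionals\<close>

context normed_space
begin

definition sublinear :: "('v \<Rightarrow> real) \<Rightarrow> bool" where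
  "sublinear p \<longleftrightarrow> (\<forall>x\<in>carrier V. \<forall>y\<in>carrier V. p (x \<oplus> y) \<le> p x + p y) \<and>
     (\<forall>x\<in>carrier V. \<forall>t\<ge>0. p (complex_of_real t \<odot> x) \<le> t * p x)"

lemma sublinear_add: "\<lbrakk>sublinear p; x \<in> carrier V; y \<in> carrier V\<rbrakk> \<Longrightarrow> p (x \<oplus> y) \<le> p x + p y"
  by (simp add: sublinear_def)

lemma sublinear_scale_le:
  "\<lbrakk>sublinear p; x \<in> carrier V; t \<ge> 0\<rbrakk> \<Longrightarrow> p (complex_of_real t \<odot> x) \<le> t * p x"
  by (simp add: sublinear_def)

lemma sublinear_zero:
  assumes "sublinear p"
  shows "p \<zero> = 0"
  using sublinear_add[OF assms, of "\<zero>" "\<zero>"] sublinear_scale_le[OF assms, of "\<zero>" 0] by simp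

lemma sublinear_scale:
  assumes p: "sublinear p" and x: "x \<in> carrier V" and t: "t \<ge> 0"
  shows "p (complex_of_real t \<odot> x) = t * p x"
proof (cases "t = 0")
  case True
  then show ?thesis using sublinear_zero[OF p] x by simp
next
  case False
  then have "p (complex_of_real (inverse t) \<odot> (complex_of_real t \<odot> x)) \<le>
      inverse t * p (complex_of_real t \<odot> x)"
    using t x by (intro sublinear_scale_le p) auto
  then have "p x \<le> inverse t * p (complex_of_real t \<odot> x)"
    using False x by (simp add: scale_scale flip: of_real_mult)
  then have "t * p x \<le> p (complex_of_real t \<odot> x)"
    using False t by (simp add: field_simps)
  then show ?thesis using sublinear_scale_le[OF p x t] by simp
qed

lemma sublinear_neg:
  assumes "sublinear p" "x \<in> carrier V"
  shows "- p (\<ominus> x) \<le> p x"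
  using sublinear_add[OF assms, of "\<ominus> x"] sublinear_zero[OF assms(1)] assms(2) by (simp add: r_neg)

text \<open>Lowering a sublinear functional along a ray: the result is at most \<open>p (x + y) - p y\<close>, so a
  minimal sublinear functional is superadditive, hence real linear.\<close>

definition lower :: "('v \<Rightarrow> real) \<Rightarrow> 'v \<Rightarrow> 'v \<Rightarrow> real" where
  "lower p y x = (INF t\<in>{0..}. p (x \<oplus> complex_of_real t \<odot> y) - t * p y)"

context
  fixes p y assumes p: "sublinear p" and y: "y \<in> carrier V"
begin

lemma bdd_below_lower:
  assumes x: "x \<in> carrier V"
  shows "bdd_below ((\<lambda>t. p (x \<oplus> complex_of_real t \<odot> y) - t * p y) ` {0..})"
proof (rule bdd_belowI2)
  fix t :: real assume "t \<in> {0..}"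
  then have t: "t \<ge> 0" by simp
  have "t * p y = p ((x \<oplus> complex_of_real t \<odot> y) \<oplus> \<ominus> x)"
    using x y t by (simp add: sublinear_scale[OF p] a_ac r_neg1 r_neg2)
  also have "\<dots> \<le> p (x \<oplus> complex_of_real t \<odot> y) + p (\<ominus> x)"
    using x y by (intro sublinear_add p) auto
  finally show "- p (\<ominus> x) \<le> p (x \<oplus> complex_of_real t \<odot> y) - t * p y" by simp
qed

lemma lower_le:
  "\<lbrakk>x \<in> carrier V; t \<ge> 0\<rbrakk> \<Longrightarrow> lower p y x \<le> p (x \<oplus> complex_of_real t \<odot> y) - t * p y"
  unfolding lower_def by (rule cINF_lower[OF bdd_below_lower]) auto

lemma lower_greatest:
  "(\<And>t. t \<ge> 0 \<Longrightarrow> b \<le> p (x \<oplus> complex_of_real t \<odot> y) - t * p y) \<Longrightarrow> b \<le> lower p y x"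
  unfolding lower_def by (rule cINF_greatest) auto

lemma lower_le_self: "x \<in> carrier V \<Longrightarrow> lower p y x \<le> p x"
  using lower_le[of x 0] y by simp

lemma lower_le_diff: "x \<in> carrier V \<Longrightarrow> lower p y x \<le> p (x \<oplus> y) - p y"
  using lower_le[of x 1] y by simp

lemma sublinear_lower: "sublinear (lower p y)"
  unfolding sublinear_def
proof (intro conjI ballI allI impI)
  fix x z assume x: "x \<in> carrier V" and z: "z \<in> carrier V"
  have *: "lower p y (x \<oplus> z) \<le> (p (x \<oplus> complex_of_real s \<odot> y) - s * p y) +
      (p (z \<oplus> complex_of_real t \<odot> y) - t * p y)" if "s \<ge> 0" "t \<ge> 0" for s t
  proof -
    have "lower p y (x \<oplus> z) \<le> p ((x \<oplus> z) \<oplus> complex_of_real (s + t) \<odot> y) - (s + t) * p y"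
      using x z that by (intro lower_le) auto
    also have "(x \<oplus> z) \<oplus> complex_of_real (s + t) \<odot> y =
        (x \<oplus> complex_of_real s \<odot> y) \<oplus> (z \<oplus> complex_of_real t \<odot> y)"
      using x y z by (simp add: scale_left_distrib a_ac)
    also have "p \<dots> \<le> p (x \<oplus> complex_of_real s \<odot> y) + p (z \<oplus> complex_of_real t \<odot> y)"
      using x y z by (intro sublinear_add p) auto
    finally show ?thesis by (simp add: algebra_simps)
  qed
  have "lower p y (x \<oplus> z) - (p (z \<oplus> complex_of_real t \<odot> y) - t * p y) \<le> lower p y x"
    if "t \<ge> 0" for t
    by (rule lower_greatest) (use *[OF _ that] in \<open>simp add: algebra_simps\<close>)
  then have "lower p y (x \<oplus> z) - lower p y x \<le> lower p y z"
    by (intro lower_greatest) (simp add: algebra_simps)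
  then show "lower p y (x \<oplus> z) \<le> lower p y x + lower p y z" by simp
next
  fix x t assume x: "x \<in> carrier V" and t: "(t :: real) \<ge> 0"
  show "lower p y (complex_of_real t \<odot> x) \<le> t * lower p y x"
  proof (cases "t = 0")
    case True
    then show ?thesis using lower_le_self[of "\<zero>"] sublinear_zero[OF p] x by simp
  next
    case False
    have "inverse t * lower p y (complex_of_real t \<odot> x) \<le> lower p y x"
    proof (rule lower_greatest)
      fix s :: real assume s: "s \<ge> 0"
      have "lower p y (complex_of_real t \<odot> x) \<le>
          p (complex_of_real t \<odot> x \<oplus> complex_of_real (t * s) \<odot> y) - (t * s) * p y"
        using x s t by (intro lower_le) auto
      also have "complex_of_real t \<odot> x \<oplus> complex_of_real (t * s) \<odot> y =
          complex_of_real t \<odot> (x \<oplus> complex_of_real s \<odot> y)"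
        using x y by (simp add: scale_right_distrib scale_scale)
      also have "p \<dots> = t * p (x \<oplus> complex_of_real s \<odot> y)"
        using x y t by (intro sublinear_scale p) auto
      finally show "inverse t * lower p y (complex_of_real t \<odot> x) \<le> p (x \<oplus> complex_of_real s \<odot> y) - s * p y"
        using False t by (simp add: field_simps)
    qed
    then show ?thesis using False t by (simp add: field_simps)
  qed
qed

end

text \<open>Zorn's lemma applies because the pointwise infimum of a chain is sublinear: of two members
  of the chain, one lies below the other everywhere, so the sum of their values at \<open>x\<close> and \<open>y\<close> is
  bounded below by a value at \<open>x \<oplus> y\<close>.\<close>

lemma ex_minimal_sublinear:
  assumes p0: "sublinear p0"
  shows "\<exists>m. sublinear m \<and> (\<forall>x\<in>carrier V. m x \<le> p0 x) \<and>
    (\<forall>q. sublinear q \<and> (\<forall>x\<in>carrier V. q x \<le> m x) \<longrightarrow> (\<forall>x\<in>carrier V. q x = m x))"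
proof -
  define Q where "Q = {p \<in> extensional (carrier V). sublinear p \<and> (\<forall>x\<in>carrier V. p x \<le> p0 x)}"
  define R where "R p q \<longleftrightarrow> (\<forall>x\<in>carrier V. q x \<le> p x)" for p q :: "'v \<Rightarrow> real"
  have sub_restrict: "sublinear (restrict p (carrier V))" if "sublinear p" for p
    using that by (simp add: sublinear_def)
  have po: "partial_order_on Q (relation_of R Q)"
    unfolding partial_order_on_def preorder_on_def
  proof (intro conjI)
    show "antisym (relation_of R Q)"
    proof (rule antisymI)
      fix p q assume "(p, q) \<in> relation_of R Q" "(q, p) \<in> relation_of R Q"
      then have pq: "p \<in> extensional (carrier V)" "q \<in> extensional (carrier V)" "R p q" "R q p"
        by (auto simp: relation_of_def Q_def)
      show "p = q"
        by (rule extensionalityI[OF pq(1,2)]) (use pq(3,4) in \<open>force simp: R_def\<close>)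
    qed
    show "trans (relation_of R Q)"
      by (rule transI) (auto simp: relation_of_def R_def intro: order_trans)
  qed (auto simp: refl_on_def relation_of_def R_def)
  have ch: "\<exists>u\<in>Q. \<forall>a\<in>C. R a u" if C: "C \<in> Chains (relation_of R Q)" for C
  proof (cases "C = {}")
    case True
    then show ?thesis
      using sub_restrict[OF p0] by (intro bexI[of _ "restrict p0 (carrier V)"]) (auto simp: Q_def)
  next
    case False
    have CQ: "p \<in> Q" if "p \<in> C" for p
      using C that by (auto simp: Chains_def relation_of_def)
    have tot: "R p q \<or> R q p" if "p \<in> C" "q \<in> C" for p q
      using C that by (auto simp: Chains_def relation_of_def)
    define u where "u x = (INF p\<in>C. p x)" for x
    have bdd: "bdd_below ((\<lambda>p. p x) ` C)" if x: "x \<in> carrier V" for x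
    proof (rule bdd_belowI2)
      fix p assume "p \<in> C"
      then have "sublinear p" "p (\<ominus> x) \<le> p0 (\<ominus> x)" using CQ[of p] x by (auto simp: Q_def)
      then show "- p0 (\<ominus> x) \<le> p x" using sublinear_neg[of p x] x by simp
    qed
    have u_le: "u x \<le> p x" if "p \<in> C" "x \<in> carrier V" for p x
      unfolding u_def by (rule cINF_lower[OF bdd]) (use that in auto)
    have u_ge: "b \<le> u x" if "\<And>p. p \<in> C \<Longrightarrow> b \<le> p x" for b x
      unfolding u_def by (rule cINF_greatest[OF False]) (use that in auto)
    have "sublinear u"
      unfolding sublinear_def
    proof (intro conjI ballI allI impI)
      fix x y assume xy: "x \<in> carrier V" "y \<in> carrier V"
      have *: "u (x \<oplus> y) \<le> p x + q y" if pq: "p \<in> C" "q \<in> C" for p q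
      proof -
        obtain r where r: "r \<in> C" "r x \<le> p x" "r y \<le> q y"
          using tot[OF pq] pq xy by (auto simp: R_def)
        have "u (x \<oplus> y) \<le> r (x \<oplus> y)" using r xy by (intro u_le) auto
        also have "\<dots> \<le> r x + r y" using CQ[OF r(1)] xy by (auto simp: Q_def intro: sublinear_add)
        finally show ?thesis using r by simp
      qed
      have "u (x \<oplus> y) - q y \<le> u x" if "q \<in> C" for q
        by (rule u_ge) (use *[OF _ that] in \<open>simp add: algebra_simps\<close>)
      then have "u (x \<oplus> y) - u x \<le> u y" by (intro u_ge) (simp add: algebra_simps)
      then show "u (x \<oplus> y) \<le> u x + u y" by simp
    next
      fix x t assume x: "x \<in> carrier V" and t: "(t :: real) \<ge> 0"
      show "u (complex_of_real t \<odot> x) \<le> t * u x"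
      proof (cases "t = 0")
        case True
        obtain q where q: "q \<in> C" using False by blast
        then have "u \<zero> \<le> 0" using u_le[OF q, of "\<zero>"] CQ[OF q] sublinear_zero[of q] by (simp add: Q_def)
        then show ?thesis using True x by simp
      next
        case False
        have "inverse t * u (complex_of_real t \<odot> x) \<le> u x"
        proof (rule u_ge)
          fix q assume q: "q \<in> C"
          have "u (complex_of_real t \<odot> x) \<le> t * q x"
            using u_le[OF q, of "complex_of_real t \<odot> x"] CQ[OF q] x t
              sublinear_scale_le[of q x t] by (simp add: Q_def)
          then show "inverse t * u (complex_of_real t \<odot> x) \<le> q x"
            using False t by (simp add: field_simps)
        qed
        then show ?thesis using False t by (simp add: field_simps)
      qed
    qed
    moreover have "u x \<le> p0 x" if x: "x \<in> carrier V" for x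
    proof -
      obtain q where q: "q \<in> C" using False by blast
      show ?thesis using u_le[OF q x] CQ[OF q] x by (auto simp: Q_def intro: order_trans)
    qed
    ultimately have "restrict u (carrier V) \<in> Q" using sub_restrict by (simp add: Q_def)
    then show ?thesis using u_le by (intro bexI[of _ "restrict u (carrier V)"]) (auto simp: R_def)
  qed
  obtain m where m: "m \<in> Q" "\<forall>q\<in>Q. R m q \<longrightarrow> q = m"
    using predicate_Zorn[OF po ch] by blast
  have "q x = m x" if q: "sublinear q" "\<forall>x\<in>carrier V. q x \<le> m x" and x: "x \<in> carrier V" for q x
  proof -
    have "q y \<le> p0 y" if y: "y \<in> carrier V" for y
      using q(2) m(1) y order_trans[of "q y" "m y" "p0 y"] by (simp add: Q_def)
    then have "restrict q (carrier V) \<in> Q"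
      using sub_restrict[OF q(1)] by (simp add: Q_def)
    then have "restrict q (carrier V) = m" using m(2) q(2) by (simp add: R_def)
    then have "restrict q (carrier V) x = m x" by simp
    then show ?thesis using x by simp
  qed
  then show ?thesis using m(1) by (intro exI[of _ m]) (simp add: Q_def)
qed

text \<open>The Hahn-Banach theorem, in the form needed here. Lowering the norm along the ray of \<open>c\<close>
  forces a minimal sublinear functional below it to be at most \<open>- nrm V c\<close> at \<open>\<ominus> c\<close>. Such a functional
  is real linear; its complexification is \<open>x \<mapsto> m x - \<i> m (\<i> x)\<close>.\<close>

theorem ex_functional_nonzero:
  assumes c: "c \<in> carrier V" "c \<noteq> \<zero>"
  shows "\<exists>(f :: 'v \<Rightarrow> complex) K. f c \<noteq> 0 \<and>
    (\<forall>x\<in>carrier V. \<forall>y\<in>carrier V. f (x \<oplus> y) = f x + f y) \<and>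
    (\<forall>z. \<forall>x\<in>carrier V. f (z \<odot> x) = z * f x) \<and> (\<forall>x\<in>carrier V. cmod (f x) \<le> K * nrm V x)"
proof -
  have N: "sublinear (nrm V)"
    by (simp add: sublinear_def nrm_triangle nrm_smult)
  obtain m where m1: "sublinear m" and m2: "\<forall>x\<in>carrier V. m x \<le> lower (nrm V) c x"
    and m3: "\<forall>q. sublinear q \<and> (\<forall>x\<in>carrier V. q x \<le> m x) \<longrightarrow> (\<forall>x\<in>carrier V. q x = m x)"
    using ex_minimal_sublinear[OF sublinear_lower[OF N c(1)]] by blast
  note m = m1 bspec[OF m2]
  have min: "q x = m x" if "sublinear q" "\<And>x. x \<in> carrier V \<Longrightarrow> q x \<le> m x" "x \<in> carrier V" for q x
    using m3[rule_format, OF conjI[OF that(1) ballI[OF that(2)]] that(3)] .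
  have add: "m (x \<oplus> y) = m x + m y" if xy: "x \<in> carrier V" "y \<in> carrier V" for x y
  proof -
    have "lower m y x = m x"
      by (rule min[OF sublinear_lower[OF m(1) xy(2)] lower_le_self[OF m(1) xy(2)] xy(1)])
    then show ?thesis
      using lower_le_diff[OF m(1) xy(2,1)] sublinear_add[OF m(1) xy] by simp
  qed
  have neg: "m (\<ominus> x) = - m x" if "x \<in> carrier V" for x
    using add[of x "\<ominus> x"] that sublinear_zero[OF m(1)] by (simp add: r_neg)
  have scale: "m (complex_of_real t \<odot> x) = t * m x" if x: "x \<in> carrier V" for t x
  proof (cases "t \<ge> 0")
    case True
    then show ?thesis using sublinear_scale[OF m(1) x] by simp
  next
    case False
    then have "m (complex_of_real (- t) \<odot> x) = - t * m x"
      using x by (intro sublinear_scale m) auto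
    moreover have "complex_of_real (- t) \<odot> x = \<ominus> (complex_of_real t \<odot> x)"
      using x by (simp add: neg_eq scale_scale)
    ultimately show ?thesis using x neg[of "complex_of_real t \<odot> x"] by simp
  qed
  have le: "\<bar>m x\<bar> \<le> nrm V x" if x: "x \<in> carrier V" for x
    using order_trans[OF m(2) lower_le_self[OF N c(1)], of x]
      order_trans[OF m(2) lower_le_self[OF N c(1)], of "\<ominus> x"] x neg[OF x] by simp
  have "m (\<ominus> c) \<le> - nrm V c"
    using order_trans[OF m(2) lower_le_diff[OF N c(1)], of "\<ominus> c"] c by (simp add: l_neg)
  then have mc: "m c > 0"
    using neg[OF c(1)] c nrm_eq_0_iff[OF c(1)] nrm_nonneg[OF c(1)] by linarith
  define f where "f x = Complex (m x) (- m (\<i> \<odot> x))" for x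
  have split: "z \<odot> x = complex_of_real (Re z) \<odot> x \<oplus> complex_of_real (Im z) \<odot> (\<i> \<odot> x)"
    if "x \<in> carrier V" for z x
  proof -
    have "complex_of_real (Re z) + complex_of_real (Im z) * \<i> = z"
      by (simp add: complex_eq_iff)
    then show ?thesis using that by (simp add: scale_scale scale_left_distrib[symmetric])
  qed
  have mz: "m (z \<odot> x) = Re z * m x + Im z * m (\<i> \<odot> x)" if "x \<in> carrier V" for z x
    using that by (subst split) (simp_all add: add scale)
  show ?thesis
  proof (intro exI[of _ f] exI[of _ 2] conjI ballI allI)
    show "f c \<noteq> 0" using mc by (auto simp: f_def complex_eq_iff)
    show "f (x \<oplus> y) = f x + f y" if "x \<in> carrier V" "y \<in> carrier V" for x y
      using that by (simp add: f_def add scale_right_distrib complex_eq_iff)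
    show "f (z \<odot> x) = z * f x" if x: "x \<in> carrier V" for z x
      using x mz[OF x, of z] mz[OF x, of "\<i> * z"]
      by (simp add: f_def complex_eq_iff scale_scale algebra_simps)
    show "cmod (f x) \<le> 2 * nrm V x" if x: "x \<in> carrier V" for x
      using cmod_le[of "f x"] le[OF x] le[of "\<i> \<odot> x"] x by (simp add: f_def nrm_smult)
  qed
qed

end


section \<open>The canonical epimorphisms and their splittings\<close>

context banach_algebra
begin

lemma zero_mult: "x \<in> carrier A \<Longrightarrow> \<zero> \<otimes> x = \<zero>"
  and mult_zero: "x \<in> carrier A \<Longrightarrow> x \<otimes> \<zero> = \<zero>"
  using mult_scale_left[of x "\<zero>" 0] mult_scale_right[of x "\<zero>" 0] mult_closed by simp_all

lemma bounded_mult_left: "x \<in> carrier A \<Longrightarrow> bounded_linear_map A A (\<lambda>y. x \<otimes> y)"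
  by (rule bounded_bilinear_map_right[OF bounded_bilinear_mult])

lemma bounded_mult_right: "x \<in> carrier A \<Longrightarrow> bounded_linear_map A A (\<lambda>y. y \<otimes> x)"
  by (rule bounded_bilinear_map_left[OF bounded_bilinear_mult])

interpretation Ap: banach_space Ap by (rule banach_unitization)

interpretation ApA: tensor_module A Ap A by unfold_locales
interpretation AAp: tensor_module A A Ap by unfold_locales
interpretation AA: tensor_module A A A by unfold_locales

lemma left_product:
  shows bounded_left_product: "bounded_linear_map (Ap \<otimes>\<^sub>\<pi> A) A (left_product A)"
    and left_product_pure: "\<And>c a b. \<lbrakk>a \<in> carrier A; b \<in> carrier A\<rbrakk> \<Longrightarrow>
      left_product A (pure_tensor Ap A (c, a) b) = c \<odot> b \<oplus> a \<otimes> b"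
proof -
  have "\<forall>u\<in>carrier Ap. \<forall>b\<in>carrier A.
      nrm A ((case u of (c, a) \<Rightarrow> \<lambda>b. c \<odot> b \<oplus> a \<otimes> b) b) \<le> 1 * nrm Ap u * nrm A b"
    by (auto simp: nrm_act_le)
  note lift = ApA.EF.ptensor_lift[OF banach_space_axioms bilinear_act_left zero_le_one this,
      folded left_product_def]
  show "bounded_linear_map (Ap \<otimes>\<^sub>\<pi> A) A (left_product A)" by (rule lift(1))
  show "left_product A (pure_tensor Ap A (c, a) b) = c \<odot> b \<oplus> a \<otimes> b"
    if "a \<in> carrier A" "b \<in> carrier A" for c a b
    using lift(2)[of "(c, a)" b] that by simp
qed

lemma right_product:
  shows bounded_right_product: "bounded_linear_map (A \<otimes>\<^sub>\<pi> Ap) A (right_product A)"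
    and right_product_pure: "\<And>c a b. \<lbrakk>a \<in> carrier A; b \<in> carrier A\<rbrakk> \<Longrightarrow>
      right_product A (pure_tensor A Ap b (c, a)) = c \<odot> b \<oplus> b \<otimes> a"
proof -
  have "\<forall>b\<in>carrier A. \<forall>u\<in>carrier Ap.
      nrm A (case u of (c, a) \<Rightarrow> c \<odot> b \<oplus> b \<otimes> a) \<le> 1 * nrm A b * nrm Ap u"
    by (auto simp: nrm_act_le)
  note lift = AAp.EF.ptensor_lift[OF banach_space_axioms bilinear_act_right zero_le_one this,
      folded right_product_def]
  show "bounded_linear_map (A \<otimes>\<^sub>\<pi> Ap) A (right_product A)" by (rule lift(1))
  show "right_product A (pure_tensor A Ap b (c, a)) = c \<odot> b \<oplus> b \<otimes> a"
    if "a \<in> carrier A" "b \<in> carrier A" for c a b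
    using lift(2)[of b "(c, a)"] that by simp
qed

lemma bi_product:
  shows bounded_bi_product: "bounded_linear_map (A \<otimes>\<^sub>\<pi> A) A (bi_product A)"
    and bi_product_pure: "\<And>a b. \<lbrakk>a \<in> carrier A; b \<in> carrier A\<rbrakk> \<Longrightarrow>
      bi_product A (pure_tensor A A a b) = a \<otimes> b"
proof -
  have "\<forall>a\<in>carrier A. \<forall>b\<in>carrier A. nrm A (a \<otimes> b) \<le> 1 * nrm A a * nrm A b"
    by (simp add: nrm_mult_le)
  note lift = AA.EF.ptensor_lift[OF banach_space_axioms mult_bilinear zero_le_one this,
      folded bi_product_def]
  show "bounded_linear_map (A \<otimes>\<^sub>\<pi> A) A (bi_product A)" by (rule lift(1))
  show "bi_product A (pure_tensor A A a b) = a \<otimes> b" if "a \<in> carrier A" "b \<in> carrier A" for a b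
    by (rule lift(2)[OF that])
qed

lemma left_product_left:
  assumes a: "a \<in> carrier A" and w: "w \<in> carrier (Ap \<otimes>\<^sub>\<pi> A)"
  shows "left_product A (tensor_left_action Ap A (plus_left A) a w) = a \<otimes> left_product A w"
proof (rule ApA.EF.ptensor_eqI[OF normed_space_axioms _ _ _ w])
  note act = ApA.left_action[OF left_module_unitization a]
  show "bounded_linear_map (Ap \<otimes>\<^sub>\<pi> A) A (\<lambda>w. left_product A (tensor_left_action Ap A (plus_left A) a w))"
    by (rule bounded_linear_map_compose[OF ApA.EF.normed_completion ApA.EF.normed_completion
          act(1) bounded_left_product])
  show "bounded_linear_map (Ap \<otimes>\<^sub>\<pi> A) A (\<lambda>w. a \<otimes> left_product A w)"
    by (rule bounded_linear_map_compose[OF ApA.EF.normed_completion normed_space_axioms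
          bounded_left_product bounded_mult_left[OF a]])
  show "left_product A (tensor_left_action Ap A (plus_left A) a (pure_tensor Ap A u b)) =
      a \<otimes> left_product A (pure_tensor Ap A u b)" if "u \<in> carrier Ap" "b \<in> carrier A" for u b
    using that a act(2)[OF that]
    by (cases u) (simp add: plus_left_eq left_product_pure mult_closed mult_add_left mult_add_right
        mult_scale_left mult_scale_right mult_assoc)
qed

lemma left_product_right:
  assumes a: "a \<in> carrier A" and w: "w \<in> carrier (Ap \<otimes>\<^sub>\<pi> A)"
  shows "left_product A (tensor_right_action Ap A (mult A) w a) = left_product A w \<otimes> a"
proof (rule ApA.EF.ptensor_eqI[OF normed_space_axioms _ _ _ w])
  note act = ApA.right_action[OF right_banach_module_self a]
  show "bounded_linear_map (Ap \<otimes>\<^sub>\<pi> A) A (\<lambda>w. left_product A (tensor_right_action Ap A (mult A) w a))"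
    by (rule bounded_linear_map_compose[OF ApA.EF.normed_completion ApA.EF.normed_completion
          act(1) bounded_left_product])
  show "bounded_linear_map (Ap \<otimes>\<^sub>\<pi> A) A (\<lambda>w. left_product A w \<otimes> a)"
    by (rule bounded_linear_map_compose[OF ApA.EF.normed_completion normed_space_axioms
          bounded_left_product bounded_mult_right[OF a]])
  show "left_product A (tensor_right_action Ap A (mult A) (pure_tensor Ap A u b) a) =
      left_product A (pure_tensor Ap A u b) \<otimes> a" if "u \<in> carrier Ap" "b \<in> carrier A" for u b
    using that a act(2)[OF that]
    by (cases u) (simp add: left_product_pure mult_closed mult_add_left mult_add_right
        mult_scale_left mult_scale_right mult_assoc)
qed

lemma right_product_right:
  assumes a: "a \<in> carrier A" and w: "w \<in> carrier (A \<otimes>\<^sub>\<pi> Ap)"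
  shows "right_product A (tensor_right_action A Ap (plus_right A) w a) = right_product A w \<otimes> a"
proof (rule AAp.EF.ptensor_eqI[OF normed_space_axioms _ _ _ w])
  note act = AAp.right_action[OF right_module_unitization a]
  show "bounded_linear_map (A \<otimes>\<^sub>\<pi> Ap) A (\<lambda>w. right_product A (tensor_right_action A Ap (plus_right A) w a))"
    by (rule bounded_linear_map_compose[OF AAp.EF.normed_completion AAp.EF.normed_completion
          act(1) bounded_right_product])
  show "bounded_linear_map (A \<otimes>\<^sub>\<pi> Ap) A (\<lambda>w. right_product A w \<otimes> a)"
    by (rule bounded_linear_map_compose[OF AAp.EF.normed_completion normed_space_axioms
          bounded_right_product bounded_mult_right[OF a]])
  show "right_product A (tensor_right_action A Ap (plus_right A) (pure_tensor A Ap b u) a) =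
      right_product A (pure_tensor A Ap b u) \<otimes> a" if "b \<in> carrier A" "u \<in> carrier Ap" for u b
    using that a act(2)[OF that]
    by (cases u) (simp add: plus_right_eq right_product_pure mult_closed mult_add_left mult_add_right
        mult_scale_left mult_scale_right mult_assoc)
qed

text \<open>The section is \<open>b \<mapsto> 1 \<otimes> b\<close>; this is what the adjoined identity is for.\<close>

lemma left_product_section:
  "has_right_inverse A (bounded_linear_map A (Ap \<otimes>\<^sub>\<pi> A)) (left_product A)"
  unfolding has_right_inverse_def
proof (intro exI[of _ "pure_tensor Ap A (1, \<zero>)"] conjI ballI)
  show "bounded_linear_map A (Ap \<otimes>\<^sub>\<pi> A) (pure_tensor Ap A (1, \<zero>))"
    using bilinear_map_right[OF ApA.EF.bilinear_pure_tensor, of "(1, \<zero>)"]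
      ApA.EF.nrm_pure_tensor_le[of "(1, \<zero>)"]
    by (intro bounded_linear_mapI[where K = 1]) auto
  show "left_product A (pure_tensor Ap A (1, \<zero>) b) = b" if "b \<in> carrier A" for b
    using that by (simp add: left_product_pure zero_mult)
qed

lemma right_product_section:
  "has_right_inverse A (bounded_linear_map A (A \<otimes>\<^sub>\<pi> Ap)) (right_product A)"
  unfolding has_right_inverse_def
proof (intro exI[of _ "\<lambda>b. pure_tensor A Ap b (1, \<zero>)"] conjI ballI)
  show "bounded_linear_map A (A \<otimes>\<^sub>\<pi> Ap) (\<lambda>b. pure_tensor A Ap b (1, \<zero>))"
    using bilinear_map_left[OF AAp.EF.bilinear_pure_tensor, of "(1, \<zero>)"]
      AAp.EF.nrm_pure_tensor_le[of _ "(1, \<zero>)"]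
    by (intro bounded_linear_mapI[where K = 1]) auto
  show "right_product A (pure_tensor A Ap b (1, \<zero>)) = b" if "b \<in> carrier A" for b
    using that by (simp add: right_product_pure mult_zero)
qed

lemma right_inverse_surj:
  assumes "has_right_inverse Z (bounded_linear_map Z Y) T" "bounded_linear_map Y Z T"
  shows "T ` carrier Y = carrier Z"
proof -
  obtain \<sigma> where \<sigma>: "bounded_linear_map Z Y \<sigma>" "\<forall>z\<in>carrier Z. T (\<sigma> z) = z"
    using assms(1) by (auto simp: has_right_inverse_def)
  show ?thesis
    using \<sigma>(2) bounded_linear_map_closed[OF \<sigma>(1)] bounded_linear_map_closed[OF assms(2)]
    by (auto intro!: image_eqI[of _ T "\<sigma> _"])
qed

theorem left_projective_splitting:
  assumes "left_projective A"
  shows "\<exists>\<rho>. left_module_morphism A A (mult A) (Ap \<otimes>\<^sub>\<pi> A) (tensor_left_action Ap A (plus_left A)) \<rho> \<and>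
    (\<forall>a\<in>carrier A. left_product A (\<rho> a) = a)"
proof -
  have "left_module_morphism A (Ap \<otimes>\<^sub>\<pi> A) (tensor_left_action Ap A (plus_left A)) A (mult A) (left_product A)"
    by (simp add: left_module_morphism_def bounded_left_product left_product_left)
  from assms[unfolded left_projective_def projective_left_module_def, rule_format,
      OF conjI[OF ApA.left_banach_module_ptensor[OF left_module_unitization] conjI[OF this
        conjI[OF right_inverse_surj[OF left_product_section bounded_left_product] left_product_section]]]]
  show ?thesis unfolding has_right_inverse_def .
qed

theorem right_projective_splitting:
  assumes "right_projective A"
  shows "\<exists>\<rho>. right_module_morphism A A (mult A) (A \<otimes>\<^sub>\<pi> Ap) (tensor_right_action A Ap (plus_right A)) \<rho> \<and>
    (\<forall>a\<in>carrier A. right_product A (\<rho> a) = a)"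
proof -
  have "right_module_morphism A (A \<otimes>\<^sub>\<pi> Ap) (tensor_right_action A Ap (plus_right A)) A (mult A) (right_product A)"
    by (simp add: right_module_morphism_def bounded_right_product right_product_right)
  from assms[unfolded right_projective_def projective_right_module_def, rule_format,
      OF conjI[OF AAp.right_banach_module_ptensor[OF right_module_unitization] conjI[OF this
        conjI[OF right_inverse_surj[OF right_product_section bounded_right_product] right_product_section]]]]
  show ?thesis unfolding has_right_inverse_def .
qed

end


section \<open>Biprojective algebras\<close>

subsection \<open>Transport of modules along injections\<close>

text \<open>Biprojectivity is tested on modules whose carriers lie in one fixed type. A module in another
  type is tested through its copy along an injection into that type.\<close>

definition image_space :: "('y \<Rightarrow> 'z) \<Rightarrow> 'y nspace \<Rightarrow> 'z nspace" where
  "image_space j Y =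
     \<lparr>carrier = j ` carrier Y, mult = undefined, one = undefined, zero = j \<zero>\<^bsub>Y\<^esub>,
      add = (\<lambda>u v. j (inv_into UNIV j u \<oplus>\<^bsub>Y\<^esub> inv_into UNIV j v)), smult = (\<lambda>c u. j (c \<odot>\<^bsub>Y\<^esub> inv_into UNIV j u)),
      nrm = (\<lambda>u. nrm Y (inv_into UNIV j u))\<rparr>"

context
  fixes j :: "'y \<Rightarrow> 'z" and Y :: "'y nspace"
  assumes j: "inj j" and Y: "banach_space Y"
begin

interpretation Y: banach_space Y by (rule Y)

lemma inv_j [simp]: "inv_into UNIV j (j y) = y"
  using j by (rule inv_f_f)

lemma image_space_simps [simp]:
  "carrier (image_space j Y) = j ` carrier Y"
  "zero (image_space j Y) = j \<zero>\<^bsub>Y\<^esub>"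
  "j x \<oplus>\<^bsub>image_space j Y\<^esub> j y = j (x \<oplus>\<^bsub>Y\<^esub> y)"
  "c \<odot>\<^bsub>image_space j Y\<^esub> j x = j (c \<odot>\<^bsub>Y\<^esub> x)"
  "nrm (image_space j Y) (j x) = nrm Y x"
  by (simp_all add: image_space_def)

lemma normed_image_space: "normed_space (image_space j Y)"
  by (rule normed_spaceI)
    (auto simp: Y.a_ac Y.scale_left_distrib Y.scale_right_distrib Y.scale_scale Y.nrm_triangle
      Y.nrm_smult Y.nrm_eq_0_iff)

lemma banach_image_space: "banach_space (image_space j Y)"
proof (rule banach_spaceI[OF normed_image_space])
  fix s :: "nat \<Rightarrow> 'z"
  assume rng: "range s \<subseteq> carrier (image_space j Y)"
    and Cauchy: "\<forall>\<epsilon>>0. \<exists>N. \<forall>m\<ge>N. \<forall>n\<ge>N. nrm (image_space j Y) (s m \<ominus>\<^bsub>image_space j Y\<^esub> s n) < \<epsilon>"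
  define t where "t n = inv_into UNIV j (s n)" for n
  have st: "s n = j (t n)" "t n \<in> carrier Y" for n
  proof -
    have "s n \<in> j ` carrier Y" using rng by auto
    then show "s n = j (t n)" "t n \<in> carrier Y" by (auto simp: t_def)
  qed
  have diff: "nrm (image_space j Y) (j x \<ominus>\<^bsub>image_space j Y\<^esub> j y) = nrm Y (x \<ominus>\<^bsub>Y\<^esub> y)"
    if "x \<in> carrier Y" "y \<in> carrier Y" for x y
    using that normed_space.diff_eq[OF normed_image_space, of "j x" "j y"] by (simp add: Y.diff_eq)
  have "range t \<subseteq> carrier Y" using st by auto
  moreover have "\<forall>\<epsilon>>0. \<exists>N. \<forall>m\<ge>N. \<forall>n\<ge>N. nrm Y (t m \<ominus>\<^bsub>Y\<^esub> t n) < \<epsilon>"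
    using Cauchy st by (simp add: diff)
  ultimately obtain y where y: "y \<in> carrier Y" "Y.converges t y"
    by (rule Y.Cauchy_converges)
  then have "(\<lambda>n. nrm (image_space j Y) (s n \<ominus>\<^bsub>image_space j Y\<^esub> j y)) \<longlonglongrightarrow> 0"
    using st by (simp add: diff Y.converges_def)
  then show "\<exists>x\<in>carrier (image_space j Y). (\<lambda>n. nrm (image_space j Y) (s n \<ominus>\<^bsub>image_space j Y\<^esub> x)) \<longlonglongrightarrow> 0"
    by (rule bexI) (use y in auto)
qed

lemma bounded_linear_map_j: "bounded_linear_map Y (image_space j Y) j"
  by (rule bounded_linear_mapI[where K = 1]) (auto intro: linear_mapI)

lemma bounded_linear_map_inv_j: "bounded_linear_map (image_space j Y) Y (inv_into UNIV j)"
  by (rule bounded_linear_mapI[where K = 1]) (auto intro!: linear_mapI)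

lemma projective_bimodule_transport:
  assumes proj: "projective_bimodule TYPE('z) B P l r" and P: "normed_space P"
    and M: "banach_bimodule B Y lY rY" and \<phi>: "bimodule_morphism B Y lY rY P l r \<phi>"
    and surj: "\<phi> ` carrier Y = carrier P"
    and split: "has_right_inverse P (bounded_linear_map P Y) \<phi>"
  shows "has_right_inverse P (bimodule_morphism B P l r Y lY rY) \<phi>"
proof -
  let ?Y = "image_space j Y" and ?i = "inv_into UNIV j"
  define l' where "l' b u = j (lY b (?i u))" for b u
  define r' where "r' u b = j (rY (?i u) b)" for b u
  note nY = Y.normed_space_axioms
  note comp = bounded_linear_map_compose
  have bilY: "bounded_bilinear_map B Y Y lY" "bounded_bilinear_map Y B Y rY"
    using M by (auto simp: banach_bimodule_def left_banach_module_def right_banach_module_def)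
  have memY: "lY b y \<in> carrier Y" "rY y b \<in> carrier Y" if "b \<in> carrier B" "y \<in> carrier Y" for b y
    using bilY that by (auto simp: bounded_bilinear_map_def intro: bilinear_map_closed)
  obtain K where K: "\<forall>b\<in>carrier B. \<forall>y\<in>carrier Y. nrm Y (lY b y) \<le> K * nrm B b * nrm Y y"
    using bilY(1) by (auto simp: bounded_bilinear_map_def)
  obtain L where L: "\<forall>y\<in>carrier Y. \<forall>b\<in>carrier B. nrm Y (rY y b) \<le> L * nrm Y y * nrm B b"
    using bilY(2) by (auto simp: bounded_bilinear_map_def)
  have bil: "bilinear_map B Y Y lY" "bilinear_map Y B Y rY"
    using bilY by (auto simp: bounded_bilinear_map_def)
  note jlin = bounded_linear_map_linear[OF bounded_linear_map_j]
  note ilin = bounded_linear_map_linear[OF bounded_linear_map_inv_j]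
  have "bounded_bilinear_map B ?Y ?Y l'"
    unfolding bounded_bilinear_map_def
  proof (intro conjI exI[of _ K] bilinear_mapI)
    show "linear_map ?Y ?Y (l' b)" if "b \<in> carrier B" for b
      unfolding l'_def
      by (rule linear_map_compose[OF linear_map_compose[OF ilin bilinear_map_right[OF bil(1) that]] jlin])
    show "linear_map B ?Y (\<lambda>b. l' b u)" if u: "u \<in> carrier ?Y" for u
      unfolding l'_def
      by (rule linear_map_compose[OF bilinear_map_left[OF bil(1) linear_map_closed[OF ilin u]] jlin])
    show "\<forall>b\<in>carrier B. \<forall>u\<in>carrier ?Y. nrm ?Y (l' b u) \<le> K * nrm B b * nrm ?Y u"
      using K by (auto simp: l'_def)
  qed
  moreover have "bounded_bilinear_map ?Y B ?Y r'"
    unfolding bounded_bilinear_map_def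
  proof (intro conjI exI[of _ L] bilinear_mapI)
    show "linear_map ?Y ?Y (\<lambda>u. r' u b)" if "b \<in> carrier B" for b
      unfolding r'_def
      by (rule linear_map_compose[OF linear_map_compose[OF ilin bilinear_map_left[OF bil(2) that]] jlin])
    show "linear_map B ?Y (r' u)" if u: "u \<in> carrier ?Y" for u
      unfolding r'_def
      by (rule linear_map_compose[OF bilinear_map_right[OF bil(2) linear_map_closed[OF ilin u]] jlin])
    show "\<forall>u\<in>carrier ?Y. \<forall>b\<in>carrier B. nrm ?Y (r' u b) \<le> L * nrm ?Y u * nrm B b"
      using L by (auto simp: r'_def)
  qed
  ultimately have M': "banach_bimodule B ?Y l' r'"
    using M memY
    by (auto simp: banach_bimodule_def left_banach_module_def right_banach_module_def
        banach_image_space l'_def r'_def)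
  have \<phi>': "bimodule_morphism B ?Y l' r' P l r (\<lambda>u. \<phi> (?i u))"
    using \<phi> comp[OF normed_image_space nY bounded_linear_map_inv_j, of P \<phi>]
    by (auto simp: bimodule_morphism_def left_module_morphism_def right_module_morphism_def
        l'_def r'_def)
  have surj': "(\<lambda>u. \<phi> (?i u)) ` carrier ?Y = carrier P"
    using surj by (simp add: image_image)
  obtain \<sigma> where \<sigma>: "bounded_linear_map P Y \<sigma>" "\<forall>z\<in>carrier P. \<phi> (\<sigma> z) = z"
    using split by (auto simp: has_right_inverse_def)
  have "has_right_inverse P (bounded_linear_map P ?Y) (\<lambda>u. \<phi> (?i u))"
    unfolding has_right_inverse_def
    by (rule exI[of _ "\<lambda>z. j (\<sigma> z)"]) (use \<sigma> comp[OF P nY \<sigma>(1) bounded_linear_map_j] in auto)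
  then obtain \<tau> where \<tau>: "bimodule_morphism B P l r ?Y l' r' \<tau>" "\<forall>z\<in>carrier P. \<phi> (?i (\<tau> z)) = z"
    using proj[unfolded projective_bimodule_def, rule_format, OF conjI[OF M' conjI[OF \<phi>' conjI[OF surj']]]]
    by (auto simp: has_right_inverse_def)
  have "bimodule_morphism B P l r Y lY rY (\<lambda>z. ?i (\<tau> z))"
    using \<tau>(1) comp[OF P normed_image_space _ bounded_linear_map_inv_j, of \<tau>]
    by (auto simp: bimodule_morphism_def left_module_morphism_def right_module_morphism_def
        l'_def r'_def)
  then show ?thesis
    unfolding has_right_inverse_def using \<tau>(2) by blast
qed

end

lemma inj_push_forward:
  assumes "inj g"
  shows "inj (\<lambda>u :: 'k \<Rightarrow>\<^sub>0 complex.
    \<Sum>k\<in>Poly_Mapping.keys u. Poly_Mapping.single (g k) (Poly_Mapping.lookup u k))"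
proof -
  have "Poly_Mapping.lookup (\<Sum>k\<in>Poly_Mapping.keys u.
      Poly_Mapping.single (g k) (Poly_Mapping.lookup u k)) (g l) = Poly_Mapping.lookup u l"
    for u :: "'k \<Rightarrow>\<^sub>0 complex" and l
    by (simp add: lookup_sum lookup_single when_def inj_eq[OF assms] in_keys_iff)
  then show ?thesis
    by (intro injI poly_mapping_eqI) metis
qed

lemma inj_constant_tensor:
  "inj (\<lambda>z. {\<lambda>n :: nat. Poly_Mapping.single z (1 :: complex)})"
proof (rule injI)
  fix x y :: 'z
  assume "{\<lambda>n :: nat. Poly_Mapping.single x (1 :: complex)} = {\<lambda>n. Poly_Mapping.single y 1}"
  then have "Poly_Mapping.single x (1 :: complex) = Poly_Mapping.single y 1"
    by (metis singleton_inject)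
  then show "x = y"
    by (metis lookup_single_eq lookup_single_not_eq zero_neq_one)
qed

text \<open>Symbols are pushed forward in every formal tensor of every sequence of the class. The image
  is merely a set of sequences and in general not a class: this is an injection of types, not a map
  of tensor products.\<close>

lemma ex_inj_tensor_elt:
  assumes "inj (h :: 'f \<Rightarrow> 'g)"
  shows "\<exists>j :: ('e, 'f) tensor_elt \<Rightarrow> ('e, 'g) tensor_elt. inj j"
proof -
  have "inj (map_prod (id :: 'e \<Rightarrow> 'e) h)" using assms by (intro prod.inj_map) auto
  from inj_push_forward[OF this] obtain q :: "('e, 'f) formal_tensor \<Rightarrow> ('e, 'g) formal_tensor"
    where q: "inj q" by blast
  have "inj (\<lambda>s (n :: nat). q (s n))"
    using q by (auto simp: inj_def fun_eq_iff)
  then have "inj ((`) (\<lambda>s (n :: nat). q (s n)))"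
    by (intro injI) (simp add: inj_image_eq_iff)
  then show ?thesis by blast
qed


subsection \<open>Splitting the product\<close>

context banach_algebra
begin

interpretation Ap: banach_space Ap by (rule banach_unitization)
interpretation ApA: tensor_module A Ap A by unfold_locales
interpretation AA: tensor_module A A A by unfold_locales

text \<open>Twist the bimodule \<open>\<complex> \<oplus> A\<close> by \<open>f\<close>: let \<open>b \<cdot> (z, c) = (f b f c, b c)\<close> and
  \<open>(z, c) \<cdot> b = (0, c b)\<close>. These are commuting actions because \<open>f\<close> kills products. The projection to \<open>A\<close> has a
  bounded linear section, hence by biprojectivity a section \<open>\<sigma>\<close> that is a bimodule map. The first
  component of \<open>\<sigma> (a a) = a \<cdot> \<sigma> a\<close> is \<open>(f a)\<^sup>2\<close>, that of \<open>\<sigma> (a a) = \<sigma> a \<cdot> a\<close> is \<open>0\<close>.\<close>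

lemma biprojective_vanishing_functional:
  assumes biproj: "biprojective A"
    and f_add: "\<forall>x\<in>carrier A. \<forall>y\<in>carrier A. f (x \<oplus> y) = f x + f y"
    and f_scale: "\<forall>z. \<forall>x\<in>carrier A. f (z \<odot> x) = z * f x"
    and f_bound: "\<forall>x\<in>carrier A. cmod (f x) \<le> K * nrm A x"
    and f_mult: "\<And>x y. \<lbrakk>x \<in> carrier A; y \<in> carrier A\<rbrakk> \<Longrightarrow> f (x \<otimes> y) = 0"
    and a: "a \<in> carrier A"
  shows "f a = 0"
proof -
  define l where "l b u = (f b * f (snd u), b \<otimes> snd u)" for b and u :: "complex \<times> 'a"
  define r where "r u b = (0 :: complex, snd u \<otimes> b)" for b and u :: "complex \<times> 'a"
  have "bounded_bilinear_map A Ap Ap l"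
    unfolding bounded_bilinear_map_def
  proof (intro conjI exI[of _ "K * K + 1"] bilinear_mapI linear_mapI ballI)
    fix b u assume bu: "b \<in> carrier A" "u \<in> carrier Ap"
    obtain z c where u: "u = (z, c)" "c \<in> carrier A" using bu by (cases u) auto
    have "cmod (f b * f c) \<le> (K * nrm A b) * (K * nrm A c)"
      unfolding norm_mult using f_bound bu u by (intro mult_mono) (auto intro: order_trans[OF norm_ge_zero])
    then have "nrm Ap (l b u) \<le> (K * K + 1) * nrm A b * nrm A c"
      using nrm_mult_le[OF bu(1) u(2)] u by (simp add: l_def algebra_simps)
    also have "\<dots> \<le> (K * K + 1) * nrm A b * nrm Ap u"
      using bu u by (intro mult_left_mono) auto
    finally show "nrm Ap (l b u) \<le> (K * K + 1) * nrm A b * nrm Ap u" .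
  qed (auto simp: l_def f_add f_scale mult_closed mult_add_left mult_add_right mult_scale_left
      mult_scale_right algebra_simps)
  moreover have "bounded_bilinear_map Ap A Ap r"
    unfolding bounded_bilinear_map_def
  proof (intro conjI exI[of _ 1] bilinear_mapI linear_mapI ballI)
    fix b u assume bu: "u \<in> carrier Ap" "b \<in> carrier A"
    obtain z c where u: "u = (z, c)" "c \<in> carrier A" using bu by (cases u) auto
    have "nrm A c * nrm A b \<le> nrm Ap u * nrm A b"
      using bu u by (intro mult_right_mono) auto
    then show "nrm Ap (r u b) \<le> 1 * nrm Ap u * nrm A b"
      using nrm_mult_le[OF u(2) bu(2)] u by (simp add: r_def)
  qed (auto simp: r_def mult_closed mult_add_left mult_add_right mult_scale_left mult_scale_right)
  ultimately have M: "banach_bimodule A Ap l r"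
    by (auto simp: banach_bimodule_def left_banach_module_def right_banach_module_def
        banach_unitization l_def r_def f_mult mult_closed mult_assoc)
  have "bounded_linear_map Ap A snd"
    by (rule bounded_linear_mapI[where K = 1]) (auto intro!: linear_mapI)
  then have \<phi>: "bimodule_morphism A Ap l r A (mult A) (mult A) snd"
    by (simp add: bimodule_morphism_def left_module_morphism_def right_module_morphism_def l_def r_def)
  have "bounded_linear_map A Ap (Pair 0)"
    by (rule bounded_linear_mapI[where K = 1]) (auto intro!: linear_mapI)
  then have split: "has_right_inverse A (bounded_linear_map A Ap) snd"
    unfolding has_right_inverse_def by (intro exI[of _ "Pair 0"]) simp
  have surj: "snd ` carrier Ap = carrier A" by force
  obtain j :: "'a plus_elt \<Rightarrow> ('a plus_elt, ('a, 'a plus_elt) tensor_elt) tensor_elt" where j: "inj j"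
  proof -
    have "inj (\<lambda>u :: 'a plus_elt. (u, {} :: ('a, 'a plus_elt) tensor_elt))" by (rule injI) simp
    from inj_compose[OF inj_constant_tensor this] that show thesis by blast
  qed
  obtain \<sigma> where \<sigma>: "bimodule_morphism A A (mult A) (mult A) Ap l r \<sigma>"
      "\<forall>a\<in>carrier A. snd (\<sigma> a) = a"
    using projective_bimodule_transport[OF j banach_unitization biproj[unfolded biprojective_def]
        normed_space_axioms M \<phi> surj split] by (auto simp: has_right_inverse_def)
  have "\<sigma> (a \<otimes> a) = l a (\<sigma> a)" "\<sigma> (a \<otimes> a) = r (\<sigma> a) a"
    using \<sigma>(1) a by (auto simp: bimodule_morphism_def left_module_morphism_def right_module_morphism_def)
  then show ?thesis using \<sigma>(2) a by (simp add: l_def r_def)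
qed

text \<open>Write \<open>A\<^sub>+ \<otimes> A = (1 \<otimes> A) \<oplus> (A \<otimes> A)\<close>, where \<open>A\<close> is the given algebra, and let \<open>\<epsilon>\<close>
  and \<open>P\<close> be the two coordinates. Biprojectivity provides a bimodule map \<open>\<rho>\<close> into \<open>A\<^sub>+ \<otimes> A\<close> that splits the product.
  The map \<open>P\<close> respects the right action, and the left action up to the error term \<open>a \<otimes> \<epsilon> w\<close>. Since
  \<open>\<epsilon> \<circ> \<rho>\<close> vanishes on products, composing it with bounded functionals shows that it is zero, so
  \<open>P \<circ> \<rho>\<close> is a bimodule map and still splits the product.\<close>

theorem biprojective_splitting:
  assumes biproj: "biprojective A"
  shows "\<exists>\<rho>. bimodule_morphism A A (mult A) (mult A) (A \<otimes>\<^sub>\<pi> A)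
      (tensor_left_action A A (mult A)) (tensor_right_action A A (mult A)) \<rho> \<and>
    (\<forall>a\<in>carrier A. bi_product A (\<rho> a) = a)"
proof -
  let ?l = "tensor_left_action Ap A (plus_left A)" and ?r = "tensor_right_action Ap A (mult A)"
  have M: "banach_bimodule A (Ap \<otimes>\<^sub>\<pi> A) ?l ?r"
    by (rule ApA.banach_bimodule_ptensor[OF left_module_unitization right_banach_module_self])
  have \<phi>: "bimodule_morphism A (Ap \<otimes>\<^sub>\<pi> A) ?l ?r A (mult A) (mult A) (left_product A)"
    by (simp add: bimodule_morphism_def left_module_morphism_def right_module_morphism_def
        bounded_left_product left_product_left left_product_right)
  obtain j :: "('a plus_elt, 'a) tensor_elt \<Rightarrow> ('a plus_elt, ('a, 'a plus_elt) tensor_elt) tensor_elt"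
    where j: "inj j"
  proof -
    have "inj (\<lambda>a :: 'a. (a, (0, a) :: 'a plus_elt))" by (rule injI) simp
    from ex_inj_tensor_elt[OF inj_compose[OF inj_constant_tensor this]] that show thesis by blast
  qed
  obtain \<rho> where \<rho>: "bimodule_morphism A A (mult A) (mult A) (Ap \<otimes>\<^sub>\<pi> A) ?l ?r \<rho>"
      "\<forall>a\<in>carrier A. left_product A (\<rho> a) = a"
    using projective_bimodule_transport[OF j ApA.EF.banach_ptensor biproj[unfolded biprojective_def]
        normed_space_axioms M \<phi> right_inverse_surj[OF left_product_section bounded_left_product]
        left_product_section] by (auto simp: has_right_inverse_def)
  have \<rho>_bl: "bounded_linear_map A (Ap \<otimes>\<^sub>\<pi> A) \<rho>"
    and \<rho>_left: "\<And>a b. \<lbrakk>a \<in> carrier A; b \<in> carrier A\<rbrakk> \<Longrightarrow> \<rho> (a \<otimes> b) = ?l a (\<rho> b)"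
    and \<rho>_right: "\<And>a b. \<lbrakk>a \<in> carrier A; b \<in> carrier A\<rbrakk> \<Longrightarrow> \<rho> (b \<otimes> a) = ?r (\<rho> b) a"
    using \<rho>(1) by (auto simp: bimodule_morphism_def left_module_morphism_def right_module_morphism_def)
  note \<rho>_mem = bounded_linear_map_closed[OF \<rho>_bl]
  note N = ApA.EF.normed_completion and N' = AA.EF.normed_completion and NA = normed_space_axioms
  note lact = ApA.left_action[OF left_module_unitization]
  note ract = ApA.right_action[OF right_banach_module_self]
  note lact' = AA.left_action[OF left_banach_module_self]
  note ract' = AA.right_action[OF right_banach_module_self]
  (* the coordinate in 1 \<otimes> A, read as an element of A *)
  define \<epsilon> where "\<epsilon> = ptensor_lift Ap A A (\<lambda>u b. fst u \<odot> b)"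
  have bil: "bilinear_map Ap A A (\<lambda>u b. fst u \<odot> b)"
    by (intro bilinear_mapI linear_mapI)
      (auto simp: scale_left_distrib scale_right_distrib scale_scale mult.commute)
  have bound: "\<forall>u\<in>carrier Ap. \<forall>b\<in>carrier A. nrm A (fst u \<odot> b) \<le> 1 * nrm Ap u * nrm A b"
    by (auto simp: nrm_smult intro!: mult_right_mono)
  note \<epsilon> = ApA.EF.ptensor_lift[OF banach_space_axioms bil zero_le_one bound, folded \<epsilon>_def]
  (* the coordinate in A \<otimes> A *)
  define P where "P = tensor_map Ap A A A snd (\<lambda>b. b)"
  have bsnd: "bounded_linear_map Ap A snd"
    by (rule bounded_linear_mapI[where K = 1]) (auto intro!: linear_mapI)
  note P = bounded_tensor_map[OF Ap.normed_space_axioms NA NA NA bsnd bounded_linear_map_id[OF NA],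
      folded P_def]
  note comp = bounded_linear_map_compose
  have \<epsilon>_left: "\<epsilon> (?l a w) = \<zero>" if a: "a \<in> carrier A" and w: "w \<in> carrier (Ap \<otimes>\<^sub>\<pi> A)" for a w
  proof (rule ApA.EF.ptensor_eqI[OF NA comp[OF N N lact(1)[OF a] \<epsilon>(1)] _ _ w])
    show "bounded_linear_map (Ap \<otimes>\<^sub>\<pi> A) A (\<lambda>_. \<zero>)"
      by (rule bounded_linear_mapI[where K = 0]) (auto intro: linear_mapI)
    show "\<epsilon> (?l a (pure_tensor Ap A u b)) = \<zero>" if "u \<in> carrier Ap" "b \<in> carrier A" for u b
    proof (cases u)
      case (Pair z c)
      then have "plus_left A a u \<in> carrier Ap" "fst (plus_left A a u) = 0"
        using a that by (auto simp: plus_left_eq mult_closed)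
      then show ?thesis using a that by (simp add: lact(2) \<epsilon>(2))
    qed
  qed
  have \<alpha>: "\<epsilon> (\<rho> b) = \<zero>" if b: "b \<in> carrier A" for b
  proof (rule ccontr)
    assume nz: "\<epsilon> (\<rho> b) \<noteq> \<zero>"
    have \<epsilon>\<rho>: "bounded_linear_map A A (\<lambda>x. \<epsilon> (\<rho> x))" by (rule comp[OF NA N \<rho>_bl \<epsilon>(1)])
    note mem = bounded_linear_map_closed[OF \<epsilon>\<rho>]
    obtain g K where g: "g (\<epsilon> (\<rho> b)) \<noteq> (0 :: complex)"
      "\<forall>x\<in>carrier A. \<forall>y\<in>carrier A. g (x \<oplus> y) = g x + g y"
      "\<forall>z. \<forall>x\<in>carrier A. g (z \<odot> x) = z * g x" "\<forall>x\<in>carrier A. cmod (g x) \<le> K * nrm A x"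
      using ex_functional_nonzero[OF mem[OF b] nz] by blast
    obtain L where L: "L \<ge> 0" "\<forall>x\<in>carrier A. nrm A (\<epsilon> (\<rho> x)) \<le> L * nrm A x"
      using bounded_linear_map_bound[OF NA \<epsilon>\<rho>] by blast
    have gz: "g \<zero> = 0" using g(3)[rule_format, of "\<zero>" 0] by simp
    have "g (\<epsilon> (\<rho> b)) = 0"
    proof (rule biprojective_vanishing_functional[OF biproj, where f = "\<lambda>x. g (\<epsilon> (\<rho> x))" and K = "\<bar>K\<bar> * L"])
      show "\<forall>x\<in>carrier A. \<forall>y\<in>carrier A. g (\<epsilon> (\<rho> (x \<oplus> y))) = g (\<epsilon> (\<rho> x)) + g (\<epsilon> (\<rho> y))"
        using g(2) mem by (simp add: bounded_linear_map_add[OF \<epsilon>\<rho>])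
      show "\<forall>z. \<forall>x\<in>carrier A. g (\<epsilon> (\<rho> (z \<odot> x))) = z * g (\<epsilon> (\<rho> x))"
        using g(3) mem by (simp add: bounded_linear_map_scale[OF \<epsilon>\<rho>])
      show "\<forall>x\<in>carrier A. cmod (g (\<epsilon> (\<rho> x))) \<le> \<bar>K\<bar> * L * nrm A x"
      proof
        fix x assume x: "x \<in> carrier A"
        have "cmod (g (\<epsilon> (\<rho> x))) \<le> K * nrm A (\<epsilon> (\<rho> x))" using g(4) mem[OF x] by blast
        also have "\<dots> \<le> \<bar>K\<bar> * nrm A (\<epsilon> (\<rho> x))" using mem[OF x] by (intro mult_right_mono) auto
        also have "\<dots> \<le> \<bar>K\<bar> * (L * nrm A x)" using L x by (intro mult_left_mono) auto
        finally show "cmod (g (\<epsilon> (\<rho> x))) \<le> \<bar>K\<bar> * L * nrm A x" by (simp add: mult.assoc)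
      qed
      show "g (\<epsilon> (\<rho> (x \<otimes> y))) = 0" if "x \<in> carrier A" "y \<in> carrier A" for x y
        using that gz by (simp add: \<rho>_left \<epsilon>_left \<rho>_mem)
    qed (rule b)
    then show False using g(1) by simp
  qed
  have P_left: "P (?l a w) = tensor_left_action A A (mult A) a (P w) \<oplus>\<^bsub>A \<otimes>\<^sub>\<pi> A\<^esub> pure_tensor A A a (\<epsilon> w)"
    if a: "a \<in> carrier A" and w: "w \<in> carrier (Ap \<otimes>\<^sub>\<pi> A)" for a w
  proof (rule ApA.EF.ptensor_eqI[OF N' comp[OF N N lact(1)[OF a] P(1)] _ _ w])
    have "bounded_linear_map A (A \<otimes>\<^sub>\<pi> A) (pure_tensor A A a)"
      using bilinear_map_right[OF AA.EF.bilinear_pure_tensor a] AA.EF.nrm_pure_tensor_le[OF a]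
      by (rule bounded_linear_mapI)
    then show "bounded_linear_map (Ap \<otimes>\<^sub>\<pi> A) (A \<otimes>\<^sub>\<pi> A)
        (\<lambda>w. tensor_left_action A A (mult A) a (P w) \<oplus>\<^bsub>A \<otimes>\<^sub>\<pi> A\<^esub> pure_tensor A A a (\<epsilon> w))"
      by (rule bounded_linear_map_plus[OF N' comp[OF N N' P(1) lact'(1)[OF a]] comp[OF N NA \<epsilon>(1)]])
    show "P (?l a (pure_tensor Ap A u b)) = tensor_left_action A A (mult A) a (P (pure_tensor Ap A u b))
        \<oplus>\<^bsub>A \<otimes>\<^sub>\<pi> A\<^esub> pure_tensor A A a (\<epsilon> (pure_tensor Ap A u b))"
      if ub: "u \<in> carrier Ap" "b \<in> carrier A" for u b
    proof (cases u)
      case (Pair z c)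
      then have c: "c \<in> carrier A" using ub by simp
      have "P (?l a (pure_tensor Ap A u b)) = pure_tensor A A (z \<odot> a \<oplus> a \<otimes> c) b"
        using a ub c by (simp add: Pair lact(2) P(2) plus_left_eq mult_closed)
      also have "\<dots> = z \<odot>\<^bsub>A \<otimes>\<^sub>\<pi> A\<^esub> pure_tensor A A a b \<oplus>\<^bsub>A \<otimes>\<^sub>\<pi> A\<^esub> pure_tensor A A (a \<otimes> c) b"
        using a ub c linear_map_add[OF bilinear_map_left[OF AA.EF.bilinear_pure_tensor ub(2)]]
          linear_map_scale[OF bilinear_map_left[OF AA.EF.bilinear_pure_tensor ub(2)]]
        by (simp add: mult_closed)
      also have "z \<odot>\<^bsub>A \<otimes>\<^sub>\<pi> A\<^esub> pure_tensor A A a b = pure_tensor A A a (z \<odot> b)"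
        using linear_map_scale[OF bilinear_map_right[OF AA.EF.bilinear_pure_tensor a] ub(2)] by simp
      also have "pure_tensor A A a (z \<odot> b) \<oplus>\<^bsub>A \<otimes>\<^sub>\<pi> A\<^esub> pure_tensor A A (a \<otimes> c) b =
          pure_tensor A A (a \<otimes> c) b \<oplus>\<^bsub>A \<otimes>\<^sub>\<pi> A\<^esub> pure_tensor A A a (z \<odot> b)"
        using a ub c by (intro AA.EF.compl.a_comm AA.EF.pure_tensor_mem) (auto simp: mult_closed)
      finally show ?thesis
        using a ub c by (simp add: Pair P(2) \<epsilon>(2) lact'(2))
    qed
  qed
  have P_right: "P (?r w a) = tensor_right_action A A (mult A) (P w) a"
    if a: "a \<in> carrier A" and w: "w \<in> carrier (Ap \<otimes>\<^sub>\<pi> A)" for a w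
    by (rule ApA.EF.ptensor_eqI[OF N' comp[OF N N ract(1)[OF a] P(1)] comp[OF N N' P(1) ract'(1)[OF a]] _ w])
      (use a in \<open>auto simp: ract(2) P(2) ract'(2) mult_closed\<close>)
  have prod: "left_product A w = bi_product A (P w) \<oplus> \<epsilon> w" if w: "w \<in> carrier (Ap \<otimes>\<^sub>\<pi> A)" for w
    by (rule ApA.EF.ptensor_eqI[OF NA bounded_left_product
          bounded_linear_map_plus[OF NA comp[OF N N' P(1) bounded_bi_product] \<epsilon>(1)] _ w])
      (auto simp: left_product_pure P(2) \<epsilon>(2) bi_product_pure mult_closed a_comm)
  show ?thesis
  proof (intro exI[of _ "\<lambda>a. P (\<rho> a)"] conjI ballI)
    have "bounded_linear_map A (A \<otimes>\<^sub>\<pi> A) (\<lambda>a. P (\<rho> a))" by (rule comp[OF NA N \<rho>_bl P(1)])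
    moreover have "P (\<rho> (a \<otimes> b)) = tensor_left_action A A (mult A) a (P (\<rho> b))"
      if ab: "a \<in> carrier A" "b \<in> carrier A" for a b
    proof -
      have "pure_tensor A A a \<zero> = 0 \<odot>\<^bsub>A \<otimes>\<^sub>\<pi> A\<^esub> pure_tensor A A a \<zero>"
        using linear_map_scale[OF bilinear_map_right[OF AA.EF.bilinear_pure_tensor ab(1)], of "\<zero>" 0] by simp
      also have "\<dots> = \<zero>\<^bsub>A \<otimes>\<^sub>\<pi> A\<^esub>"
        using AA.EF.pure_tensor_mem[OF ab(1), of "\<zero>"] by simp
      finally show ?thesis
        using ab bounded_linear_map_closed[OF lact'(1)[OF ab(1)] bounded_linear_map_closed[OF P(1) \<rho>_mem]]
        by (simp add: \<rho>_left P_left \<rho>_mem \<alpha>)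
    qed
    moreover have "P (\<rho> (b \<otimes> a)) = tensor_right_action A A (mult A) (P (\<rho> b)) a"
      if ab: "a \<in> carrier A" "b \<in> carrier A" for a b
      using ab by (simp add: \<rho>_right P_right \<rho>_mem)
    ultimately show "bimodule_morphism A A (mult A) (mult A) (A \<otimes>\<^sub>\<pi> A)
        (tensor_left_action A A (mult A)) (tensor_right_action A A (mult A)) (\<lambda>a. P (\<rho> a))"
      by (simp add: bimodule_morphism_def left_module_morphism_def right_module_morphism_def)
    show "bi_product A (P (\<rho> a)) = a" if a: "a \<in> carrier A" for a
      using prod[OF \<rho>_mem[OF a]] \<rho>(2) a \<alpha>[OF a]
        bounded_linear_map_closed[OF bounded_bi_product bounded_linear_map_closed[OF P(1) \<rho>_mem[OF a]]]
      by simp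
  qed
qed

end


section \<open>Passing to a locally split quotient\<close>

lemma op_norm_le:
  assumes "normed_space V" "K \<ge> 0" "\<forall>x\<in>carrier V. nrm W (T x) \<le> K * nrm V x"
  shows "op_norm V W T \<le> K"
proof -
  interpret V: normed_space V by fact
  have "nrm W (T x) \<le> K" if "x \<in> carrier V" "nrm V x \<le> 1" for x
    using assms(3) that mult_left_mono[OF that(2) assms(2)] by force
  then show ?thesis
    unfolding op_norm_def
    by (intro cSup_least) (auto intro!: exI[of _ "T \<zero>\<^bsub>V\<^esub>"] exI[of _ "\<zero>\<^bsub>V\<^esub>"])
qed

text \<open>The abstract relation between the algebra \<open>B\<close> of a field and a fibre \<open>F\<close>: an evaluation
  homomorphism with a contractive linear section \<open>\<sigma>\<close>, and a second section \<open>\<tau>\<close> which makes up for \<open>\<sigma>\<close>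
  not being multiplicative.\<close>

locale split_quotient = B: banach_algebra B + F: banach_algebra F
  for B :: "'b nspace" and F :: "'a nspace" +
  fixes ev :: "'b \<Rightarrow> 'a" and \<sigma> \<tau> :: "'a \<Rightarrow> 'b"
  assumes ev_linear: "linear_map B F ev"
    and nrm_ev: "x \<in> carrier B \<Longrightarrow> nrm F (ev x) \<le> nrm B x"
    and ev_mult: "\<lbrakk>x \<in> carrier B; y \<in> carrier B\<rbrakk> \<Longrightarrow> ev (x \<otimes>\<^bsub>B\<^esub> y) = ev x \<otimes>\<^bsub>F\<^esub> ev y"
    and \<sigma>_linear: "linear_map F B \<sigma>"
    and nrm_\<sigma>: "a \<in> carrier F \<Longrightarrow> nrm B (\<sigma> a) \<le> nrm F a"
    and ev_\<sigma>: "a \<in> carrier F \<Longrightarrow> ev (\<sigma> a) = a"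
    and \<tau>_mem: "a \<in> carrier F \<Longrightarrow> \<tau> a \<in> carrier B"
    and ev_\<tau>: "a \<in> carrier F \<Longrightarrow> ev (\<tau> a) = a"
    and \<tau>_\<sigma>: "\<lbrakk>a \<in> carrier F; b \<in> carrier F\<rbrakk> \<Longrightarrow> \<tau> a \<otimes>\<^bsub>B\<^esub> \<sigma> b = \<sigma> (a \<otimes>\<^bsub>F\<^esub> b)"
    and \<sigma>_\<tau>: "\<lbrakk>a \<in> carrier F; b \<in> carrier F\<rbrakk> \<Longrightarrow> \<sigma> a \<otimes>\<^bsub>B\<^esub> \<tau> b = \<sigma> (a \<otimes>\<^bsub>F\<^esub> b)"
begin

abbreviation "Bp \<equiv> unitization B"
abbreviation "Fp \<equiv> unitization F"

interpretation Bp: banach_space Bp by (rule B.banach_unitization)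
interpretation Fp: banach_space Fp by (rule F.banach_unitization)
interpretation BpB: tensor_module B Bp B by unfold_locales
interpretation FpF: tensor_module F Fp F by unfold_locales
interpretation BBp: tensor_module B B Bp by unfold_locales
interpretation FFp: tensor_module F F Fp by unfold_locales
interpretation BB: tensor_module B B B by unfold_locales
interpretation FF: tensor_module F F F by unfold_locales

lemmas nB = B.normed_space_axioms and nF = F.normed_space_axioms
  and nBp = Bp.normed_space_axioms and nFp = Fp.normed_space_axioms

lemmas ev_mem = linear_map_closed[OF ev_linear]
lemmas \<sigma>_mem = linear_map_closed[OF \<sigma>_linear]

lemma bounded_ev: "bounded_linear_map B F ev"
  by (rule bounded_linear_mapI[OF ev_linear, where K = 1]) (simp add: nrm_ev)

lemma bounded_\<sigma>: "bounded_linear_map F B \<sigma>"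
  by (rule bounded_linear_mapI[OF \<sigma>_linear, where K = 1]) (simp add: nrm_\<sigma>)

definition evp :: "'b plus_elt \<Rightarrow> 'a plus_elt" where
  "evp u = (fst u, ev (snd u))"

lemma evp_linear: "linear_map Bp Fp evp"
  by (rule linear_mapI)
    (auto simp: evp_def ev_mem linear_map_add[OF ev_linear] linear_map_scale[OF ev_linear])

lemma nrm_evp: "u \<in> carrier Bp \<Longrightarrow> nrm Fp (evp u) \<le> nrm Bp u"
  by (auto simp: evp_def nrm_ev)

lemma bounded_evp: "bounded_linear_map Bp Fp evp"
  by (rule bounded_linear_mapI[OF evp_linear, where K = 1]) (simp add: nrm_evp)

lemma evp_plus_left: "\<lbrakk>b \<in> carrier B; u \<in> carrier Bp\<rbrakk> \<Longrightarrow> evp (plus_left B b u) = plus_left F (ev b) (evp u)"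
  by (cases u) (simp add: evp_def B.plus_left_eq F.plus_left_eq ev_mem ev_mult B.mult_closed
      linear_map_add[OF ev_linear] linear_map_scale[OF ev_linear])

lemma evp_plus_right: "\<lbrakk>b \<in> carrier B; u \<in> carrier Bp\<rbrakk> \<Longrightarrow> evp (plus_right B u b) = plus_right F (evp u) (ev b)"
  by (cases u) (simp add: evp_def B.plus_right_eq F.plus_right_eq ev_mem ev_mult B.mult_closed
      linear_map_add[OF ev_linear] linear_map_scale[OF ev_linear])

text \<open>A splitting \<open>\<rho>\<close> descends to \<open>\<Phi> \<circ> \<rho> \<circ> \<sigma>\<close>. Neither \<open>\<sigma>\<close> nor \<open>\<tau>\<close> is multiplicative, but
  \<open>\<sigma> (a b) = \<tau> a \<cdot> \<sigma> b\<close> turns the module property of \<open>\<rho>\<close> over \<open>B\<close> into that of the descended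
  map over \<open>F\<close>, because \<open>\<tau> a\<close> is again a preimage of \<open>a\<close>.\<close>

lemma splitting_descends:
  fixes Y :: "'y nspace" and Y' :: "'z nspace"
  assumes Y: "normed_space Y" and \<Phi>: "bounded_linear_map Y Y' \<Phi>"
    and \<Phi>_nrm: "\<forall>w\<in>carrier Y. nrm Y' (\<Phi> w) \<le> nrm Y w"
    and \<Phi>_prod: "\<forall>w\<in>carrier Y. \<pi>' (\<Phi> w) = ev (\<pi> w)"
    and \<rho>: "bounded_linear_map B Y \<rho>" and split: "\<forall>b\<in>carrier B. \<pi> (\<rho> b) = b"
    and bound: "\<forall>b\<in>carrier B. nrm Y (\<rho> b) \<le> K * nrm B b" and "K \<ge> 0"
  shows "bounded_linear_map F Y' (\<lambda>a. \<Phi> (\<rho> (\<sigma> a)))"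
    and "\<forall>a\<in>carrier F. \<pi>' (\<Phi> (\<rho> (\<sigma> a))) = a"
    and "\<forall>a\<in>carrier F. nrm Y' (\<Phi> (\<rho> (\<sigma> a))) \<le> K * nrm F a"
    and "\<lbrakk>\<forall>a\<in>carrier B. \<forall>b\<in>carrier B. \<rho> (a \<otimes>\<^bsub>B\<^esub> b) = l a (\<rho> b);
      \<forall>b\<in>carrier B. \<forall>w\<in>carrier Y. \<Phi> (l b w) = l' (ev b) (\<Phi> w)\<rbrakk> \<Longrightarrow>
      \<forall>a\<in>carrier F. \<forall>b\<in>carrier F. \<Phi> (\<rho> (\<sigma> (a \<otimes>\<^bsub>F\<^esub> b))) = l' a (\<Phi> (\<rho> (\<sigma> b)))"
    and "\<lbrakk>\<forall>a\<in>carrier B. \<forall>b\<in>carrier B. \<rho> (b \<otimes>\<^bsub>B\<^esub> a) = r (\<rho> b) a;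
      \<forall>b\<in>carrier B. \<forall>w\<in>carrier Y. \<Phi> (r w b) = r' (\<Phi> w) (ev b)\<rbrakk> \<Longrightarrow>
      \<forall>a\<in>carrier F. \<forall>b\<in>carrier F. \<Phi> (\<rho> (\<sigma> (b \<otimes>\<^bsub>F\<^esub> a))) = r' (\<Phi> (\<rho> (\<sigma> b))) a"
proof -
  note \<rho>_mem = bounded_linear_map_closed[OF \<rho>]
  show "bounded_linear_map F Y' (\<lambda>a. \<Phi> (\<rho> (\<sigma> a)))"
    by (rule bounded_linear_map_compose[OF nF Y bounded_linear_map_compose[OF nF nB bounded_\<sigma> \<rho>] \<Phi>])
  show "\<forall>a\<in>carrier F. \<pi>' (\<Phi> (\<rho> (\<sigma> a))) = a"
    using split by (simp add: \<Phi>_prod \<rho>_mem \<sigma>_mem ev_\<sigma>)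
  show "\<forall>a\<in>carrier F. nrm Y' (\<Phi> (\<rho> (\<sigma> a))) \<le> K * nrm F a"
  proof
    fix a assume a: "a \<in> carrier F"
    have "nrm Y' (\<Phi> (\<rho> (\<sigma> a))) \<le> K * nrm B (\<sigma> a)"
      using order_trans[OF bspec[OF \<Phi>_nrm \<rho>_mem[OF \<sigma>_mem[OF a]]] bspec[OF bound \<sigma>_mem[OF a]]] .
    also have "\<dots> \<le> K * nrm F a"
      by (intro mult_left_mono nrm_\<sigma> a \<open>K \<ge> 0\<close>)
    finally show "nrm Y' (\<Phi> (\<rho> (\<sigma> a))) \<le> K * nrm F a" .
  qed
  show "\<forall>a\<in>carrier F. \<forall>b\<in>carrier F. \<Phi> (\<rho> (\<sigma> (a \<otimes>\<^bsub>F\<^esub> b))) = l' a (\<Phi> (\<rho> (\<sigma> b)))"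
    if "\<forall>a\<in>carrier B. \<forall>b\<in>carrier B. \<rho> (a \<otimes>\<^bsub>B\<^esub> b) = l a (\<rho> b)"
      "\<forall>b\<in>carrier B. \<forall>w\<in>carrier Y. \<Phi> (l b w) = l' (ev b) (\<Phi> w)"
    using that by (simp add: \<tau>_\<sigma>[symmetric] \<tau>_mem \<sigma>_mem \<rho>_mem ev_\<tau>)
  show "\<forall>a\<in>carrier F. \<forall>b\<in>carrier F. \<Phi> (\<rho> (\<sigma> (b \<otimes>\<^bsub>F\<^esub> a))) = r' (\<Phi> (\<rho> (\<sigma> b))) a"
    if "\<forall>a\<in>carrier B. \<forall>b\<in>carrier B. \<rho> (b \<otimes>\<^bsub>B\<^esub> a) = r (\<rho> b) a"
      "\<forall>b\<in>carrier B. \<forall>w\<in>carrier Y. \<Phi> (r w b) = r' (\<Phi> w) (ev b)"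
    using that by (simp add: \<sigma>_\<tau>[symmetric] \<tau>_mem \<sigma>_mem \<rho>_mem ev_\<tau>)
qed

theorem left_splitting_descends:
  assumes \<rho>: "left_module_morphism B B (mult B) (Bp \<otimes>\<^sub>\<pi> B) (tensor_left_action Bp B (plus_left B)) \<rho>"
    and split: "\<forall>b\<in>carrier B. left_product B (\<rho> b) = b"
    and bound: "\<forall>b\<in>carrier B. nrm (Bp \<otimes>\<^sub>\<pi> B) (\<rho> b) \<le> K * nrm B b" and "K \<ge> 0"
  shows "\<exists>\<rho>'. left_module_morphism F F (mult F) (Fp \<otimes>\<^sub>\<pi> F) (tensor_left_action Fp F (plus_left F)) \<rho>' \<and>
    (\<forall>a\<in>carrier F. left_product F (\<rho>' a) = a) \<and>
    (\<forall>a\<in>carrier F. nrm (Fp \<otimes>\<^sub>\<pi> F) (\<rho>' a) \<le> K * nrm F a)"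
proof -
  let ?\<Phi> = "tensor_map Bp B Fp F evp ev"
  have \<rho>_bl: "bounded_linear_map B (Bp \<otimes>\<^sub>\<pi> B) \<rho>"
    and \<rho>_left: "\<forall>a\<in>carrier B. \<forall>b\<in>carrier B.
      \<rho> (a \<otimes>\<^bsub>B\<^esub> b) = tensor_left_action Bp B (plus_left B) a (\<rho> b)"
    using \<rho> by (auto simp: left_module_morphism_def)
  note \<Phi> = bounded_tensor_map[OF nBp nB nFp nF bounded_evp bounded_ev]
  note N = BpB.EF.normed_completion and N' = FpF.EF.normed_completion
  note comp = bounded_linear_map_compose
  note lB = BpB.left_action[OF B.left_module_unitization]
    and lF = FpF.left_action[OF F.left_module_unitization]
  have \<Phi>_nrm: "\<forall>w\<in>carrier (Bp \<otimes>\<^sub>\<pi> B). nrm (Fp \<otimes>\<^sub>\<pi> F) (?\<Phi> w) \<le> nrm (Bp \<otimes>\<^sub>\<pi> B) w"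
    using nrm_tensor_map_le[OF nBp nB nFp nF evp_linear _ zero_le_one ev_linear _ zero_le_one]
    by (simp add: nrm_evp nrm_ev)
  have \<Phi>_left: "\<forall>b\<in>carrier B. \<forall>w\<in>carrier (Bp \<otimes>\<^sub>\<pi> B). ?\<Phi> (tensor_left_action Bp B (plus_left B) b w) =
      tensor_left_action Fp F (plus_left F) (ev b) (?\<Phi> w)"
  proof (intro ballI)
    fix b w assume b: "b \<in> carrier B" and w: "w \<in> carrier (Bp \<otimes>\<^sub>\<pi> B)"
    show "?\<Phi> (tensor_left_action Bp B (plus_left B) b w) =
      tensor_left_action Fp F (plus_left F) (ev b) (?\<Phi> w)"
      by (rule BpB.EF.ptensor_eqI[OF N' comp[OF N N lB(1)[OF b] \<Phi>(1)]
            comp[OF N N' \<Phi>(1) lF(1)[OF ev_mem[OF b]]] _ w])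
        (simp add: lB(2)[OF b] \<Phi>(2) lF(2)[OF ev_mem[OF b]] evp_plus_left[OF b] ev_mem
          linear_map_closed[OF evp_linear]
          bilinear_map_closed[OF left_banach_moduleD(3)[OF B.left_module_unitization] b]
          del: B.unitization_simps(1) F.unitization_simps(1))
  qed
  have \<Phi>_prod: "\<forall>w\<in>carrier (Bp \<otimes>\<^sub>\<pi> B). left_product F (?\<Phi> w) = ev (left_product B w)"
    by (intro ballI, rule BpB.EF.ptensor_eqI[OF nF comp[OF N N' \<Phi>(1) F.bounded_left_product]
          comp[OF N nB B.bounded_left_product bounded_ev] _])
      (auto simp: \<Phi>(2) evp_def ev_mem B.left_product_pure F.left_product_pure B.mult_closed ev_mult
        linear_map_add[OF ev_linear] linear_map_scale[OF ev_linear])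
  note desc = splitting_descends[OF N \<Phi>(1) \<Phi>_nrm \<Phi>_prod \<rho>_bl split bound \<open>K \<ge> 0\<close>]
  show ?thesis
    unfolding bimodule_morphism_def left_module_morphism_def right_module_morphism_def
    by (intro exI[of _ "\<lambda>a. ?\<Phi> (\<rho> (\<sigma> a))"] conjI desc(1-3) desc(4)[OF \<rho>_left \<Phi>_left])
qed

theorem right_splitting_descends:
  assumes \<rho>: "right_module_morphism B B (mult B) (B \<otimes>\<^sub>\<pi> Bp) (tensor_right_action B Bp (plus_right B)) \<rho>"
    and split: "\<forall>b\<in>carrier B. right_product B (\<rho> b) = b"
    and bound: "\<forall>b\<in>carrier B. nrm (B \<otimes>\<^sub>\<pi> Bp) (\<rho> b) \<le> K * nrm B b" and "K \<ge> 0"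
  shows "\<exists>\<rho>'. right_module_morphism F F (mult F) (F \<otimes>\<^sub>\<pi> Fp) (tensor_right_action F Fp (plus_right F)) \<rho>' \<and>
    (\<forall>a\<in>carrier F. right_product F (\<rho>' a) = a) \<and>
    (\<forall>a\<in>carrier F. nrm (F \<otimes>\<^sub>\<pi> Fp) (\<rho>' a) \<le> K * nrm F a)"
proof -
  let ?\<Phi> = "tensor_map B Bp F Fp ev evp"
  have \<rho>_bl: "bounded_linear_map B (B \<otimes>\<^sub>\<pi> Bp) \<rho>"
    and \<rho>_right: "\<forall>a\<in>carrier B. \<forall>b\<in>carrier B.
      \<rho> (b \<otimes>\<^bsub>B\<^esub> a) = tensor_right_action B Bp (plus_right B) (\<rho> b) a"
    using \<rho> by (auto simp: right_module_morphism_def)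
  note \<Phi> = bounded_tensor_map[OF nB nBp nF nFp bounded_ev bounded_evp]
  note N = BBp.EF.normed_completion and N' = FFp.EF.normed_completion
  note comp = bounded_linear_map_compose
  note rB = BBp.right_action[OF B.right_module_unitization]
    and rF = FFp.right_action[OF F.right_module_unitization]
  have \<Phi>_nrm: "\<forall>w\<in>carrier (B \<otimes>\<^sub>\<pi> Bp). nrm (F \<otimes>\<^sub>\<pi> Fp) (?\<Phi> w) \<le> nrm (B \<otimes>\<^sub>\<pi> Bp) w"
    using nrm_tensor_map_le[OF nB nBp nF nFp ev_linear _ zero_le_one evp_linear _ zero_le_one]
    by (simp add: nrm_evp nrm_ev)
  have \<Phi>_right: "\<forall>b\<in>carrier B. \<forall>w\<in>carrier (B \<otimes>\<^sub>\<pi> Bp). ?\<Phi> (tensor_right_action B Bp (plus_right B) w b) =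
      tensor_right_action F Fp (plus_right F) (?\<Phi> w) (ev b)"
  proof (intro ballI)
    fix b w assume b: "b \<in> carrier B" and w: "w \<in> carrier (B \<otimes>\<^sub>\<pi> Bp)"
    show "?\<Phi> (tensor_right_action B Bp (plus_right B) w b) =
      tensor_right_action F Fp (plus_right F) (?\<Phi> w) (ev b)"
      by (rule BBp.EF.ptensor_eqI[OF N' comp[OF N N rB(1)[OF b] \<Phi>(1)]
            comp[OF N N' \<Phi>(1) rF(1)[OF ev_mem[OF b]]] _ w])
        (simp add: rB(2)[OF b] \<Phi>(2) rF(2)[OF ev_mem[OF b]] evp_plus_right[OF b] ev_mem
          linear_map_closed[OF evp_linear]
          bilinear_map_closed[OF right_banach_moduleD(3)[OF B.right_module_unitization] _ b]
          del: B.unitization_simps(1) F.unitization_simps(1))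
  qed
  have \<Phi>_prod: "\<forall>w\<in>carrier (B \<otimes>\<^sub>\<pi> Bp). right_product F (?\<Phi> w) = ev (right_product B w)"
    by (intro ballI, rule BBp.EF.ptensor_eqI[OF nF comp[OF N N' \<Phi>(1) F.bounded_right_product]
          comp[OF N nB B.bounded_right_product bounded_ev] _])
      (auto simp: \<Phi>(2) evp_def ev_mem B.right_product_pure F.right_product_pure B.mult_closed ev_mult
        linear_map_add[OF ev_linear] linear_map_scale[OF ev_linear])
  note desc = splitting_descends[OF N \<Phi>(1) \<Phi>_nrm \<Phi>_prod \<rho>_bl split bound \<open>K \<ge> 0\<close>]
  show ?thesis
    unfolding bimodule_morphism_def left_module_morphism_def right_module_morphism_def
    by (intro exI[of _ "\<lambda>a. ?\<Phi> (\<rho> (\<sigma> a))"] conjI desc(1-3) desc(5)[OF \<rho>_right \<Phi>_right])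
qed

theorem bimodule_splitting_descends:
  assumes \<rho>: "bimodule_morphism B B (mult B) (mult B) (B \<otimes>\<^sub>\<pi> B)
      (tensor_left_action B B (mult B)) (tensor_right_action B B (mult B)) \<rho>"
    and split: "\<forall>b\<in>carrier B. bi_product B (\<rho> b) = b"
    and bound: "\<forall>b\<in>carrier B. nrm (B \<otimes>\<^sub>\<pi> B) (\<rho> b) \<le> K * nrm B b" and "K \<ge> 0"
  shows "\<exists>\<rho>'. bimodule_morphism F F (mult F) (mult F) (F \<otimes>\<^sub>\<pi> F)
      (tensor_left_action F F (mult F)) (tensor_right_action F F (mult F)) \<rho>' \<and>
    (\<forall>a\<in>carrier F. bi_product F (\<rho>' a) = a) \<and>
    (\<forall>a\<in>carrier F. nrm (F \<otimes>\<^sub>\<pi> F) (\<rho>' a) \<le> K * nrm F a)"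
proof -
  let ?\<Phi> = "tensor_map B B F F ev ev"
  have \<rho>_bl: "bounded_linear_map B (B \<otimes>\<^sub>\<pi> B) \<rho>"
    and \<rho>_left: "\<forall>a\<in>carrier B. \<forall>b\<in>carrier B.
      \<rho> (a \<otimes>\<^bsub>B\<^esub> b) = tensor_left_action B B (mult B) a (\<rho> b)"
    and \<rho>_right: "\<forall>a\<in>carrier B. \<forall>b\<in>carrier B.
      \<rho> (b \<otimes>\<^bsub>B\<^esub> a) = tensor_right_action B B (mult B) (\<rho> b) a"
    using \<rho> by (auto simp: bimodule_morphism_def left_module_morphism_def right_module_morphism_def)
  note \<Phi> = bounded_tensor_map[OF nB nB nF nF bounded_ev bounded_ev]
  note N = BB.EF.normed_completion and N' = FF.EF.normed_completion
  note comp = bounded_linear_map_compose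
  note lB = BB.left_action[OF B.left_banach_module_self]
    and lF = FF.left_action[OF F.left_banach_module_self]
  note rB = BB.right_action[OF B.right_banach_module_self]
    and rF = FF.right_action[OF F.right_banach_module_self]
  have \<Phi>_nrm: "\<forall>w\<in>carrier (B \<otimes>\<^sub>\<pi> B). nrm (F \<otimes>\<^sub>\<pi> F) (?\<Phi> w) \<le> nrm (B \<otimes>\<^sub>\<pi> B) w"
    using nrm_tensor_map_le[OF nB nB nF nF ev_linear _ zero_le_one ev_linear _ zero_le_one]
    by (simp add: nrm_ev)
  have \<Phi>_left: "\<forall>b\<in>carrier B. \<forall>w\<in>carrier (B \<otimes>\<^sub>\<pi> B). ?\<Phi> (tensor_left_action B B (mult B) b w) =
      tensor_left_action F F (mult F) (ev b) (?\<Phi> w)"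
  proof (intro ballI)
    fix b w assume b: "b \<in> carrier B" and w: "w \<in> carrier (B \<otimes>\<^sub>\<pi> B)"
    show "?\<Phi> (tensor_left_action B B (mult B) b w) =
      tensor_left_action F F (mult F) (ev b) (?\<Phi> w)"
      by (rule BB.EF.ptensor_eqI[OF N' comp[OF N N lB(1)[OF b] \<Phi>(1)]
            comp[OF N N' \<Phi>(1) lF(1)[OF ev_mem[OF b]]] _ w])
        (simp add: lB(2)[OF b] \<Phi>(2) lF(2)[OF ev_mem[OF b]] ev_mem ev_mult b B.mult_closed)
  qed
  have \<Phi>_right: "\<forall>b\<in>carrier B. \<forall>w\<in>carrier (B \<otimes>\<^sub>\<pi> B). ?\<Phi> (tensor_right_action B B (mult B) w b) =
      tensor_right_action F F (mult F) (?\<Phi> w) (ev b)"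
  proof (intro ballI)
    fix b w assume b: "b \<in> carrier B" and w: "w \<in> carrier (B \<otimes>\<^sub>\<pi> B)"
    show "?\<Phi> (tensor_right_action B B (mult B) w b) =
      tensor_right_action F F (mult F) (?\<Phi> w) (ev b)"
      by (rule BB.EF.ptensor_eqI[OF N' comp[OF N N rB(1)[OF b] \<Phi>(1)]
            comp[OF N N' \<Phi>(1) rF(1)[OF ev_mem[OF b]]] _ w])
        (simp add: rB(2)[OF b] \<Phi>(2) rF(2)[OF ev_mem[OF b]] ev_mem ev_mult b B.mult_closed)
  qed
  have \<Phi>_prod: "\<forall>w\<in>carrier (B \<otimes>\<^sub>\<pi> B). bi_product F (?\<Phi> w) = ev (bi_product B w)"
    by (intro ballI, rule BB.EF.ptensor_eqI[OF nF comp[OF N N' \<Phi>(1) F.bounded_bi_product]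
          comp[OF N nB B.bounded_bi_product bounded_ev] _])
      (simp add: \<Phi>(2) ev_mem B.bi_product_pure F.bi_product_pure ev_mult)
  note desc = splitting_descends[OF N \<Phi>(1) \<Phi>_nrm \<Phi>_prod \<rho>_bl split bound \<open>K \<ge> 0\<close>]
  show ?thesis
    unfolding bimodule_morphism_def left_module_morphism_def right_module_morphism_def
    by (intro exI[of _ "\<lambda>a. ?\<Phi> (\<rho> (\<sigma> a))"] conjI desc(1-3) desc(4)[OF \<rho>_left \<Phi>_left] desc(5)[OF \<rho>_right \<Phi>_right])
qed

end


section \<open>The Banach algebra of a continuous field\<close>

lemma vanishes_at_infinity_dominated:
  assumes f: "vanishes_at_infinity X f" and g: "vanishes_at_infinity X g" and "M \<ge> 0"
    and le: "\<And>t. t \<in> topspace X \<Longrightarrow> \<bar>h t\<bar> \<le> M * (\<bar>f t\<bar> + \<bar>g t\<bar>)"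
  shows "vanishes_at_infinity X h"
  unfolding vanishes_at_infinity_def
proof (intro allI impI)
  fix \<epsilon> :: real assume "\<epsilon> > 0"
  then have e: "\<epsilon> / (M + 1) / 2 > 0" using \<open>M \<ge> 0\<close> by simp
  obtain K where K: "compactin X K" "\<forall>t\<in>topspace X - K. \<bar>f t\<bar> < \<epsilon> / (M + 1) / 2"
    using f e unfolding vanishes_at_infinity_def by blast
  obtain L where L: "compactin X L" "\<forall>t\<in>topspace X - L. \<bar>g t\<bar> < \<epsilon> / (M + 1) / 2"
    using g e unfolding vanishes_at_infinity_def by blast
  have "\<bar>h t\<bar> < \<epsilon>" if t: "t \<in> topspace X - (K \<union> L)" for t
  proof -
    have "\<bar>f t\<bar> < \<epsilon> / (M + 1) / 2" "\<bar>g t\<bar> < \<epsilon> / (M + 1) / 2"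
      using K(2) L(2) t by auto
    then have "\<bar>f t\<bar> + \<bar>g t\<bar> < \<epsilon> / (M + 1)" by linarith
    then have "(M + 1) * (\<bar>f t\<bar> + \<bar>g t\<bar>) < \<epsilon>"
      using \<open>M \<ge> 0\<close> by (simp add: field_simps)
    moreover have "M * (\<bar>f t\<bar> + \<bar>g t\<bar>) \<le> (M + 1) * (\<bar>f t\<bar> + \<bar>g t\<bar>)"
      by (intro mult_right_mono) auto
    ultimately show ?thesis using le[of t] t by simp
  qed
  then show "\<exists>K. compactin X K \<and> (\<forall>t\<in>topspace X - K. \<bar>h t\<bar> < \<epsilon>)"
    using compactin_Un[OF K(1) L(1)] by blast
qed

locale cfield =
  fixes \<U> :: "('x, 'a) field_data"
  assumes continuous_field: "continuous_field \<U>"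
begin

abbreviation "X \<equiv> base \<U>"
abbreviation "A \<equiv> fibre \<U>"
abbreviation "\<Theta> \<equiv> sections \<U>"
abbreviation "\<Omega> \<equiv> topspace (base \<U>)"
abbreviation "\<A> \<equiv> field_algebra \<U>"

lemma fibre_algebra: "t \<in> \<Omega> \<Longrightarrow> banach_algebra (A t)"
  and locally_compact: "locally_compact_space X"
  and Hausdorff: "Hausdorff_space X"
  and dense_sections: "\<lbrakk>t \<in> \<Omega>; a \<in> carrier (A t); \<epsilon> > 0\<rbrakk> \<Longrightarrow> \<exists>x\<in>\<Theta>. ndist (A t) (x t) a < \<epsilon>"
  and continuous_nrm: "x \<in> \<Theta> \<Longrightarrow> continuous_map X euclideanreal (\<lambda>t. nrm (A t) (x t))"
  and sections_local: "\<lbrakk>x \<in> (\<Pi>\<^sub>E t\<in>\<Omega>. carrier (A t)); locally_approximable X A \<Theta> \<Omega> x\<rbrakk> \<Longrightarrow> x \<in> \<Theta>"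
  using continuous_field by (simp_all add: continuous_field_def Let_def product_algebra_def)

lemma fibre_normed: "t \<in> \<Omega> \<Longrightarrow> normed_space (A t)"
  by (intro normed_banach banach_algebra.axioms fibre_algebra)

lemma fibre_abelian: "t \<in> \<Omega> \<Longrightarrow> abelian_monoid (A t)"
  by (rule abelian_group.axioms[OF module.axioms(2)[OF normed_space.axioms(1)[OF fibre_normed]]])

lemma sections_subalgebra: "subalgebra_set \<Omega> A \<Theta>"
  using continuous_field by (simp add: continuous_field_def Let_def)

lemma sections_PiE: "x \<in> \<Theta> \<Longrightarrow> x \<in> (\<Pi>\<^sub>E t\<in>\<Omega>. carrier (A t))"
  and sections_zero: "(\<lambda>t\<in>\<Omega>. \<zero>\<^bsub>A t\<^esub>) \<in> \<Theta>"
  and sections_add: "\<lbrakk>x \<in> \<Theta>; y \<in> \<Theta>\<rbrakk> \<Longrightarrow> (\<lambda>t\<in>\<Omega>. x t \<oplus>\<^bsub>A t\<^esub> y t) \<in> \<Theta>"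
  and sections_mult: "\<lbrakk>x \<in> \<Theta>; y \<in> \<Theta>\<rbrakk> \<Longrightarrow> (\<lambda>t\<in>\<Omega>. x t \<otimes>\<^bsub>A t\<^esub> y t) \<in> \<Theta>"
  and sections_scale: "x \<in> \<Theta> \<Longrightarrow> (\<lambda>t\<in>\<Omega>. c \<odot>\<^bsub>A t\<^esub> x t) \<in> \<Theta>"
  using sections_subalgebra by (auto simp: subalgebra_set_def product_algebra_def)

lemma field_algebra_simps [simp]:
  "carrier \<A> = {x \<in> \<Theta>. vanishes_at_infinity X (\<lambda>t. nrm (A t) (x t))}"
  "x \<oplus>\<^bsub>\<A>\<^esub> y = (\<lambda>t\<in>\<Omega>. x t \<oplus>\<^bsub>A t\<^esub> y t)"
  "x \<otimes>\<^bsub>\<A>\<^esub> y = (\<lambda>t\<in>\<Omega>. x t \<otimes>\<^bsub>A t\<^esub> y t)"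
  "c \<odot>\<^bsub>\<A>\<^esub> x = (\<lambda>t\<in>\<Omega>. c \<odot>\<^bsub>A t\<^esub> x t)"
  "\<zero>\<^bsub>\<A>\<^esub> = (\<lambda>t\<in>\<Omega>. \<zero>\<^bsub>A t\<^esub>)"
  by (simp_all add: field_algebra_def Let_def product_algebra_def)

lemma nrm_field_algebra: "nrm \<A> x = Sup (insert 0 ((\<lambda>t. nrm (A t) (x t)) ` \<Omega>))"
  by (simp add: field_algebra_def Let_def)

lemma section_mem: "x \<in> \<Theta> \<Longrightarrow> t \<in> \<Omega> \<Longrightarrow> x t \<in> carrier (A t)"
  using sections_PiE by blast

lemma section_eqI:
  assumes "x \<in> \<Theta>" "y \<in> \<Theta>" "\<And>t. t \<in> \<Omega> \<Longrightarrow> x t = y t"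
  shows "x = y"
  by (rule PiE_ext[OF sections_PiE sections_PiE]) (use assms in auto)

text \<open>The norm function of a section is bounded on a compact set by continuity, and off a suitable
  compact set because it vanishes at infinity.\<close>

lemma bdd_above_nrm:
  assumes x: "x \<in> carrier \<A>"
  shows "bdd_above (insert 0 ((\<lambda>t. nrm (A t) (x t)) ` \<Omega>))"
proof -
  have v: "vanishes_at_infinity X (\<lambda>t. nrm (A t) (x t))" and "x \<in> \<Theta>" using x by auto
  obtain K where K: "compactin X K" "\<forall>t\<in>\<Omega> - K. \<bar>nrm (A t) (x t)\<bar> < 1"
    using v[unfolded vanishes_at_infinity_def, rule_format, of 1] by auto
  have "compactin euclideanreal ((\<lambda>t. nrm (A t) (x t)) ` K)"
    by (rule image_compactin[OF K(1) continuous_nrm[OF \<open>x \<in> \<Theta>\<close>]])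
  then have "bdd_above ((\<lambda>t. nrm (A t) (x t)) ` K)"
    by (simp add: compact_imp_bounded bounded_imp_bdd_above)
  moreover have "bdd_above ((\<lambda>t. nrm (A t) (x t)) ` (\<Omega> - K))"
    by (rule bdd_aboveI2[of _ _ 1]) (use K(2) in \<open>auto simp: abs_less_iff intro: less_imp_le\<close>)
  ultimately have "bdd_above ((\<lambda>t. nrm (A t) (x t)) ` (K \<union> (\<Omega> - K)))"
    unfolding image_Un by (simp only: bdd_above_Un)
  then have "bdd_above ((\<lambda>t. nrm (A t) (x t)) ` \<Omega>)"
    by (rule bdd_above_mono) auto
  then show ?thesis by simp
qed

lemma nrm_pointwise_le: "\<lbrakk>x \<in> carrier \<A>; t \<in> \<Omega>\<rbrakk> \<Longrightarrow> nrm (A t) (x t) \<le> nrm \<A> x"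
  unfolding nrm_field_algebra by (rule cSup_upper[OF _ bdd_above_nrm]) auto

lemma nrm_field_nonneg: "x \<in> carrier \<A> \<Longrightarrow> 0 \<le> nrm \<A> x"
  unfolding nrm_field_algebra by (rule cSup_upper[OF _ bdd_above_nrm]) auto

lemma nrm_field_le: "0 \<le> c \<Longrightarrow> (\<And>t. t \<in> \<Omega> \<Longrightarrow> nrm (A t) (x t) \<le> c) \<Longrightarrow> nrm \<A> x \<le> c"
  unfolding nrm_field_algebra by (rule cSup_least) auto

lemma field_add_closed:
  assumes "x \<in> carrier \<A>" "y \<in> carrier \<A>"
  shows "x \<oplus>\<^bsub>\<A>\<^esub> y \<in> carrier \<A>"
proof -
  have xy: "x \<in> \<Theta>" "y \<in> \<Theta>" using assms by auto
  have "vanishes_at_infinity X (\<lambda>t. nrm (A t) ((x \<oplus>\<^bsub>\<A>\<^esub> y) t))"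
  proof (rule vanishes_at_infinity_dominated[OF _ _ zero_le_one])
    fix t assume t: "t \<in> \<Omega>"
    interpret At: normed_space "A t" by (rule fibre_normed[OF t])
    show "\<bar>nrm (A t) ((x \<oplus>\<^bsub>\<A>\<^esub> y) t)\<bar> \<le> 1 * (\<bar>nrm (A t) (x t)\<bar> + \<bar>nrm (A t) (y t)\<bar>)"
      using At.nrm_triangle[OF section_mem[OF xy(1) t] section_mem[OF xy(2) t]] t
        section_mem[OF xy(1) t] section_mem[OF xy(2) t] by simp
  qed (use assms in auto)
  then show ?thesis using sections_add[OF xy] by simp
qed

lemma field_scale_closed:
  assumes "x \<in> carrier \<A>"
  shows "c \<odot>\<^bsub>\<A>\<^esub> x \<in> carrier \<A>"
proof -
  have x: "x \<in> \<Theta>" using assms by auto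
  have "vanishes_at_infinity X (\<lambda>t. nrm (A t) ((c \<odot>\<^bsub>\<A>\<^esub> x) t))"
  proof (rule vanishes_at_infinity_dominated[OF _ _ norm_ge_zero[of c]])
    fix t assume t: "t \<in> \<Omega>"
    interpret At: normed_space "A t" by (rule fibre_normed[OF t])
    show "\<bar>nrm (A t) ((c \<odot>\<^bsub>\<A>\<^esub> x) t)\<bar> \<le> cmod c * (\<bar>nrm (A t) (x t)\<bar> + \<bar>nrm (A t) (x t)\<bar>)"
      using section_mem[OF x t] t by (simp add: At.nrm_smult abs_mult mult_left_mono)
  qed (use assms in auto)
  then show ?thesis using sections_scale[OF x] by simp
qed

lemma field_mult_closed:
  assumes "x \<in> carrier \<A>" "y \<in> carrier \<A>"
  shows "x \<otimes>\<^bsub>\<A>\<^esub> y \<in> carrier \<A>"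
proof -
  have xy: "x \<in> \<Theta>" "y \<in> \<Theta>" using assms by auto
  have "vanishes_at_infinity X (\<lambda>t. nrm (A t) ((x \<otimes>\<^bsub>\<A>\<^esub> y) t))"
  proof (rule vanishes_at_infinity_dominated[OF _ _ nrm_field_nonneg[OF assms(1)]])
    fix t assume t: "t \<in> \<Omega>"
    interpret At: banach_algebra "A t" by (rule fibre_algebra[OF t])
    note m = section_mem[OF xy(1) t] section_mem[OF xy(2) t]
    have "nrm (A t) (x t \<otimes>\<^bsub>A t\<^esub> y t) \<le> nrm (A t) (x t) * nrm (A t) (y t)"
      by (rule At.nrm_mult_le[OF m])
    also have "\<dots> \<le> nrm \<A> x * nrm (A t) (y t)"
      using m by (intro mult_right_mono nrm_pointwise_le assms t) simp
    also have "\<dots> \<le> nrm \<A> x * (\<bar>nrm (A t) (y t)\<bar> + \<bar>nrm (A t) (y t)\<bar>)"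
      by (intro mult_left_mono nrm_field_nonneg assms) simp
    finally show "\<bar>nrm (A t) ((x \<otimes>\<^bsub>\<A>\<^esub> y) t)\<bar> \<le>
        nrm \<A> x * (\<bar>nrm (A t) (y t)\<bar> + \<bar>nrm (A t) (y t)\<bar>)"
      using m t by (simp add: At.mult_closed)
  qed (use assms in auto)
  then show ?thesis using sections_mult[OF xy] by simp
qed

lemma field_zero_closed: "\<zero>\<^bsub>\<A>\<^esub> \<in> carrier \<A>"
proof -
  have "vanishes_at_infinity X (\<lambda>t. nrm (A t) ((\<lambda>t\<in>\<Omega>. \<zero>\<^bsub>A t\<^esub>) t))"
    unfolding vanishes_at_infinity_def
    by (auto intro!: exI[of _ "{}"] simp: normed_space.nrm_zero[OF fibre_normed])
  then show ?thesis using sections_zero by simp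
qed

lemma normed_field_algebra: "normed_space \<A>"
proof -
  have ext: "x = y" if "x \<in> carrier \<A>" "y \<in> carrier \<A>" "\<And>t. t \<in> \<Omega> \<Longrightarrow> x t = y t" for x y
    by (rule section_eqI) (use that in auto)
  have mem: "x t \<in> carrier (A t)" if "x \<in> carrier \<A>" "t \<in> \<Omega>" for x t
    using that section_mem by auto
  note closed = field_add_closed field_scale_closed field_zero_closed
  show ?thesis
  proof (rule normed_spaceI)
    fix x y z and c d
    assume x: "x \<in> carrier \<A>"
    show "c \<odot>\<^bsub>\<A>\<^esub> x \<in> carrier \<A>" by (intro closed x)
    show "\<zero>\<^bsub>\<A>\<^esub> \<oplus>\<^bsub>\<A>\<^esub> x = x"
      by (rule ext) (intro closed x | simp add: mem[OF x] abelian_monoid.l_zero[OF fibre_abelian])+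
    show "(c + d) \<odot>\<^bsub>\<A>\<^esub> x = c \<odot>\<^bsub>\<A>\<^esub> x \<oplus>\<^bsub>\<A>\<^esub> d \<odot>\<^bsub>\<A>\<^esub> x"
      by (rule ext) (intro closed x | simp add: mem[OF x] normed_space.scale_left_distrib[OF fibre_normed])+
    show "(c * d) \<odot>\<^bsub>\<A>\<^esub> x = c \<odot>\<^bsub>\<A>\<^esub> (d \<odot>\<^bsub>\<A>\<^esub> x)"
      by (rule ext) (intro closed x | simp add: mem[OF x] normed_space.scale_scale[OF fibre_normed])+
    show "1 \<odot>\<^bsub>\<A>\<^esub> x = x"
      by (rule ext) (intro closed x | simp add: mem[OF x] normed_space.one_smult[OF fibre_normed])+
    show "0 \<odot>\<^bsub>\<A>\<^esub> x = \<zero>\<^bsub>\<A>\<^esub>"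
      by (rule ext) (intro closed x | simp add: mem[OF x] normed_space.zero_smult[OF fibre_normed])+
    show "x = \<zero>\<^bsub>\<A>\<^esub>" if nz: "nrm \<A> x = 0"
    proof (rule ext)
      fix t assume t: "t \<in> \<Omega>"
      interpret At: normed_space "A t" by (rule fibre_normed[OF t])
      have "nrm (A t) (x t) = 0"
        using nrm_pointwise_le[OF x t] At.nrm_nonneg[OF mem[OF x t]] nz by simp
      then show "x t = \<zero>\<^bsub>\<A>\<^esub> t" using t mem[OF x t] by (simp add: At.nrm_eq_0_iff)
    qed (intro closed x)+
    have scale_le: "nrm \<A> (c \<odot>\<^bsub>\<A>\<^esub> x) \<le> cmod c * nrm \<A> x" if x: "x \<in> carrier \<A>" for c x
    proof (rule nrm_field_le)
      fix t assume t: "t \<in> \<Omega>"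
      interpret At: normed_space "A t" by (rule fibre_normed[OF t])
      show "nrm (A t) ((c \<odot>\<^bsub>\<A>\<^esub> x) t) \<le> cmod c * nrm \<A> x"
        using t mem[OF x t] nrm_pointwise_le[OF x t] by (simp add: At.nrm_smult mult_left_mono)
    qed (use nrm_field_nonneg[OF x] in simp)
    show "nrm \<A> (c \<odot>\<^bsub>\<A>\<^esub> x) = cmod c * nrm \<A> x"
    proof (cases "c = 0")
      case True
      then show ?thesis
        using scale_le[OF x, of 0] nrm_field_nonneg[OF field_scale_closed[OF x, of 0]] by simp
    next
      case False
      have "inverse c \<odot>\<^bsub>\<A>\<^esub> (c \<odot>\<^bsub>\<A>\<^esub> x) = x"
      proof (rule ext)
        fix t assume t: "t \<in> \<Omega>"
        interpret At: normed_space "A t" by (rule fibre_normed[OF t])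
        show "(inverse c \<odot>\<^bsub>\<A>\<^esub> (c \<odot>\<^bsub>\<A>\<^esub> x)) t = x t"
          using t mem[OF x t] False by (simp add: At.scale_scale)
      qed (intro closed x)+
      then have "nrm \<A> x \<le> cmod (inverse c) * nrm \<A> (c \<odot>\<^bsub>\<A>\<^esub> x)"
        using scale_le[OF field_scale_closed[OF x], of "inverse c" c] by simp
      then have "cmod c * nrm \<A> x \<le> nrm \<A> (c \<odot>\<^bsub>\<A>\<^esub> x)"
        using False by (simp add: norm_divide field_simps)
      then show ?thesis using scale_le[OF x, of c] by simp
    qed
    assume y: "y \<in> carrier \<A>"
    show "x \<oplus>\<^bsub>\<A>\<^esub> y \<in> carrier \<A>" by (intro closed x y)
    show "x \<oplus>\<^bsub>\<A>\<^esub> y = y \<oplus>\<^bsub>\<A>\<^esub> x"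
      by (rule ext) (intro closed x y | simp add: mem[OF x] mem[OF y] abelian_monoid.a_comm[OF fibre_abelian])+
    show "c \<odot>\<^bsub>\<A>\<^esub> (x \<oplus>\<^bsub>\<A>\<^esub> y) = c \<odot>\<^bsub>\<A>\<^esub> x \<oplus>\<^bsub>\<A>\<^esub> c \<odot>\<^bsub>\<A>\<^esub> y"
      by (rule ext) (intro closed x y | simp add: mem[OF x] mem[OF y] normed_space.scale_right_distrib[OF fibre_normed])+
    show "nrm \<A> (x \<oplus>\<^bsub>\<A>\<^esub> y) \<le> nrm \<A> x + nrm \<A> y"
    proof (rule nrm_field_le)
      fix t assume t: "t \<in> \<Omega>"
      interpret At: normed_space "A t" by (rule fibre_normed[OF t])
      show "nrm (A t) ((x \<oplus>\<^bsub>\<A>\<^esub> y) t) \<le> nrm \<A> x + nrm \<A> y"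
        using t At.nrm_triangle[OF mem[OF x t] mem[OF y t]] nrm_pointwise_le[OF x t]
          nrm_pointwise_le[OF y t] by simp
    qed (use nrm_field_nonneg[OF x] nrm_field_nonneg[OF y] in simp)
    assume z: "z \<in> carrier \<A>"
    show "x \<oplus>\<^bsub>\<A>\<^esub> y \<oplus>\<^bsub>\<A>\<^esub> z = x \<oplus>\<^bsub>\<A>\<^esub> (y \<oplus>\<^bsub>\<A>\<^esub> z)"
      by (rule ext) (intro closed x y z | simp add: mem[OF x] mem[OF y] mem[OF z] abelian_monoid.a_assoc[OF fibre_abelian])+
  qed (rule field_zero_closed)
qed

lemma field_diff:
  assumes "x \<in> carrier \<A>" "y \<in> carrier \<A>" "t \<in> \<Omega>"
  shows "(x \<ominus>\<^bsub>\<A>\<^esub> y) t = x t \<ominus>\<^bsub>A t\<^esub> y t"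
  using assms section_mem[of _ t] normed_space.diff_eq[OF normed_field_algebra assms(1,2)]
    normed_space.diff_eq[OF fibre_normed[OF assms(3)], of "x t" "y t"] by simp

text \<open>The limit of a Cauchy sequence is formed in each fibre. It is uniformly approximated by the terms
  of the sequence, so it is a section by the locality axiom of the field.\<close>

lemma banach_field_algebra: "banach_space \<A>"
proof (rule banach_spaceI[OF normed_field_algebra])
  interpret N: normed_space \<A> by (rule normed_field_algebra)
  fix s :: "nat \<Rightarrow> 'x \<Rightarrow> 'a"
  assume rng: "range s \<subseteq> carrier \<A>"
    and Cauchy: "\<forall>\<epsilon>>0. \<exists>N. \<forall>m\<ge>N. \<forall>n\<ge>N. nrm \<A> (s m \<ominus>\<^bsub>\<A>\<^esub> s n) < \<epsilon>"
  have s: "s n \<in> carrier \<A>" for n using rng by blast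
  have s_mem: "s n t \<in> carrier (A t)" if "t \<in> \<Omega>" for n t using s[of n] section_mem that by auto
  have unif: "\<exists>N. \<forall>m\<ge>N. \<forall>n\<ge>N. \<forall>t\<in>\<Omega>. nrm (A t) (s m t \<ominus>\<^bsub>A t\<^esub> s n t) < \<epsilon>" if "\<epsilon> > 0" for \<epsilon>
  proof -
    obtain N where N: "\<forall>m\<ge>N. \<forall>n\<ge>N. nrm \<A> (s m \<ominus>\<^bsub>\<A>\<^esub> s n) < \<epsilon>" using Cauchy \<open>\<epsilon> > 0\<close> by blast
    have "nrm (A t) (s m t \<ominus>\<^bsub>A t\<^esub> s n t) < \<epsilon>" if "m \<ge> N" "n \<ge> N" "t \<in> \<Omega>" for m n t
      using nrm_pointwise_le[OF N.minus_closed[OF s s] that(3), of m n] N that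
      unfolding field_diff[OF s s that(3)] by force
    then show ?thesis by blast
  qed
  have "\<exists>a\<in>carrier (A t). normed_space.converges (A t) (\<lambda>n. s n t) a" if t: "t \<in> \<Omega>" for t
  proof -
    interpret At: banach_algebra "A t" by (rule fibre_algebra[OF t])
    have rng: "range (\<lambda>n. s n t) \<subseteq> carrier (A t)" using s_mem[OF t] by auto
    have C: "\<forall>\<epsilon>>0. \<exists>N. \<forall>m\<ge>N. \<forall>n\<ge>N. nrm (A t) (s m t \<ominus>\<^bsub>A t\<^esub> s n t) < \<epsilon>" using unif t by blast
    show ?thesis by (rule At.Cauchy_converges[OF rng C]) blast
  qed
  then obtain a where a: "\<forall>t\<in>\<Omega>. a t \<in> carrier (A t) \<and> normed_space.converges (A t) (\<lambda>n. s n t) (a t)"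
    by metis
  define y where "y = restrict a \<Omega>"
  have y_mem: "y t \<in> carrier (A t)" if "t \<in> \<Omega>" for t using a that by (simp add: y_def)
  have lim: "\<exists>N. \<forall>m\<ge>N. \<forall>t\<in>\<Omega>. nrm (A t) (s m t \<ominus>\<^bsub>A t\<^esub> y t) \<le> \<epsilon>" if e: "\<epsilon> > 0" for \<epsilon>
  proof -
    obtain N where N: "\<forall>m\<ge>N. \<forall>n\<ge>N. \<forall>t\<in>\<Omega>. nrm (A t) (s m t \<ominus>\<^bsub>A t\<^esub> s n t) < \<epsilon>"
      using unif[OF e] by blast
    have "nrm (A t) (s m t \<ominus>\<^bsub>A t\<^esub> y t) \<le> \<epsilon>" if m: "m \<ge> N" and t: "t \<in> \<Omega>" for m t
    proof (rule LIMSEQ_le_const)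
      interpret At: banach_algebra "A t" by (rule fibre_algebra[OF t])
      have "(\<lambda>n. nrm (A t) (s n t \<ominus>\<^bsub>A t\<^esub> y t)) \<longlonglongrightarrow> 0"
        using bspec[OF a t] t unfolding At.converges_def by (simp add: y_def)
      then show "(\<lambda>n. \<epsilon> + nrm (A t) (s n t \<ominus>\<^bsub>A t\<^esub> y t)) \<longlonglongrightarrow> \<epsilon>"
        using tendsto_add[OF tendsto_const] by fastforce
      have "nrm (A t) (s m t \<ominus>\<^bsub>A t\<^esub> y t) \<le> \<epsilon> + nrm (A t) (s n t \<ominus>\<^bsub>A t\<^esub> y t)" if "n \<ge> N" for n
        using At.nrm_diff_triangle[OF s_mem[OF t] s_mem[OF t] y_mem[OF t], of m n] N m t that
        by fastforce
      then show "\<exists>M. \<forall>n\<ge>M. nrm (A t) (s m t \<ominus>\<^bsub>A t\<^esub> y t) \<le> \<epsilon> + nrm (A t) (s n t \<ominus>\<^bsub>A t\<^esub> y t)"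
        by blast
    qed
    then show ?thesis by blast
  qed
  have y\<Theta>: "y \<in> \<Theta>"
  proof (rule sections_local)
    show "y \<in> (\<Pi>\<^sub>E t\<in>\<Omega>. carrier (A t))" using y_mem by (auto simp: y_def)
    show "locally_approximable X A \<Theta> \<Omega> y"
      unfolding locally_approximable_def
    proof (intro ballI allI impI)
      fix t0 and \<epsilon> :: real assume t0: "t0 \<in> \<Omega>" and e: "\<epsilon> > 0"
      obtain N where N: "\<forall>m\<ge>N. \<forall>t\<in>\<Omega>. nrm (A t) (s m t \<ominus>\<^bsub>A t\<^esub> y t) \<le> \<epsilon>" using lim[OF e] by blast
      have "ndist (A t) (y t) (s N t) \<le> \<epsilon>" if t: "t \<in> \<Omega>" for t
        using N t s_mem[OF t] y_mem[OF t]
          normed_space.nrm_diff_commute[OF fibre_normed[OF t] y_mem[OF t] s_mem[OF t, of N]]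
        by (simp add: ndist_def)
      then show "\<exists>x'\<in>\<Theta>. \<exists>W. openin X W \<and> t0 \<in> W \<and> (\<forall>t\<in>W \<inter> \<Omega>. ndist (A t) (y t) (x' t) \<le> \<epsilon>)"
        using s[of N] t0 by (intro bexI[of _ "s N"] exI[of _ \<Omega>]) auto
    qed
  qed
  have "vanishes_at_infinity X (\<lambda>t. nrm (A t) (y t))"
    unfolding vanishes_at_infinity_def
  proof (intro allI impI)
    fix \<epsilon> :: real assume "\<epsilon> > 0"
    then have e: "\<epsilon> / 2 > 0" by simp
    obtain N where N: "\<forall>m\<ge>N. \<forall>t\<in>\<Omega>. nrm (A t) (s m t \<ominus>\<^bsub>A t\<^esub> y t) \<le> \<epsilon> / 2" using lim[OF e] by blast
    have "vanishes_at_infinity X (\<lambda>t. nrm (A t) (s N t))" using s[of N] by simp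
    then obtain K where K: "compactin X K" "\<forall>t\<in>\<Omega> - K. \<bar>nrm (A t) (s N t)\<bar> < \<epsilon> / 2"
      using e unfolding vanishes_at_infinity_def by blast
    have "\<bar>nrm (A t) (y t)\<bar> < \<epsilon>" if t: "t \<in> \<Omega> - K" for t
    proof -
      interpret At: banach_algebra "A t" using fibre_algebra t by blast
      have t': "t \<in> \<Omega>" using t by blast
      have "nrm (A t) (y t) \<le> nrm (A t) (y t \<ominus>\<^bsub>A t\<^esub> s N t) + nrm (A t) (s N t)"
        by (rule At.nrm_le_diff[OF y_mem[OF t'] s_mem[OF t']])
      also have "nrm (A t) (y t \<ominus>\<^bsub>A t\<^esub> s N t) = nrm (A t) (s N t \<ominus>\<^bsub>A t\<^esub> y t)"
        by (rule At.nrm_diff_commute[OF y_mem[OF t'] s_mem[OF t']])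
      finally have "nrm (A t) (y t) \<le> nrm (A t) (s N t \<ominus>\<^bsub>A t\<^esub> y t) + nrm (A t) (s N t)" .
      moreover have "nrm (A t) (s N t \<ominus>\<^bsub>A t\<^esub> y t) \<le> \<epsilon> / 2" using N t' by blast
      moreover have "\<bar>nrm (A t) (s N t)\<bar> < \<epsilon> / 2" using K(2) t by blast
      ultimately show ?thesis using At.nrm_nonneg[OF y_mem[OF t']] by linarith
    qed
    then show "\<exists>K. compactin X K \<and> (\<forall>t\<in>\<Omega> - K. \<bar>nrm (A t) (y t)\<bar> < \<epsilon>)" using K(1) by blast
  qed
  then have y: "y \<in> carrier \<A>" using y\<Theta> by simp
  have "(\<lambda>n. nrm \<A> (s n \<ominus>\<^bsub>\<A>\<^esub> y)) \<longlonglongrightarrow> 0"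
  proof (rule LIMSEQ_I)
    fix \<epsilon> :: real assume "\<epsilon> > 0"
    then have e: "\<epsilon> / 2 > 0" by simp
    obtain N where N: "\<forall>m\<ge>N. \<forall>t\<in>\<Omega>. nrm (A t) (s m t \<ominus>\<^bsub>A t\<^esub> y t) \<le> \<epsilon> / 2" using lim[OF e] by blast
    have "norm (nrm \<A> (s n \<ominus>\<^bsub>\<A>\<^esub> y) - 0) < \<epsilon>" if n: "n \<ge> N" for n
    proof -
      have "nrm \<A> (s n \<ominus>\<^bsub>\<A>\<^esub> y) \<le> \<epsilon> / 2"
      proof (rule nrm_field_le)
        show "nrm (A t) ((s n \<ominus>\<^bsub>\<A>\<^esub> y) t) \<le> \<epsilon> / 2" if "t \<in> \<Omega>" for t
          unfolding field_diff[OF s y that] using N n that by blast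
      qed (use e in simp)
      then show ?thesis using \<open>\<epsilon> > 0\<close> N.nrm_nonneg[OF N.minus_closed[OF s y]] by simp
    qed
    then show "\<exists>N. \<forall>n\<ge>N. norm (nrm \<A> (s n \<ominus>\<^bsub>\<A>\<^esub> y) - 0) < \<epsilon>" by blast
  qed
  then show "\<exists>x\<in>carrier \<A>. (\<lambda>n. nrm \<A> (s n \<ominus>\<^bsub>\<A>\<^esub> x)) \<longlonglongrightarrow> 0"
    by (intro bexI[of _ y] y)
qed

theorem banach_algebra_field_algebra: "banach_algebra \<A>"
proof -
  have ext: "x = y" if "x \<in> carrier \<A>" "y \<in> carrier \<A>" "\<And>t. t \<in> \<Omega> \<Longrightarrow> x t = y t" for x y
    by (rule section_eqI) (use that in auto)
  have mem: "x t \<in> carrier (A t)" if "x \<in> carrier \<A>" "t \<in> \<Omega>" for x t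
    using that section_mem by auto
  note closed = field_add_closed field_scale_closed field_mult_closed
  have "banach_algebra_axioms \<A>"
  proof
    show "bilinear_map \<A> \<A> \<A> (mult \<A>)"
    proof (intro bilinear_mapI linear_mapI)
      fix x y z c
      assume x: "x \<in> carrier \<A>" and y: "y \<in> carrier \<A>"
      show "x \<otimes>\<^bsub>\<A>\<^esub> y \<in> carrier \<A>" by (intro closed x y)
      then show "x \<otimes>\<^bsub>\<A>\<^esub> y \<in> carrier \<A>" .
      show "x \<otimes>\<^bsub>\<A>\<^esub> (c \<odot>\<^bsub>\<A>\<^esub> y) = c \<odot>\<^bsub>\<A>\<^esub> (x \<otimes>\<^bsub>\<A>\<^esub> y)"
        by (rule ext) (intro closed x y | simp add: mem[OF x] mem[OF y] banach_algebra.mult_scale_right[OF fibre_algebra])+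
      show "(c \<odot>\<^bsub>\<A>\<^esub> x) \<otimes>\<^bsub>\<A>\<^esub> y = c \<odot>\<^bsub>\<A>\<^esub> (x \<otimes>\<^bsub>\<A>\<^esub> y)"
        by (rule ext) (intro closed x y | simp add: mem[OF x] mem[OF y] banach_algebra.mult_scale_left[OF fibre_algebra])+
      assume z: "z \<in> carrier \<A>"
      show "x \<otimes>\<^bsub>\<A>\<^esub> (y \<oplus>\<^bsub>\<A>\<^esub> z) = x \<otimes>\<^bsub>\<A>\<^esub> y \<oplus>\<^bsub>\<A>\<^esub> x \<otimes>\<^bsub>\<A>\<^esub> z"
        by (rule ext) (intro closed x y z | simp add: mem[OF x] mem[OF y] mem[OF z] banach_algebra.mult_add_right[OF fibre_algebra])+
      show "(x \<oplus>\<^bsub>\<A>\<^esub> y) \<otimes>\<^bsub>\<A>\<^esub> z = x \<otimes>\<^bsub>\<A>\<^esub> z \<oplus>\<^bsub>\<A>\<^esub> y \<otimes>\<^bsub>\<A>\<^esub> z"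
        by (rule ext) (intro closed x y z | simp add: mem[OF x] mem[OF y] mem[OF z] banach_algebra.mult_add_left[OF fibre_algebra])+
    qed
  next
    fix x y z
    assume x: "x \<in> carrier \<A>" and y: "y \<in> carrier \<A>"
    show "nrm \<A> (x \<otimes>\<^bsub>\<A>\<^esub> y) \<le> nrm \<A> x * nrm \<A> y"
    proof (rule nrm_field_le)
      fix t assume t: "t \<in> \<Omega>"
      interpret At: banach_algebra "A t" by (rule fibre_algebra[OF t])
      have "nrm (A t) (x t \<otimes>\<^bsub>A t\<^esub> y t) \<le> nrm (A t) (x t) * nrm (A t) (y t)"
        by (rule At.nrm_mult_le[OF mem[OF x t] mem[OF y t]])
      also have "\<dots> \<le> nrm \<A> x * nrm \<A> y"
        using mem[OF y t] by (intro mult_mono nrm_pointwise_le nrm_field_nonneg x y t) simp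
      finally show "nrm (A t) ((x \<otimes>\<^bsub>\<A>\<^esub> y) t) \<le> nrm \<A> x * nrm \<A> y" using t by simp
    qed (intro mult_nonneg_nonneg nrm_field_nonneg x y)
    assume z: "z \<in> carrier \<A>"
    show "(x \<otimes>\<^bsub>\<A>\<^esub> y) \<otimes>\<^bsub>\<A>\<^esub> z = x \<otimes>\<^bsub>\<A>\<^esub> (y \<otimes>\<^bsub>\<A>\<^esub> z)"
      by (rule ext) (intro closed x y z | simp add: mem[OF x] mem[OF y] mem[OF z] banach_algebra.mult_assoc[OF fibre_algebra])+
  qed
  then show ?thesis by (intro banach_algebra.intro banach_field_algebra)
qed

end


section \<open>Local sections of a locally trivial field\<close>

lemma isometric_alg_iso_inverse:
  assumes "normed_space A" "normed_space C" and iso: "isometric_alg_iso A C \<phi>"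
  defines "\<psi> \<equiv> inv_into (carrier A) \<phi>"
  shows "c \<in> carrier C \<Longrightarrow> \<phi> (\<psi> c) = c"
    and "a \<in> carrier A \<Longrightarrow> \<psi> (\<phi> a) = a"
    and "linear_map C A \<psi>"
    and "\<lbrakk>c \<in> carrier C; d \<in> carrier C\<rbrakk> \<Longrightarrow> \<psi> c \<otimes>\<^bsub>A\<^esub> \<psi> d \<in> carrier A \<Longrightarrow>
      \<psi> (c \<otimes>\<^bsub>C\<^esub> d) = \<psi> c \<otimes>\<^bsub>A\<^esub> \<psi> d"
    and "c \<in> carrier C \<Longrightarrow> nrm A (\<psi> c) = nrm C c"
proof -
  interpret A: normed_space A by fact
  interpret C: normed_space C by fact
  have lin: "linear_map A C \<phi>" and bij: "bij_betw \<phi> (carrier A) (carrier C)"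
    and mult: "\<And>x y. \<lbrakk>x \<in> carrier A; y \<in> carrier A\<rbrakk> \<Longrightarrow> \<phi> (x \<otimes>\<^bsub>A\<^esub> y) = \<phi> x \<otimes>\<^bsub>C\<^esub> \<phi> y"
    and nrm: "\<And>x. x \<in> carrier A \<Longrightarrow> nrm C (\<phi> x) = nrm A x"
    using iso by (auto simp: isometric_alg_iso_def)
  have 1: "\<phi> (\<psi> c) = c" if "c \<in> carrier C" for c
    using bij that by (simp add: \<psi>_def bij_betw_inv_into_right)
  have 2: "\<psi> (\<phi> a) = a" if "a \<in> carrier A" for a
    using bij that by (simp add: \<psi>_def bij_betw_inv_into_left)
  have mem: "\<psi> c \<in> carrier A" if "c \<in> carrier C" for c
    using bij_betw_inv_into[OF bij] that by (auto simp: \<psi>_def bij_betw_def)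
  show "c \<in> carrier C \<Longrightarrow> \<phi> (\<psi> c) = c" by (rule 1)
  show "a \<in> carrier A \<Longrightarrow> \<psi> (\<phi> a) = a" by (rule 2)
  show "linear_map C A \<psi>"
  proof (rule linear_mapI)
    fix c d assume cd: "c \<in> carrier C" "d \<in> carrier C"
    have "\<psi> (\<phi> (\<psi> c \<oplus>\<^bsub>A\<^esub> \<psi> d)) = \<psi> c \<oplus>\<^bsub>A\<^esub> \<psi> d" using cd mem by (intro 2) auto
    then show "\<psi> (c \<oplus>\<^bsub>C\<^esub> d) = \<psi> c \<oplus>\<^bsub>A\<^esub> \<psi> d"
      using cd mem by (simp add: linear_map_add[OF lin] 1)
  next
    fix z c assume c: "c \<in> carrier C"
    have "\<psi> (\<phi> (z \<odot>\<^bsub>A\<^esub> \<psi> c)) = z \<odot>\<^bsub>A\<^esub> \<psi> c" using c mem by (intro 2) auto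
    then show "\<psi> (z \<odot>\<^bsub>C\<^esub> c) = z \<odot>\<^bsub>A\<^esub> \<psi> c"
      using c mem by (simp add: linear_map_scale[OF lin] 1)
  qed (rule mem)
  show "\<psi> (c \<otimes>\<^bsub>C\<^esub> d) = \<psi> c \<otimes>\<^bsub>A\<^esub> \<psi> d"
    if cd: "c \<in> carrier C" "d \<in> carrier C" "\<psi> c \<otimes>\<^bsub>A\<^esub> \<psi> d \<in> carrier A"
    using 2[OF cd(3)] cd mem by (simp add: mult 1)
  show "nrm A (\<psi> c) = nrm C c" if "c \<in> carrier C"
    using nrm[OF mem[OF that]] 1[OF that] by simp
qed

text \<open>Complete regularity gives \<open>h\<close> with \<open>h x = 1\<close> that vanishes off \<open>N\<close>; the values of \<open>2 h - 1\<close> and of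
  \<open>2 h\<close>, clipped to \<open>[0, 1]\<close>, are the two functions. If the first is nonzero, then \<open>h > 1 / 2\<close>, so the
  second is \<open>1\<close>.\<close>

lemma ex_cutoff_pair:
  assumes X: "locally_compact_space X" "Hausdorff_space X" and N: "openin X N" "x \<in> N"
  shows "\<exists>f g. continuous_map X euclideanreal f \<and> continuous_map X euclideanreal g \<and>
    (\<forall>t. 0 \<le> f t \<and> f t \<le> (1 :: real)) \<and> (\<forall>t. 0 \<le> g t \<and> g t \<le> (1 :: real)) \<and>
    (\<forall>t\<in>topspace X - N. f t = 0 \<and> g t = 0) \<and> f x = 1 \<and> g x = 1 \<and> (\<forall>t. g t * f t = f t)"
proof -
  have "completely_regular_space X"
    using X locally_compact_regular_imp_completely_regular_space by blast
  then have "\<exists>h. continuous_map X euclideanreal h \<and> h x = 1 \<and> h ` (topspace X - N) \<subseteq> {0}"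
    using N unfolding completely_regular_space_gen_alt'[OF one_neq_zero] by blast
  then obtain h :: "'a \<Rightarrow> real" where h: "continuous_map X euclideanreal h" "h x = 1"
      "h ` (topspace X - N) \<subseteq> {0}" by blast
  define f where "f t = max 0 (min 1 (2 * h t - 1))" for t
  define g where "g t = max 0 (min 1 (2 * h t))" for t
  have "continuous_map X euclideanreal f" "continuous_map X euclideanreal g"
    unfolding f_def g_def using h(1)
    by (auto intro!: continuous_intros continuous_map_real_mult_left)
  moreover have "f t = 0 \<and> g t = 0" if "t \<in> topspace X - N" for t
  proof -
    have "h t = 0" using h(3) that by blast
    then show ?thesis by (simp add: f_def g_def)
  qed
  moreover have "g t * f t = f t" for t
    by (cases "f t = 0") (auto simp: f_def g_def max_def min_def split: if_splits)
  ultimately show ?thesis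
    using h(2) by (intro exI[of _ f] exI[of _ g]) (auto simp: f_def g_def)
qed

context cfield
begin

text \<open>An isomorphism of fields is only required to carry sections to sections. A constant section
  of the trivialisation nevertheless pulls back to one that is, near each point, uniformly close
  to a section of the given field: sections take values close to any prescribed one at the point,
  and their images in the constant field are continuous.\<close>

lemma cutoff_section_mem:
  assumes W: "openin X W" "W \<subseteq> V" and V: "V \<subseteq> \<Omega>" and C: "banach_algebra C"
    and iso: "field_isomorphism (induced_field \<U> V) (constant_field (base (induced_field \<U> V)) C) \<phi>"
    and k: "continuous_map X euclideanreal k" "\<forall>t. 0 \<le> k t \<and> k t \<le> 1"
    and K: "compactin X K" "\<forall>t\<in>\<Omega>. t \<notin> W \<inter> K \<longrightarrow> k t = 0"
    and c: "c \<in> carrier C"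
  defines "s \<equiv> \<lambda>t\<in>\<Omega>. if t \<in> W then complex_of_real (k t) \<odot>\<^bsub>A t\<^esub> inv_into (carrier (A t)) (\<phi> t) c
    else \<zero>\<^bsub>A t\<^esub>"
  shows "s \<in> carrier \<A>" and "t \<in> \<Omega> \<Longrightarrow> nrm (A t) (s t) = k t * nrm C c"
proof -
  interpret C: banach_algebra C by (rule C)
  define \<psi> where "\<psi> t = inv_into (carrier (A t)) (\<phi> t)" for t
  have topV: "topspace (subtopology X V) = V" using V by auto
  have iso_t: "isometric_alg_iso (A t) C (\<phi> t)" if "t \<in> V" for t
    using iso that topV by (simp add: field_isomorphism_def induced_field_def constant_field_def)
  have image_section: "\<forall>z\<in>sections (induced_field \<U> V).
      (\<lambda>t\<in>V. \<phi> t (z t)) \<in> sections (constant_field (subtopology X V) C)"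
    using iso topV by (simp add: field_isomorphism_def induced_field_def)
  have nA: "normed_space (A t)" if "t \<in> V" for t using fibre_normed V that by blast
  note inverse = isometric_alg_iso_inverse[OF nA C.normed_space_axioms iso_t, folded \<psi>_def]
  have \<psi>_mem: "\<psi> t c \<in> carrier (A t)" if "t \<in> V" for t
    by (rule linear_map_closed[OF inverse(3)[OF that that] c])
  have \<psi>_nrm: "nrm (A t) (\<psi> t c) = nrm C c" if "t \<in> V" for t
    by (rule inverse(5)[OF that that c])
  have WV: "t \<in> V" if "t \<in> W" for t using W(2) that by blast
  have s_W: "s t = complex_of_real (k t) \<odot>\<^bsub>A t\<^esub> \<psi> t c" if "t \<in> W" for t
    using that WV V by (auto simp: s_def \<psi>_def)
  have s_off: "s t = \<zero>\<^bsub>A t\<^esub>" if "t \<in> \<Omega>" "t \<notin> W" for t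
    using that by (simp add: s_def)
  have s_mem: "s t \<in> carrier (A t)" if t: "t \<in> \<Omega>" for t
  proof (cases "t \<in> W")
    case True
    interpret At: normed_space "A t" by (rule fibre_normed[OF t])
    show ?thesis using \<psi>_mem[OF WV[OF True]] by (simp add: s_W[OF True])
  next
    case False
    interpret At: normed_space "A t" by (rule fibre_normed[OF t])
    show ?thesis by (simp add: s_off[OF t False])
  qed
  have s_nrm: "nrm (A t) (s t) = k t * nrm C c" if t: "t \<in> \<Omega>" for t
  proof (cases "t \<in> W")
    case True
    interpret At: normed_space "A t" by (rule fibre_normed[OF t])
    show ?thesis
      using \<psi>_mem[OF WV[OF True]] k(2) by (simp add: s_W[OF True] At.nrm_smult \<psi>_nrm WV[OF True])
  next
    case False
    interpret At: normed_space "A t" by (rule fibre_normed[OF t])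
    show ?thesis using K(2) False t by (simp add: s_off[OF t False])
  qed
  have open_near: "openin X {t \<in> \<Omega>. \<bar>k t - k t0\<bar> < \<delta>}" for t0 \<delta>
  proof -
    have "{t \<in> \<Omega>. \<bar>k t - k t0\<bar> < \<delta>} = {t \<in> \<Omega>. k t \<in> ball (k t0) \<delta>}"
      by (auto simp: dist_real_def abs_minus_commute)
    then show ?thesis
      using openin_continuous_map_preimage[OF k(1), of "ball (k t0) \<delta>"] by simp
  qed
  have c_pos: "nrm C c + 1 > 0" using C.nrm_nonneg[OF c] by linarith
  have approx: "\<exists>x'\<in>\<Theta>. \<exists>N. openin X N \<and> t0 \<in> N \<and> (\<forall>t\<in>N \<inter> \<Omega>. ndist (A t) (s t) (x' t) \<le> \<epsilon>)"
    if t0: "t0 \<in> \<Omega>" and e: "\<epsilon> > 0" for t0 \<epsilon>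
  proof (cases "t0 \<in> W")
    case False
    (* Here k t0 = 0, so s is small near t0 and the zero section approximates it. *)
    let ?N = "{t \<in> \<Omega>. \<bar>k t - k t0\<bar> < \<epsilon> / (nrm C c + 1)}"
    have k0: "k t0 = 0" using K(2) t0 False by blast
    have "ndist (A t) (s t) ((\<lambda>t\<in>\<Omega>. \<zero>\<^bsub>A t\<^esub>) t) \<le> \<epsilon>" if t: "t \<in> ?N" for t
    proof -
      interpret At: normed_space "A t" using fibre_normed t by blast
      have t': "t \<in> \<Omega>" using t by blast
      have "s t \<ominus>\<^bsub>A t\<^esub> \<zero>\<^bsub>A t\<^esub> = s t" using s_mem[OF t'] by (simp add: At.diff_eq)
      then have "ndist (A t) (s t) ((\<lambda>t\<in>\<Omega>. \<zero>\<^bsub>A t\<^esub>) t) = k t * nrm C c"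
        using t' s_mem[OF t'] by (simp add: ndist_def s_nrm)
      also have "\<dots> \<le> k t * (nrm C c + 1)" using k(2) by (intro mult_left_mono) auto
      also have "k t < \<epsilon> / (nrm C c + 1)" using t k0 by (simp add: abs_less_iff)
      then have "k t * (nrm C c + 1) \<le> \<epsilon>" using c_pos by (simp add: pos_less_divide_eq)
      finally show ?thesis .
    qed
    then show ?thesis
      using sections_zero open_near t0 e c_pos
      by (intro bexI[of _ "\<lambda>t\<in>\<Omega>. \<zero>\<^bsub>A t\<^esub>"] exI[of _ ?N]) auto
  next
    case True
    then have t0V: "t0 \<in> V" by (rule WV)
    (* Choose a section y close to the pullback of c at t0. It stays close to it near t0, where
       k is close to k t0, so the section k t0 y approximates s there. *)
    have e3: "\<epsilon> / 3 > 0" using e by simp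
    obtain y where y: "y \<in> \<Theta>" "ndist (A t0) (y t0) (\<psi> t0 c) < \<epsilon> / 3"
      using dense_sections[OF t0 \<psi>_mem[OF t0V] e3] by blast
    have y_mem: "y t \<in> carrier (A t)" if "t \<in> V" for t using section_mem[OF y(1)] V that by blast
    have "restrict y V \<in> sections (induced_field \<U> V)"
    proof -
      have "\<exists>x'\<in>\<Theta>. \<exists>N. openin X N \<and> t \<in> N \<and> (\<forall>u\<in>N \<inter> V. ndist (A u) (restrict y V u) (x' u) \<le> \<delta>)"
        if t: "t \<in> V" and d: "\<delta> > 0" for t \<delta>
      proof (intro bexI[of _ y] exI[of _ \<Omega>] conjI ballI)
        fix u assume u: "u \<in> \<Omega> \<inter> V"
        interpret Au: normed_space "A u" using fibre_normed u by blast
        have "y u \<ominus>\<^bsub>A u\<^esub> y u = \<zero>\<^bsub>A u\<^esub>" using y_mem u by (simp add: Au.diff_eq_zero_iff)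
        then show "ndist (A u) (restrict y V u) (y u) \<le> \<delta>" using u d by (simp add: ndist_def)
      qed (use y t V in auto)
      then show ?thesis
        using y_mem by (simp add: induced_field_def product_algebra_def locally_approximable_def)
    qed
    then have "(\<lambda>t\<in>V. \<phi> t (restrict y V t)) \<in> sections (constant_field (subtopology X V) C)"
      by (rule bspec[OF image_section])
    then have cont: "continuous_map (subtopology X V) C.metric.mtopology (\<lambda>t\<in>V. \<phi> t (restrict y V t))"
      by (simp add: constant_field_def)
    have "openin (subtopology X V)
        {t \<in> topspace (subtopology X V). (\<lambda>t\<in>V. \<phi> t (restrict y V t)) t \<in> C.metric.mball c (\<epsilon> / 3)}"
      by (rule openin_continuous_map_preimage[OF cont C.metric.openin_mball])
    then obtain T where T: "openin X T"
      "{t \<in> V. \<phi> t (y t) \<in> C.metric.mball c (\<epsilon> / 3)} = T \<inter> V"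
      unfolding topV openin_subtopology by (auto cong: conj_cong)
    have dist_eq: "nrm (A t) (\<psi> t c \<ominus>\<^bsub>A t\<^esub> y t) = nrm C (c \<ominus>\<^bsub>C\<^esub> \<phi> t (y t))" if t: "t \<in> V" for t
    proof -
      have lin: "linear_map (A t) C (\<phi> t)" and nrm: "\<forall>a\<in>carrier (A t). nrm C (\<phi> t a) = nrm (A t) a"
        using iso_t[OF t] by (auto simp: isometric_alg_iso_def)
      interpret At: normed_space "A t" by (rule nA[OF t])
      have "nrm (A t) (\<psi> t c \<ominus>\<^bsub>A t\<^esub> y t) = nrm C (\<phi> t (\<psi> t c \<ominus>\<^bsub>A t\<^esub> y t))"
        using nrm \<psi>_mem[OF t] y_mem[OF t] by simp
      also have "\<phi> t (\<psi> t c \<ominus>\<^bsub>A t\<^esub> y t) = \<phi> t (\<psi> t c) \<ominus>\<^bsub>C\<^esub> \<phi> t (y t)"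
        by (rule linear_map_diff[OF nA[OF t] C.normed_space_axioms lin \<psi>_mem[OF t] y_mem[OF t]])
      also have "\<phi> t (\<psi> t c) = c" by (rule inverse(1)[OF t t c])
      finally show ?thesis .
    qed
    have \<phi>y_mem: "\<phi> t (y t) \<in> carrier C" if "t \<in> V" for t
      using iso_t[OF that] y_mem[OF that] by (auto simp: isometric_alg_iso_def linear_map_def)
    have "t0 \<in> T"
    proof -
      have "nrm (A t0) (\<psi> t0 c \<ominus>\<^bsub>A t0\<^esub> y t0) < \<epsilon> / 3"
        using y(2) \<psi>_mem[OF t0V] y_mem[OF t0V]
          normed_space.nrm_diff_commute[OF nA[OF t0V] \<psi>_mem[OF t0V] y_mem[OF t0V]]
        by (simp add: ndist_def)
      then have "\<phi> t0 (y t0) \<in> C.metric.mball c (\<epsilon> / 3)"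
        using c \<phi>y_mem[OF t0V] dist_eq[OF t0V] by (simp add: ndist_def)
      then show ?thesis using T(2) t0V by blast
    qed
    define x' where "x' = (\<lambda>t\<in>\<Omega>. complex_of_real (k t0) \<odot>\<^bsub>A t\<^esub> y t)"
    let ?N = "T \<inter> W \<inter> {t \<in> \<Omega>. \<bar>k t - k t0\<bar> < \<epsilon> / 3 / (nrm C c + 1)}"
    have "ndist (A t) (s t) (x' t) \<le> \<epsilon>" if t: "t \<in> ?N" for t
    proof -
      have tW: "t \<in> W" and tV: "t \<in> V" and t\<Omega>: "t \<in> \<Omega>" using t WV by auto
      interpret At: normed_space "A t" by (rule nA[OF tV])
      note m = \<psi>_mem[OF tV] y_mem[OF tV]
      have "\<phi> t (y t) \<in> C.metric.mball c (\<epsilon> / 3)" using T(2) t tV by blast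
      then have near: "nrm (A t) (\<psi> t c \<ominus>\<^bsub>A t\<^esub> y t) < \<epsilon> / 3"
        using c \<phi>y_mem[OF tV] by (simp add: ndist_def dist_eq[OF tV])
      let ?a = "complex_of_real (k t) \<odot>\<^bsub>A t\<^esub> \<psi> t c" and ?b = "complex_of_real (k t0) \<odot>\<^bsub>A t\<^esub> \<psi> t c"
      have "nrm (A t) (?a \<ominus>\<^bsub>A t\<^esub> complex_of_real (k t0) \<odot>\<^bsub>A t\<^esub> y t) \<le>
          nrm (A t) (?a \<ominus>\<^bsub>A t\<^esub> ?b) + nrm (A t) (?b \<ominus>\<^bsub>A t\<^esub> complex_of_real (k t0) \<odot>\<^bsub>A t\<^esub> y t)"
        using m by (intro At.nrm_diff_triangle) auto
      also have "?a \<ominus>\<^bsub>A t\<^esub> ?b = complex_of_real (k t - k t0) \<odot>\<^bsub>A t\<^esub> \<psi> t c"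
        using m At.scale_left_distrib[of "\<psi> t c" "complex_of_real (k t)" "- complex_of_real (k t0)"]
        by (simp add: At.diff_eq At.scale_scale)
      also have "nrm (A t) \<dots> = \<bar>k t - k t0\<bar> * nrm C c"
        using m by (simp add: At.nrm_smult \<psi>_nrm[OF tV] del: of_real_diff)
      also have "?b \<ominus>\<^bsub>A t\<^esub> complex_of_real (k t0) \<odot>\<^bsub>A t\<^esub> y t = complex_of_real (k t0) \<odot>\<^bsub>A t\<^esub> (\<psi> t c \<ominus>\<^bsub>A t\<^esub> y t)"
        using m by (simp add: At.smult_diff)
      also have "nrm (A t) \<dots> = k t0 * nrm (A t) (\<psi> t c \<ominus>\<^bsub>A t\<^esub> y t)"
        using m k(2) by (simp add: At.nrm_smult)
      also have "k t0 * nrm (A t) (\<psi> t c \<ominus>\<^bsub>A t\<^esub> y t) \<le> 1 * (\<epsilon> / 3)"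
        using near k(2) m by (intro mult_mono) auto
      also have "\<bar>k t - k t0\<bar> * nrm C c \<le> \<epsilon> / 3"
      proof -
        have "\<bar>k t - k t0\<bar> * nrm C c \<le> \<bar>k t - k t0\<bar> * (nrm C c + 1)" by (intro mult_left_mono) auto
        also have "\<bar>k t - k t0\<bar> < \<epsilon> / 3 / (nrm C c + 1)" using t by blast
        then have "\<bar>k t - k t0\<bar> * (nrm C c + 1) \<le> \<epsilon> / 3"
          using c_pos by (simp only: pos_less_divide_eq less_imp_le)
        finally show ?thesis .
      qed
      finally have "nrm (A t) (?a \<ominus>\<^bsub>A t\<^esub> complex_of_real (k t0) \<odot>\<^bsub>A t\<^esub> y t) \<le> \<epsilon>" using e by simp
      then show ?thesis using m t\<Omega> e by (simp add: ndist_def s_W[OF tW] x'_def)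
    qed
    moreover have "openin X ?N" by (intro openin_Int T(1) W(1) open_near)
    moreover have "t0 \<in> ?N" using \<open>t0 \<in> T\<close> True t0 e c_pos by simp
    moreover have "x' \<in> \<Theta>" unfolding x'_def by (rule sections_scale[OF y(1)])
    ultimately show ?thesis by (intro bexI[of _ x'] exI[of _ ?N]) auto
  qed
  have "s \<in> \<Theta>"
  proof (rule sections_local)
    show "s \<in> (\<Pi>\<^sub>E t\<in>\<Omega>. carrier (A t))" using s_mem by (auto simp: s_def)
    show "locally_approximable X A \<Theta> \<Omega> s"
      unfolding locally_approximable_def by (intro ballI allI impI approx)
  qed
  moreover have "vanishes_at_infinity X (\<lambda>t. nrm (A t) (s t))"
    unfolding vanishes_at_infinity_def
    by (intro allI impI exI[of _ K] conjI K(1) ballI) (use K(2) s_nrm in auto)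
  ultimately show "s \<in> carrier \<A>" by simp
  show "nrm (A t) (s t) = k t * nrm C c" if "t \<in> \<Omega>" by (rule s_nrm[OF that])
qed

text \<open>For cutoff functions \<open>f\<close> and \<open>g\<close> with \<open>g f = f\<close>, the lifts of \<open>a\<close> are the sections
  \<open>f \<cdot> \<phi>\<^sup>-\<^sup>1 (\<phi>\<^sub>x a)\<close> and \<open>g \<cdot> \<phi>\<^sup>-\<^sup>1 (\<phi>\<^sub>x a)\<close>.\<close>

theorem fibre_split_quotient:
  assumes triv: "locally_trivial \<U>" and x: "x \<in> \<Omega>"
  shows "\<exists>\<sigma> \<tau>. split_quotient \<A> (A x) (\<lambda>y. y x) \<sigma> \<tau>"
proof -
  obtain V W where V: "V \<subseteq> \<Omega>" and W: "openin X W" "x \<in> W" "W \<subseteq> V"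
    and tr: "trivial_field (induced_field \<U> V)"
    using bspec[OF triv[unfolded locally_trivial_def] x] by (elim exE conjE) (rule that)
  obtain C :: "'a nspace" and \<phi> where C: "banach_algebra C"
    and iso: "field_isomorphism (induced_field \<U> V) (constant_field (base (induced_field \<U> V)) C) \<phi>"
    using tr[unfolded trivial_field_def] by (elim exE conjE) (rule that)
  obtain U K where U: "openin X U" "compactin X K" "x \<in> U" "U \<subseteq> K"
    using bspec[OF locally_compact[unfolded locally_compact_space_def] x]
    by (elim exE conjE) (rule that)
  have "openin X (W \<inter> U)" "x \<in> W \<inter> U" using W U by auto
  from ex_cutoff_pair[OF locally_compact Hausdorff this] obtain f g
    where f: "continuous_map X euclideanreal f" "\<forall>t. 0 \<le> f t \<and> f t \<le> 1"
      and g: "continuous_map X euclideanreal g" "\<forall>t. 0 \<le> g t \<and> g t \<le> 1"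
      and off: "\<forall>t\<in>\<Omega> - W \<inter> U. f t = 0 \<and> g t = 0" and fx: "f x = 1" and gx: "g x = 1"
      and gf: "\<forall>t. g t * f t = f t"
    by (elim exE conjE) (rule that)
  have K: "\<forall>t\<in>\<Omega>. t \<notin> W \<inter> K \<longrightarrow> f t = 0" "\<forall>t\<in>\<Omega>. t \<notin> W \<inter> K \<longrightarrow> g t = 0"
    using off U(4) by blast+
  interpret C: banach_algebra C by (rule C)
  interpret Ax: banach_algebra "A x" by (rule fibre_algebra[OF x])
  interpret \<A>: banach_algebra \<A> by (rule banach_algebra_field_algebra)
  have xV: "x \<in> V" using W by blast
  have iso_t: "isometric_alg_iso (A t) C (\<phi> t)" if "t \<in> V" for t
    using iso that V by (simp add: field_isomorphism_def induced_field_def constant_field_def Int_absorb1)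
  define \<psi> where "\<psi> t = inv_into (carrier (A t)) (\<phi> t)" for t
  have nA: "normed_space (A t)" if "t \<in> V" for t using fibre_normed V that by blast
  note inverse = isometric_alg_iso_inverse[OF nA C.normed_space_axioms iso_t, folded \<psi>_def]
  have \<phi>_lin: "linear_map (A x) C (\<phi> x)"
    and \<phi>_mult: "\<And>a b. \<lbrakk>a \<in> carrier (A x); b \<in> carrier (A x)\<rbrakk> \<Longrightarrow> \<phi> x (a \<otimes>\<^bsub>A x\<^esub> b) = \<phi> x a \<otimes>\<^bsub>C\<^esub> \<phi> x b"
    and \<phi>_nrm: "\<And>a. a \<in> carrier (A x) \<Longrightarrow> nrm C (\<phi> x a) = nrm (A x) a"
    using iso_t[OF xV] by (auto simp: isometric_alg_iso_def)
  note \<phi>_mem = linear_map_closed[OF \<phi>_lin]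
  define sec where "sec k a = (\<lambda>t\<in>\<Omega>. if t \<in> W then complex_of_real (k t) \<odot>\<^bsub>A t\<^esub> \<psi> t (\<phi> x a)
    else \<zero>\<^bsub>A t\<^esub>)" for k a
  note cutoff = cutoff_section_mem[OF W(1,3) V C iso, folded \<psi>_def]
  have sec_f: "sec f a \<in> carrier \<A>" "\<And>t. t \<in> \<Omega> \<Longrightarrow> nrm (A t) (sec f a t) = f t * nrm C (\<phi> x a)"
    and sec_g: "sec g a \<in> carrier \<A>" if "a \<in> carrier (A x)" for a
    unfolding sec_def by (intro cutoff[OF f U(2) K(1) \<phi>_mem[OF that]] cutoff[OF g U(2) K(2) \<phi>_mem[OF that]]; assumption)+
  have at_x: "sec k a x = a" if "a \<in> carrier (A x)" "k x = 1" for k a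
    using that x W(2) inverse(2)[OF xV xV that(1)] by (simp add: sec_def)
  have \<psi>_mem: "\<psi> t (\<phi> x a) \<in> carrier (A t)" if "t \<in> V" "a \<in> carrier (A x)" for t a
    by (rule linear_map_closed[OF inverse(3)[OF that(1) that(1)] \<phi>_mem[OF that(2)]])
  have \<psi>_lin: "linear_map C (A t) (\<psi> t)" if "t \<in> V" for t by (rule inverse(3)[OF that that])
  have ext: "u = v" if "u \<in> carrier \<A>" "v \<in> carrier \<A>" "\<And>t. t \<in> \<Omega> \<Longrightarrow> u t = v t" for u v
    by (rule section_eqI) (use that in auto)
  have prod: "sec k a t \<otimes>\<^bsub>A t\<^esub> sec l b t = sec f (a \<otimes>\<^bsub>A x\<^esub> b) t"
    if kl: "\<forall>t. k t * l t = f t" and ab: "a \<in> carrier (A x)" "b \<in> carrier (A x)" and t: "t \<in> \<Omega>" for k l a b t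
  proof -
    interpret At: banach_algebra "A t" by (rule fibre_algebra[OF t])
    show ?thesis
    proof (cases "t \<in> W")
      case True
      then have tV: "t \<in> V" using W(3) by blast
      note m = \<psi>_mem[OF tV ab(1)] \<psi>_mem[OF tV ab(2)]
      have "\<psi> t (\<phi> x a \<otimes>\<^bsub>C\<^esub> \<phi> x b) = \<psi> t (\<phi> x a) \<otimes>\<^bsub>A t\<^esub> \<psi> t (\<phi> x b)"
        by (rule inverse(4)[OF tV tV \<phi>_mem[OF ab(1)] \<phi>_mem[OF ab(2)] At.mult_closed[OF m]])
      moreover have "l t * k t = f t" using kl by (simp add: mult.commute)
      ultimately show ?thesis
        using True t m ab
        by (simp add: sec_def \<phi>_mult At.mult_scale_left At.mult_scale_right At.scale_scale At.mult_closed
            flip: of_real_mult)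
    next
      case False
      then show ?thesis using t by (simp add: sec_def At.zero_mult)
    qed
  qed
  have "split_quotient_axioms \<A> (A x) (\<lambda>y. y x) (sec f) (sec g)"
  proof
    show "linear_map \<A> (A x) (\<lambda>y. y x)"
      by (rule linear_mapI) (use x section_mem in auto)
    show "nrm (A x) (y x) \<le> nrm \<A> y" if "y \<in> carrier \<A>" for y
      by (rule nrm_pointwise_le[OF that x])
    show "(y \<otimes>\<^bsub>\<A>\<^esub> z) x = y x \<otimes>\<^bsub>A x\<^esub> z x" for y z using x by simp
    show "linear_map (A x) \<A> (sec f)"
    proof (rule linear_mapI)
      fix a b assume ab: "a \<in> carrier (A x)" "b \<in> carrier (A x)"
      show "sec f (a \<oplus>\<^bsub>A x\<^esub> b) = sec f a \<oplus>\<^bsub>\<A>\<^esub> sec f b"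
      proof (rule ext)
        fix t assume t: "t \<in> \<Omega>"
        interpret At: normed_space "A t" by (rule fibre_normed[OF t])
        show "sec f (a \<oplus>\<^bsub>A x\<^esub> b) t = (sec f a \<oplus>\<^bsub>\<A>\<^esub> sec f b) t"
        proof (cases "t \<in> W")
          case True
          then have tV: "t \<in> V" using W(3) by blast
          show ?thesis
            using True t ab \<psi>_mem[OF tV ab(1)] \<psi>_mem[OF tV ab(2)] \<phi>_mem
            by (simp add: sec_def linear_map_add[OF \<phi>_lin] linear_map_add[OF \<psi>_lin[OF tV]]
                At.scale_right_distrib)
        qed (use t in \<open>simp add: sec_def\<close>)
      qed (use ab sec_f \<A>.a_closed in \<open>auto simp del: field_algebra_simps\<close>)
    next
      fix z a assume a: "a \<in> carrier (A x)"
      show "sec f (z \<odot>\<^bsub>A x\<^esub> a) = z \<odot>\<^bsub>\<A>\<^esub> sec f a"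
      proof (rule ext)
        fix t assume t: "t \<in> \<Omega>"
        interpret At: normed_space "A t" by (rule fibre_normed[OF t])
        show "sec f (z \<odot>\<^bsub>A x\<^esub> a) t = (z \<odot>\<^bsub>\<A>\<^esub> sec f a) t"
        proof (cases "t \<in> W")
          case True
          then have tV: "t \<in> V" using W(3) by blast
          show ?thesis
            using True t a \<psi>_mem[OF tV a] \<phi>_mem
            by (simp add: sec_def linear_map_scale[OF \<phi>_lin] linear_map_scale[OF \<psi>_lin[OF tV]]
                At.scale_scale mult.commute)
        qed (use t in \<open>simp add: sec_def\<close>)
      qed (use a sec_f \<A>.scale_closed in \<open>auto simp del: field_algebra_simps\<close>)
    qed (rule sec_f)
    fix a assume a: "a \<in> carrier (A x)"
    show "nrm \<A> (sec f a) \<le> nrm (A x) a"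
    proof (rule nrm_field_le)
      show "nrm (A t) (sec f a t) \<le> nrm (A x) a" if "t \<in> \<Omega>" for t
        using f(2) a that mult_right_mono[of "f t" 1 "nrm (A x) a"] by (simp add: sec_f \<phi>_nrm)
    qed (use a in simp)
    show "sec f a x = a" "sec g a x = a" using at_x a fx gx by auto
    show "sec g a \<in> carrier \<A>" by (rule sec_g[OF a])
    fix b assume b: "b \<in> carrier (A x)"
    have ab: "sec f (a \<otimes>\<^bsub>A x\<^esub> b) \<in> carrier \<A>" by (intro sec_f Ax.mult_closed a b)
    show "sec g a \<otimes>\<^bsub>\<A>\<^esub> sec f b = sec f (a \<otimes>\<^bsub>A x\<^esub> b)"
      by (rule ext[OF \<A>.mult_closed[OF sec_g[OF a] sec_f(1)[OF b]] ab])
        (use prod[OF gf a b] in simp)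
    show "sec f a \<otimes>\<^bsub>\<A>\<^esub> sec g b = sec f (a \<otimes>\<^bsub>A x\<^esub> b)"
      by (rule ext[OF \<A>.mult_closed[OF sec_f(1)[OF a] sec_g[OF b]] ab])
        (use prod[OF _ a b, of f g] gf in \<open>simp add: mult.commute\<close>)
  qed
  then show ?thesis
    using split_quotient.intro \<A>.banach_algebra_axioms Ax.banach_algebra_axioms by blast
qed

end


section \<open>Uniform projectivity of the fibres\<close>

theorem proposition3p6:
  fixes \<U> :: "('x, 'a) field_data"
  assumes "continuous_field \<U>" and "locally_trivial \<U>"
  shows "(left_projective (field_algebra \<U>) \<longrightarrow>
            uniformly_left_projective (topspace (base \<U>)) (fibre \<U>)) \<and>
         (right_projective (field_algebra \<U>) \<longrightarrow>
            uniformly_right_projective (topspace (base \<U>)) (fibre \<U>)) \<and>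
         (biprojective (field_algebra \<U>) \<longrightarrow>
            uniformly_biprojective (topspace (base \<U>)) (fibre \<U>))"
proof -
  interpret cfield \<U> by unfold_locales (rule assms(1))
  interpret \<A>: banach_algebra \<A> by (rule banach_algebra_field_algebra)
  have quotient: "\<exists>\<sigma> \<tau>. split_quotient \<A> (A x) (\<lambda>y. y x) \<sigma> \<tau>" if "x \<in> \<Omega>" for x
    by (rule fibre_split_quotient[OF assms(2) that])
  have bdd: "bdd_above ((\<lambda>x. op_norm (A x) (W x) (\<rho> x)) ` \<Omega>)"
    if "K \<ge> 0" "\<forall>x\<in>\<Omega>. \<forall>a\<in>carrier (A x). nrm (W x) (\<rho> x a) \<le> K * nrm (A x) a"
    for K and W :: "'x \<Rightarrow> 'w nspace" and \<rho>
    by (rule bdd_aboveI2[of _ _ K]) (use that in \<open>auto intro!: op_norm_le fibre_normed\<close>)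
  show ?thesis
  proof (intro conjI impI)
    assume "left_projective \<A>"
    then obtain \<rho> where \<rho>: "left_module_morphism \<A> \<A> (mult \<A>) (unitization \<A> \<otimes>\<^sub>\<pi> \<A>)
        (tensor_left_action (unitization \<A>) \<A> (plus_left \<A>)) \<rho>" "\<forall>a\<in>carrier \<A>. left_product \<A> (\<rho> a) = a"
      using \<A>.left_projective_splitting by blast
    obtain K where K: "K \<ge> 0" "\<forall>a\<in>carrier \<A>. nrm (unitization \<A> \<otimes>\<^sub>\<pi> \<A>) (\<rho> a) \<le> K * nrm \<A> a"
      using bounded_linear_map_bound[OF \<A>.normed_space_axioms] \<rho>(1)
      unfolding left_module_morphism_def by blast
    have "\<exists>\<rho>'. left_module_morphism (A x) (A x) (mult (A x)) (unitization (A x) \<otimes>\<^sub>\<pi> A x)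
          (tensor_left_action (unitization (A x)) (A x) (plus_left (A x))) \<rho>' \<and>
        (\<forall>a\<in>carrier (A x). left_product (A x) (\<rho>' a) = a) \<and>
        (\<forall>a\<in>carrier (A x). nrm (unitization (A x) \<otimes>\<^sub>\<pi> A x) (\<rho>' a) \<le> K * nrm (A x) a)"
      if "x \<in> \<Omega>" for x
      using quotient[OF that] split_quotient.left_splitting_descends[OF _ \<rho> K(2,1)] by blast
    then obtain \<rho>' where \<rho>': "\<forall>x\<in>\<Omega>. left_module_morphism (A x) (A x) (mult (A x)) (unitization (A x) \<otimes>\<^sub>\<pi> A x)
          (tensor_left_action (unitization (A x)) (A x) (plus_left (A x))) (\<rho>' x) \<and>
        (\<forall>a\<in>carrier (A x). left_product (A x) (\<rho>' x a) = a) \<and>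
        (\<forall>a\<in>carrier (A x). nrm (unitization (A x) \<otimes>\<^sub>\<pi> A x) (\<rho>' x a) \<le> K * nrm (A x) a)"
      by metis
    then show "uniformly_left_projective \<Omega> A"
      unfolding uniformly_left_projective_def by (intro exI[of _ \<rho>'] conjI bdd[OF K(1)]) auto
  next
    assume "right_projective \<A>"
    then obtain \<rho> where \<rho>: "right_module_morphism \<A> \<A> (mult \<A>) (\<A> \<otimes>\<^sub>\<pi> unitization \<A>)
        (tensor_right_action \<A> (unitization \<A>) (plus_right \<A>)) \<rho>" "\<forall>a\<in>carrier \<A>. right_product \<A> (\<rho> a) = a"
      using \<A>.right_projective_splitting by blast
    obtain K where K: "K \<ge> 0" "\<forall>a\<in>carrier \<A>. nrm (\<A> \<otimes>\<^sub>\<pi> unitization \<A>) (\<rho> a) \<le> K * nrm \<A> a"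
      using bounded_linear_map_bound[OF \<A>.normed_space_axioms] \<rho>(1)
      unfolding right_module_morphism_def by blast
    have "\<exists>\<rho>'. right_module_morphism (A x) (A x) (mult (A x)) (A x \<otimes>\<^sub>\<pi> unitization (A x))
          (tensor_right_action (A x) (unitization (A x)) (plus_right (A x))) \<rho>' \<and>
        (\<forall>a\<in>carrier (A x). right_product (A x) (\<rho>' a) = a) \<and>
        (\<forall>a\<in>carrier (A x). nrm (A x \<otimes>\<^sub>\<pi> unitization (A x)) (\<rho>' a) \<le> K * nrm (A x) a)"
      if "x \<in> \<Omega>" for x
      using quotient[OF that] split_quotient.right_splitting_descends[OF _ \<rho> K(2,1)] by blast
    then obtain \<rho>' where \<rho>': "\<forall>x\<in>\<Omega>. right_module_morphism (A x) (A x) (mult (A x)) (A x \<otimes>\<^sub>\<pi> unitization (A x))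
          (tensor_right_action (A x) (unitization (A x)) (plus_right (A x))) (\<rho>' x) \<and>
        (\<forall>a\<in>carrier (A x). right_product (A x) (\<rho>' x a) = a) \<and>
        (\<forall>a\<in>carrier (A x). nrm (A x \<otimes>\<^sub>\<pi> unitization (A x)) (\<rho>' x a) \<le> K * nrm (A x) a)"
      by metis
    then show "uniformly_right_projective \<Omega> A"
      unfolding uniformly_right_projective_def by (intro exI[of _ \<rho>'] conjI bdd[OF K(1)]) auto
  next
    assume "biprojective \<A>"
    then obtain \<rho> where \<rho>: "bimodule_morphism \<A> \<A> (mult \<A>) (mult \<A>) (\<A> \<otimes>\<^sub>\<pi> \<A>)
        (tensor_left_action \<A> \<A> (mult \<A>)) (tensor_right_action \<A> \<A> (mult \<A>)) \<rho>"
        "\<forall>a\<in>carrier \<A>. bi_product \<A> (\<rho> a) = a"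
      using \<A>.biprojective_splitting by blast
    obtain K where K: "K \<ge> 0" "\<forall>a\<in>carrier \<A>. nrm (\<A> \<otimes>\<^sub>\<pi> \<A>) (\<rho> a) \<le> K * nrm \<A> a"
      using bounded_linear_map_bound[OF \<A>.normed_space_axioms] \<rho>(1)
      unfolding bimodule_morphism_def left_module_morphism_def by blast
    have "\<exists>\<rho>'. bimodule_morphism (A x) (A x) (mult (A x)) (mult (A x)) (A x \<otimes>\<^sub>\<pi> A x)
          (tensor_left_action (A x) (A x) (mult (A x))) (tensor_right_action (A x) (A x) (mult (A x))) \<rho>' \<and>
        (\<forall>a\<in>carrier (A x). bi_product (A x) (\<rho>' a) = a) \<and>
        (\<forall>a\<in>carrier (A x). nrm (A x \<otimes>\<^sub>\<pi> A x) (\<rho>' a) \<le> K * nrm (A x) a)"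
      if "x \<in> \<Omega>" for x
      using quotient[OF that] split_quotient.bimodule_splitting_descends[OF _ \<rho> K(2,1)] by blast
    then obtain \<rho>' where \<rho>': "\<forall>x\<in>\<Omega>. bimodule_morphism (A x) (A x) (mult (A x)) (mult (A x)) (A x \<otimes>\<^sub>\<pi> A x)
          (tensor_left_action (A x) (A x) (mult (A x))) (tensor_right_action (A x) (A x) (mult (A x))) (\<rho>' x) \<and>
        (\<forall>a\<in>carrier (A x). bi_product (A x) (\<rho>' x a) = a) \<and>
        (\<forall>a\<in>carrier (A x). nrm (A x \<otimes>\<^sub>\<pi> A x) (\<rho>' x a) \<le> K * nrm (A x) a)"
      by metis
    then show "uniformly_biprojective \<Omega> A"
      unfolding uniformly_biprojective_def by (intro exI[of _ \<rho>'] conjI bdd[OF K(1)]) auto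
  qed
qed

end
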